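(* Let $\Bbbk\to A\xrightarrow{\iota}B\xrightarrow{\pi}C\to\Bbbk$ be an exact sequence of Hopf algebras over a field $\Bbbk$, with $B$ faithfully coflat as a right $C$-comodule (via $(\mathrm{id}\otimes\pi)\Delta$). Then $B$ is co-Frobenius if and only if $A$ and $C$ are co-Frobenius.
   Context: A sequence of Hopf algebra maps $\Bbbk\to A\xrightarrow{\iota}B\xrightarrow{\pi}C\to\Bbbk$ is exact if $\iota$ is injective, $\pi$ is surjective, $\ker\pi=B\iota(A)^+$ (where $A^+=\ker\varepsilon_A$), and $B^{\mathrm{co}\,C}:=\{b\in B:(\mathrm{id}\otimes\pi)\Delta(b)=b\otimes1\}=\iota(A)$. A Hopf algebra $L$ is co-Frobenius if there is a nonzero linear map $\int:L\to\Bbbk$ with $\int(h_{(2)})h_{(1)}=\int(h)1_L$ for all $h\in L$. *)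

theory Defs
  imports Main
begin

text \<open>A vector space with basis indexed by a set I of some type 'i over a field 'k is
  modelled as the finitely supported functions 'i => 'k supported in I.
  The tensor product of spaces with bases 'i and 'j is the space with basis 'i * 'j.
  Every vector space has a basis, so this covers all Hopf algebras up to isomorphism.\<close>

definition supp :: "('i \<Rightarrow> 'k::zero) \<Rightarrow> 'i set" where
  "supp v = {i. v i \<noteq> 0}"

definition vecs_on :: "'i set \<Rightarrow> ('i \<Rightarrow> 'k::zero) set" where
  "vecs_on I = {v. finite (supp v) \<and> supp v \<subseteq> I}"

abbreviation vecs :: "('i \<Rightarrow> 'k::zero) set" where
  "vecs \<equiv> vecs_on UNIV"

definition bvec :: "'i \<Rightarrow> 'i \<Rightarrow> 'k::zero_neq_one" where
  "bvec i = (\<lambda>j. if j = i then 1 else 0)"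

definition vzero :: "'i \<Rightarrow> 'k::zero" where
  "vzero = (\<lambda>i. 0)"

definition vadd :: "('i \<Rightarrow> 'k::plus) \<Rightarrow> ('i \<Rightarrow> 'k) \<Rightarrow> ('i \<Rightarrow> 'k)" where
  "vadd u v = (\<lambda>i. u i + v i)"

definition vsmul :: "'k::times \<Rightarrow> ('i \<Rightarrow> 'k) \<Rightarrow> ('i \<Rightarrow> 'k)" where
  "vsmul c v = (\<lambda>i. c * v i)"

definition lspan :: "('i \<Rightarrow> 'k::comm_semiring_1) set \<Rightarrow> ('i \<Rightarrow> 'k) set" where
  "lspan S = {(\<lambda>i. \<Sum>x\<in>F. c x * x i) | F c. finite F \<and> F \<subseteq> S}"

definition linext :: "('i \<Rightarrow> 'j \<Rightarrow> 'k::comm_semiring_1) \<Rightarrow> ('i \<Rightarrow> 'k) \<Rightarrow> 'j \<Rightarrow> 'k" where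
  "linext F v = (\<lambda>j. \<Sum>i\<in>supp v. v i * F i j)"

definition tens :: "('i \<Rightarrow> 'k::times) \<Rightarrow> ('j \<Rightarrow> 'k) \<Rightarrow> ('i \<times> 'j \<Rightarrow> 'k)" where
  "tens v w = (\<lambda>(a, b). v a * w b)"

definition tmap :: "(('i \<Rightarrow> 'k) \<Rightarrow> ('i2 \<Rightarrow> 'k)) \<Rightarrow> (('j \<Rightarrow> 'k) \<Rightarrow> ('j2 \<Rightarrow> 'k))
     \<Rightarrow> ('i \<times> 'j \<Rightarrow> 'k::comm_semiring_1) \<Rightarrow> ('i2 \<times> 'j2 \<Rightarrow> 'k)" where
  "tmap f g = linext (\<lambda>(a, b). tens (f (bvec a)) (g (bvec b)))"

definition lin_on :: "'i set \<Rightarrow> 'j set \<Rightarrow> (('i \<Rightarrow> 'k::field) \<Rightarrow> ('j \<Rightarrow> 'k)) \<Rightarrow> bool" where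
  "lin_on I J f \<longleftrightarrow>
     (\<forall>v\<in>vecs_on I. f v \<in> vecs_on J) \<and>
     (\<forall>u\<in>vecs_on I. \<forall>v\<in>vecs_on I. f (vadd u v) = vadd (f u) (f v)) \<and>
     (\<forall>c. \<forall>v\<in>vecs_on I. f (vsmul c v) = vsmul c (f v))"

abbreviation lin :: "(('i \<Rightarrow> 'k::field) \<Rightarrow> ('j \<Rightarrow> 'k)) \<Rightarrow> bool" where
  "lin f \<equiv> lin_on UNIV UNIV f"

definition lfun :: "(('i \<Rightarrow> 'k::field) \<Rightarrow> 'k) \<Rightarrow> bool" where
  "lfun l \<longleftrightarrow>
     (\<forall>u\<in>vecs. \<forall>v\<in>vecs. l (vadd u v) = l u + l v) \<and>
     (\<forall>c. \<forall>v\<in>vecs. l (vsmul c v) = c * l v)"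

record ('i, 'k) hopf =
  hmul    :: "('i \<Rightarrow> 'k) \<Rightarrow> ('i \<Rightarrow> 'k) \<Rightarrow> ('i \<Rightarrow> 'k)"
  hone    :: "'i \<Rightarrow> 'k"
  hcomul  :: "('i \<Rightarrow> 'k) \<Rightarrow> ('i \<times> 'i \<Rightarrow> 'k)"
  hcounit :: "('i \<Rightarrow> 'k) \<Rightarrow> 'k"
  hanti   :: "('i \<Rightarrow> 'k) \<Rightarrow> ('i \<Rightarrow> 'k)"

definition mulT :: "('i, 'k::field) hopf \<Rightarrow> ('i \<times> 'i \<Rightarrow> 'k) \<Rightarrow> ('i \<Rightarrow> 'k)" where
  "mulT H = linext (\<lambda>(a, b). hmul H (bvec a) (bvec b))"

definition tmul :: "('i, 'k::field) hopf \<Rightarrow> ('i \<times> 'i \<Rightarrow> 'k) \<Rightarrow> ('i \<times> 'i \<Rightarrow> 'k) \<Rightarrow> ('i \<times> 'i \<Rightarrow> 'k)" where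
  "tmul H s t = linext (\<lambda>(a, b). linext (\<lambda>(c, d).
       tens (hmul H (bvec a) (bvec c)) (hmul H (bvec b) (bvec d))) t) s"

definition epsL :: "('i, 'k::field) hopf \<Rightarrow> ('i \<times> 'j \<Rightarrow> 'k) \<Rightarrow> ('j \<Rightarrow> 'k)" where
  "epsL H = linext (\<lambda>(a, b). vsmul (hcounit H (bvec a)) (bvec b))"

definition epsR :: "('i, 'k::field) hopf \<Rightarrow> ('j \<times> 'i \<Rightarrow> 'k) \<Rightarrow> ('j \<Rightarrow> 'k)" where
  "epsR H = linext (\<lambda>(a, b). vsmul (hcounit H (bvec b)) (bvec a))"

definition hopf_alg :: "('i, 'k::field) hopf \<Rightarrow> bool" where
  "hopf_alg H \<longleftrightarrow>
     (\<forall>u\<in>vecs. lin (hmul H u)) \<and> (\<forall>v\<in>vecs. lin (\<lambda>u. hmul H u v)) \<and>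
     hone H \<in> vecs \<and>
     (\<forall>u\<in>vecs. \<forall>v\<in>vecs. \<forall>w\<in>vecs. hmul H (hmul H u v) w = hmul H u (hmul H v w)) \<and>
     (\<forall>v\<in>vecs. hmul H (hone H) v = v \<and> hmul H v (hone H) = v) \<and>
     lin (hcomul H) \<and> lfun (hcounit H) \<and>
     (\<forall>v\<in>vecs. \<forall>a b c.
        tmap (hcomul H) id (hcomul H v) ((a, b), c) = tmap id (hcomul H) (hcomul H v) (a, (b, c))) \<and>
     (\<forall>v\<in>vecs. epsL H (hcomul H v) = v \<and> epsR H (hcomul H v) = v) \<and>
     (\<forall>u\<in>vecs. \<forall>v\<in>vecs. hcomul H (hmul H u v) = tmul H (hcomul H u) (hcomul H v)) \<and>
     hcomul H (hone H) = tens (hone H) (hone H) \<and>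
     (\<forall>u\<in>vecs. \<forall>v\<in>vecs. hcounit H (hmul H u v) = hcounit H u * hcounit H v) \<and>
     hcounit H (hone H) = 1 \<and>
     lin (hanti H) \<and>
     (\<forall>v\<in>vecs. mulT H (tmap (hanti H) id (hcomul H v)) = vsmul (hcounit H v) (hone H) \<and>
                mulT H (tmap id (hanti H) (hcomul H v)) = vsmul (hcounit H v) (hone H))"

definition hopf_map :: "('i, 'k::field) hopf \<Rightarrow> ('j, 'k) hopf \<Rightarrow> (('i \<Rightarrow> 'k) \<Rightarrow> ('j \<Rightarrow> 'k)) \<Rightarrow> bool" where
  "hopf_map H1 H2 f \<longleftrightarrow>
     lin f \<and>
     (\<forall>u\<in>vecs. \<forall>v\<in>vecs. f (hmul H1 u v) = hmul H2 (f u) (f v)) \<and>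
     f (hone H1) = hone H2 \<and>
     (\<forall>v\<in>vecs. hcomul H2 (f v) = tmap f f (hcomul H1 v)) \<and>
     (\<forall>v\<in>vecs. hcounit H2 (f v) = hcounit H1 v) \<and>
     (\<forall>v\<in>vecs. f (hanti H1 v) = hanti H2 (f v))"

definition exact_seq :: "('a, 'k::field) hopf \<Rightarrow> ('b, 'k) hopf \<Rightarrow> ('c, 'k) hopf
     \<Rightarrow> (('a \<Rightarrow> 'k) \<Rightarrow> ('b \<Rightarrow> 'k)) \<Rightarrow> (('b \<Rightarrow> 'k) \<Rightarrow> ('c \<Rightarrow> 'k)) \<Rightarrow> bool" where
  "exact_seq A B C \<iota> \<pi> \<longleftrightarrow>
     inj_on \<iota> vecs \<and>
     \<pi> ` vecs = vecs \<and>
     {b\<in>vecs. \<pi> b = vzero} =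
        lspan {hmul B b (\<iota> a) | a b. a \<in> vecs \<and> b \<in> vecs \<and> hcounit A a = 0} \<and>
     {b\<in>vecs. tmap id \<pi> (hcomul B b) = tens b (hone C)} = \<iota> ` vecs"

definition lcomod :: "('c, 'k::field) hopf \<Rightarrow> nat set \<Rightarrow> ((nat \<Rightarrow> 'k) \<Rightarrow> ('c \<times> nat \<Rightarrow> 'k)) \<Rightarrow> bool" where
  "lcomod C I lam \<longleftrightarrow>
     lin_on I (UNIV \<times> I) lam \<and>
     (\<forall>n\<in>vecs_on I. \<forall>c1 c2 x.
        tmap (hcomul C) id (lam n) ((c1, c2), x) = tmap id lam (lam n) (c1, (c2, x))) \<and>
     (\<forall>n\<in>vecs_on I. epsL C (lam n) = n)"

definition lcomod_map :: "nat set \<Rightarrow> ((nat \<Rightarrow> 'k) \<Rightarrow> ('c \<times> nat \<Rightarrow> 'k)) \<Rightarrow> nat set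
     \<Rightarrow> ((nat \<Rightarrow> 'k) \<Rightarrow> ('c \<times> nat \<Rightarrow> 'k)) \<Rightarrow> ((nat \<Rightarrow> 'k::field) \<Rightarrow> (nat \<Rightarrow> 'k)) \<Rightarrow> bool" where
  "lcomod_map I lam J lam' f \<longleftrightarrow>
     lin_on I J f \<and> (\<forall>n\<in>vecs_on I. lam' (f n) = tmap id f (lam n))"

definition rcoact :: "('b, 'k::field) hopf \<Rightarrow> (('b \<Rightarrow> 'k) \<Rightarrow> ('c \<Rightarrow> 'k)) \<Rightarrow> ('b \<Rightarrow> 'k) \<Rightarrow> ('b \<times> 'c \<Rightarrow> 'k)" where
  "rcoact B \<pi> v = tmap id \<pi> (hcomul B v)"

definition cotensor :: "('b, 'k::field) hopf \<Rightarrow> (('b \<Rightarrow> 'k) \<Rightarrow> ('c \<Rightarrow> 'k)) \<Rightarrow> nat set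
     \<Rightarrow> ((nat \<Rightarrow> 'k) \<Rightarrow> ('c \<times> nat \<Rightarrow> 'k)) \<Rightarrow> ('b \<times> nat \<Rightarrow> 'k) set" where
  "cotensor B \<pi> I lam = {t \<in> vecs_on (UNIV \<times> I). \<forall>b c x.
      tmap (rcoact B \<pi>) id t ((b, c), x) = tmap id lam t (b, (c, x))}"

definition faithfully_coflat :: "('b, 'k::field) hopf \<Rightarrow> ('c, 'k) hopf \<Rightarrow> (('b \<Rightarrow> 'k) \<Rightarrow> ('c \<Rightarrow> 'k)) \<Rightarrow> bool" where
  "faithfully_coflat B C \<pi> \<longleftrightarrow>
     (\<forall>I1 I2 I3 lam1 lam2 lam3 f g.
        lcomod C I1 lam1 \<and> lcomod C I2 lam2 \<and> lcomod C I3 lam3 \<and>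
        lcomod_map I1 lam1 I2 lam2 f \<and> lcomod_map I2 lam2 I3 lam3 g \<longrightarrow>
        ((f ` vecs_on I1 = {n \<in> vecs_on I2. g n = vzero}) \<longleftrightarrow>
         (tmap id f ` cotensor B \<pi> I1 lam1 =
            {t \<in> cotensor B \<pi> I2 lam2. tmap id g t = vzero})))"

definition cofrob :: "('i, 'k::field) hopf \<Rightarrow> bool" where
  "cofrob H \<longleftrightarrow> (\<exists>l. lfun l \<and> (\<exists>v\<in>vecs. l v \<noteq> 0) \<and>
      (\<forall>h\<in>vecs. linext (\<lambda>(a, b). vsmul (l (bvec b)) (bvec a)) (hcomul H h) = vsmul (l h) (hone H)))"

end

theory Submission
  imports Defs "HOL-Library.Function_Algebras" "HOL.Vector_Spaces"
begin

text \<open>Coflatness, applied to duals of finite-dimensional comodules, says that right colinear maps into \<open>B\<close>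
  extend along inclusions of finite-dimensional subcomodules; by Zorn's lemma there is a right colinear map
  \<open>\<phi> : C \<rightarrow> B\<close> with \<open>\<phi>(1) = 1\<close>. Given integrals on \<open>A\<close> and \<open>C\<close>, the map \<open>E(b) = b\<^sub>1 \<integral>\<^sub>C \<pi>(b\<^sub>2)\<close> takes values in
  the coinvariants \<open>A\<close>, and \<open>\<integral>\<^sub>A \<circ> E\<close> is an integral on \<open>B\<close> with \<open>\<integral>\<^sub>A E(\<phi>(c) a) = \<integral>\<^sub>C c \<cdot> \<integral>\<^sub>A a\<close>. Conversely,
  for an integral on \<open>B\<close> and a fixed \<open>v\<close> with \<open>\<integral> v \<noteq> 0\<close>, the functionals \<open>a \<mapsto> \<integral>(v \<iota>(a))\<close> on \<open>A\<close> and, after passing to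
  left integrals, \<open>c \<mapsto> \<integral>(v \<phi>(c))\<close> on \<open>C\<close> are rational and nonzero at \<open>1\<close>; projecting the Hopf module of
  rational functionals onto its coinvariants yields nonzero integrals. The exchange of left and right
  integrals rests on the injectivity of the antipode.\<close>

subsection \<open>Sweedler sums\<close>

text \<open>The dual of an infinite-dimensional right comodule need not be a left comodule, so
  coflatness cannot extend the unit map to all of \<open>C\<close> in one step; this forces the
  detour through finite pieces. The map \<open>\<phi>\<close> stands in for a splitting of
  \<open>\<pi>\<close>, although it is only colinear: \<open>\<phi>(c1) \<otimes> c2 = \<phi>(c)1
  \<otimes> \<pi>(\<phi>(c)2)\<close>. Here the leg that stays in \<open>B\<close> is the first one,
  whereas an integral evaluates the second leg. This mismatch, absent for the coalgebra map
  \<open>\<iota>\<close>, is the reason for changing sides in the quotient case. A change of side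
  replaces an integral \<open>L\<close> by \<open>L \<circ> S\<close>, which might vanish. For this
  reason the projection argument records its result as \<open>L(S(z)) \<noteq> 0\<close> for some
  \<open>z\<close>, which follows from evaluating the reconstruction of a functional from its
  projections at \<open>1\<close>. The mirrored invariance of \<open>L \<circ> S\<close> is at first
  visible only after applying \<open>S\<close> to it, and here injectivity of the antipode
  enters.\<close>

lemma supp_iff [simp]: "i \<in> supp v \<longleftrightarrow> v i \<noteq> 0"
  by (simp add: supp_def)

lemma vecs_iff: "v \<in> vecs \<longleftrightarrow> finite (supp v)"
  by (simp add: vecs_on_def)

lemma supp_bvec [simp]: "supp (bvec i :: 'i \<Rightarrow> 'k::zero_neq_one) = {i}"
  by (auto simp: supp_def bvec_def)

lemma bvec_vecs [simp]: "bvec i \<in> vecs"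
  by (simp add: vecs_iff)

lemma bvec_apply: "bvec i j = (if j = i then 1 else 0)"
  by (simp add: bvec_def)

lemma vadd_vecs [simp]: "u \<in> vecs \<Longrightarrow> v \<in> vecs \<Longrightarrow> vadd u v \<in> vecs"
  for u v :: "'i \<Rightarrow> 'k::field"
  unfolding vecs_iff
  by (rule finite_subset[of _ "supp u \<union> supp v"]) (auto simp: vadd_def)

lemma vsmul_vecs [simp]: "v \<in> vecs \<Longrightarrow> vsmul c v \<in> vecs"
  for v :: "'i \<Rightarrow> 'k::field"
  unfolding vecs_iff
  by (rule finite_subset[of _ "supp v"]) (auto simp: vsmul_def)

lemma vzero_vecs [simp]: "vzero \<in> vecs"
  by (simp add: vecs_iff vzero_def supp_def)

lemma sum_vecs:
  fixes f :: "'x \<Rightarrow> 'i \<Rightarrow> 'k::field"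
  assumes "\<And>x. x \<in> X \<Longrightarrow> f x \<in> vecs"
  shows "(\<lambda>i. \<Sum>x\<in>X. f x i) \<in> vecs"
proof (cases "finite X")
  case True
  have "supp (\<lambda>i. \<Sum>x\<in>X. f x i) \<subseteq> (\<Union>x\<in>X. supp (f x))"
    by (auto simp: supp_def intro: ccontr elim: sum.not_neutral_contains_not_neutral)
  then show ?thesis
    using True assms by (auto simp: vecs_iff intro: finite_subset)
qed (simp add: vecs_iff supp_def)

lemma tens_vecs [simp]: "u \<in> vecs \<Longrightarrow> v \<in> vecs \<Longrightarrow> tens u v \<in> vecs"
  for u :: "'i \<Rightarrow> 'k::field"
  unfolding vecs_iff
  by (rule finite_subset[of _ "supp u \<times> supp v"]) (auto simp: tens_def)

lemma lin_vecs: "lin f \<Longrightarrow> v \<in> vecs \<Longrightarrow> f v \<in> vecs"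
  by (simp add: lin_on_def)

lemma lfun_vadd: "lfun l \<Longrightarrow> u \<in> vecs \<Longrightarrow> v \<in> vecs \<Longrightarrow> l (vadd u v) = l u + l v"
  by (simp add: lfun_def)

lemma lfun_vsmul: "lfun l \<Longrightarrow> v \<in> vecs \<Longrightarrow> l (vsmul c v) = c * l v"
  by (simp add: lfun_def)

lemma lfun_vzero: "lfun l \<Longrightarrow> l vzero = 0"
proof -
  assume l: "lfun l"
  have "vsmul 0 vzero = (vzero :: 'a \<Rightarrow> 'b)" by (simp add: vsmul_def vzero_def)
  then show ?thesis using lfun_vsmul[OF l, of vzero 0] by simp
qed

lemma lfun_sum:
  assumes l: "lfun l" and "finite X" "\<And>x. x \<in> X \<Longrightarrow> f x \<in> vecs"
  shows "l (\<lambda>i. \<Sum>x\<in>X. c x * f x i) = (\<Sum>x\<in>X. c x * l (f x))"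
  using assms(2,3)
proof (induction X rule: finite_induct)
  case empty
  show ?case using lfun_vzero[OF l] by (simp add: vzero_def)
next
  case (insert x X)
  have v: "(\<lambda>i. \<Sum>y\<in>X. c y * f y i) \<in> vecs"
    using sum_vecs[of X "\<lambda>y. vsmul (c y) (f y)"] insert.prems vsmul_vecs[of "f _"]
    by (simp add: vsmul_def)
  have "(\<lambda>i. \<Sum>y\<in>insert x X. c y * f y i) = vadd (vsmul (c x) (f x)) (\<lambda>i. \<Sum>y\<in>X. c y * f y i)"
    using insert.hyps by (simp add: vadd_def vsmul_def fun_eq_iff)
  then show ?case
    using insert v by (simp add: lfun_vadd[OF l] lfun_vsmul[OF l])
qed

lemma lfun_expand:
  assumes "lfun l" "v \<in> vecs" "finite K" "supp v \<subseteq> K"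
  shows "l v = (\<Sum>i\<in>K. v i * l (bvec i))"
proof -
  have "v = (\<lambda>j. \<Sum>i\<in>K. v i * bvec i j)"
    using assms(3,4) by (auto simp: bvec_apply fun_eq_iff if_distrib cong: if_cong)
  then have "l v = l (\<lambda>j. \<Sum>i\<in>K. v i * bvec i j)" by simp
  also have "\<dots> = (\<Sum>i\<in>K. v i * l (bvec i))"
    by (rule lfun_sum) (use assms in auto)
  finally show ?thesis .
qed

lemma lfun_eqI:
  assumes "lfun l" "lfun l'" "\<And>i. l (bvec i) = l' (bvec i)" "v \<in> vecs"
  shows "l v = l' v"
  using lfun_expand[OF assms(1,4), of "supp v"] lfun_expand[OF assms(2,4), of "supp v"] assms(3,4)
  by (simp add: vecs_iff)

lemma linext_lfun: 
  fixes F :: "'i \<Rightarrow> 'j \<Rightarrow> 'k::field"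
  assumes "lfun G" "\<And>i. F i \<in> vecs" "t \<in> vecs"
  shows "G (linext F t) = (\<Sum>i\<in>supp t. t i * G (F i))"
  unfolding linext_def using assms by (intro lfun_sum) (auto simp: vecs_iff)

lemma sum_supp_mono:
  fixes t :: "'i \<Rightarrow> 'k::field"
  assumes "finite K" "supp t \<subseteq> K"
  shows "(\<Sum>i\<in>supp t. t i * F i) = (\<Sum>i\<in>K. t i * F i)"
  using assms by (intro sum.mono_neutral_left) auto

text \<open>Cancellation can make the support of a sum smaller than the union of the supports, so
  both sides are computed over one common finite index set.\<close>

lemma lfun_weighted_sum: "lfun (\<lambda>t. \<Sum>i\<in>supp t. t i * F i)" for F :: "'i \<Rightarrow> 'k::field"
  unfolding lfun_def
proof (intro conjI ballI allI)
  fix u v :: "'i \<Rightarrow> 'k" assume uv: "u \<in> vecs" "v \<in> vecs"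
  let ?K = "supp u \<union> supp v"
  have K: "finite ?K" using uv by (simp add: vecs_iff)
  have "supp (vadd u v) \<subseteq> ?K" by (auto simp: vadd_def)
  then show "(\<Sum>i\<in>supp (vadd u v). vadd u v i * F i) = (\<Sum>i\<in>supp u. u i * F i) + (\<Sum>i\<in>supp v. v i * F i)"
    using sum_supp_mono[OF K, of "vadd u v" F] sum_supp_mono[OF K, of u F] sum_supp_mono[OF K, of v F]
    by (simp add: vadd_def distrib_right sum.distrib)
next
  fix c and v :: "'i \<Rightarrow> 'k" assume v: "v \<in> vecs"
  have "supp (vsmul c v) \<subseteq> supp v" by (auto simp: vsmul_def)
  then show "(\<Sum>i\<in>supp (vsmul c v). vsmul c v i * F i) = c * (\<Sum>i\<in>supp v. v i * F i)"
    using v sum_supp_mono[of "supp v" "vsmul c v" F]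
    by (simp add: vecs_iff vsmul_def sum_distrib_left mult.assoc)
qed

lemma lin_linext:
  fixes F :: "'i \<Rightarrow> 'j \<Rightarrow> 'k::field"
  assumes "\<And>i. F i \<in> vecs" shows "lin (linext F)"
proof -
  have "linext F v \<in> vecs" if "v \<in> vecs" for v
    unfolding linext_def using sum_vecs[of "supp v" "\<lambda>i. vsmul (v i) (F i)"] vsmul_vecs[OF assms]
    by (simp add: vsmul_def)
  moreover have "lfun (\<lambda>t. linext F t j)" for j
    unfolding linext_def by (rule lfun_weighted_sum)
  ultimately show ?thesis
    by (auto simp: lin_on_def lfun_def vadd_def vsmul_def fun_eq_iff)
qed

text \<open>For \<open>t = \<Delta> d\<close> the scalar \<open>tsum t F\<close> is \<open>F d\<^sub>1 d\<^sub>2\<close>; vector-valued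
  identities are tested against linear forms, so scalar-valued multilinear \<open>F\<close> suffice.\<close>

definition tsum :: "('i \<times> 'j \<Rightarrow> 'k) \<Rightarrow> (('i \<Rightarrow> 'k) \<Rightarrow> ('j \<Rightarrow> 'k) \<Rightarrow> 'k) \<Rightarrow> 'k::field" where
  "tsum t F = (\<Sum>p\<in>supp t. t p * F (bvec (fst p)) (bvec (snd p)))"

definition bilin :: "(('i \<Rightarrow> 'k::field) \<Rightarrow> ('j \<Rightarrow> 'k) \<Rightarrow> 'k) \<Rightarrow> bool" where
  "bilin F \<longleftrightarrow> (\<forall>y\<in>vecs. lfun (\<lambda>x. F x y)) \<and> (\<forall>x\<in>vecs. lfun (F x))"

definition trilin :: "(('i \<Rightarrow> 'k::field) \<Rightarrow> ('j \<Rightarrow> 'k) \<Rightarrow> ('l \<Rightarrow> 'k) \<Rightarrow> 'k) \<Rightarrow> bool" where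
  "trilin F \<longleftrightarrow> (\<forall>y\<in>vecs. \<forall>z\<in>vecs. lfun (\<lambda>x. F x y z)) \<and> (\<forall>x\<in>vecs. \<forall>z\<in>vecs. lfun (\<lambda>y. F x y z))
     \<and> (\<forall>x\<in>vecs. \<forall>y\<in>vecs. lfun (\<lambda>z. F x y z))"

lemma bilinI: 
  "(\<And>y. y \<in> vecs \<Longrightarrow> lfun (\<lambda>x. F x y)) \<Longrightarrow> (\<And>x. x \<in> vecs \<Longrightarrow> lfun (\<lambda>y. F x y)) \<Longrightarrow> bilin F"
  by (simp add: bilin_def)

lemma trilinI: 
  "(\<And>y z. y \<in> vecs \<Longrightarrow> z \<in> vecs \<Longrightarrow> lfun (\<lambda>x. F x y z)) \<Longrightarrow> 
   (\<And>x z. x \<in> vecs \<Longrightarrow> z \<in> vecs \<Longrightarrow> lfun (\<lambda>y. F x y z)) \<Longrightarrow>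
   (\<And>x y. x \<in> vecs \<Longrightarrow> y \<in> vecs \<Longrightarrow> lfun (\<lambda>z. F x y z)) \<Longrightarrow> trilin F"
  by (simp add: trilin_def)

lemma tsum_cong:
  "(\<And>x y. x \<in> vecs \<Longrightarrow> y \<in> vecs \<Longrightarrow> F x y = G x y) \<Longrightarrow> tsum t F = tsum t G"
  by (simp add: tsum_def)

lemma lin_id [simp]: "lin (\<lambda>x. x)" "lin id"
  by (simp_all add: lin_on_def)

lemma lfun_mult_left: "lfun f \<Longrightarrow> lfun (\<lambda>x. c * f x)"
  by (simp add: lfun_def distrib_left mult.left_commute)

lemma lfun_mult_right: "lfun f \<Longrightarrow> lfun (\<lambda>x. f x * c)"
  by (simp add: lfun_def distrib_right mult.assoc)

lemma lfun_setsum: "(\<And>i. i \<in> X \<Longrightarrow> lfun (f i)) \<Longrightarrow> lfun (\<lambda>x. \<Sum>i\<in>X. f i x)"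
  by (simp add: lfun_def sum.distrib sum_distrib_left)

lemma lfun_tsum: "lfun (\<lambda>t. tsum t F)"
  unfolding tsum_def by (rule lfun_weighted_sum)

lemma lfun_comp: "lfun l \<Longrightarrow> lin f \<Longrightarrow> lfun (\<lambda>x. l (f x))"
  by (simp add: lfun_def lin_on_def)

lemma lin_comp: "lin g \<Longrightarrow> lin f \<Longrightarrow> lin (\<lambda>x. g (f x))"
  by (simp add: lin_on_def)

lemma lfun_coord: "lfun (\<lambda>x. x j)"
  by (simp add: lfun_def vadd_def vsmul_def)

lemma lfun_tsum_arg: "lin f \<Longrightarrow> lfun (\<lambda>x. tsum (f x) F)"
  by (rule lfun_comp[OF lfun_tsum])

lemma lfun_tsum_form:
  "(\<And>a b. a \<in> vecs \<Longrightarrow> b \<in> vecs \<Longrightarrow> lfun (\<lambda>x. F x a b)) \<Longrightarrow> lfun (\<lambda>x. tsum t (\<lambda>a b. F x a b))"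
  unfolding tsum_def by (intro lfun_setsum lfun_mult_left) auto

lemma tsum_bvec: "tsum (bvec (a, b)) F = F (bvec a) (bvec b)"
  by (simp add: tsum_def bvec_apply)

lemma tsum_tens:
  assumes "bilin F" "u \<in> vecs" "v \<in> vecs"
  shows "tsum (tens u v) F = F u v"
proof -
  have 1: "lfun (\<lambda>x. F x y)" if "y \<in> vecs" for y using assms that by (simp add: bilin_def)
  have 2: "lfun (F x)" if "x \<in> vecs" for x using assms that by (simp add: bilin_def)
  have "tsum (tens u v) F = (\<Sum>p\<in>supp u \<times> supp v. tens u v p * F (bvec (fst p)) (bvec (snd p)))"
    unfolding tsum_def using assms by (intro sum_supp_mono) (auto simp: vecs_iff tens_def)
  also have "\<dots> = (\<Sum>i\<in>supp u. u i * (\<Sum>j\<in>supp v. v j * F (bvec i) (bvec j)))"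
    by (simp add: sum.cartesian_product split_def tens_def sum_distrib_left mult.assoc)
  also have "\<dots> = F u v"
    using assms lfun_expand[OF 1[OF assms(3)] assms(2)] lfun_expand[OF 2 assms(3)]
    by (simp add: vecs_iff)
  finally show ?thesis .
qed

lemma lin_tmap: "lin f \<Longrightarrow> lin g \<Longrightarrow> lin (tmap f g)"
  unfolding tmap_def by (rule lin_linext) (auto simp: lin_vecs)

lemma tmap_bvec: "tmap f g (bvec (a, b)) = tens (f (bvec a)) (g (bvec b))"
  by (simp add: tmap_def linext_def bvec_apply)

lemma tsum_tmap:
  assumes "bilin F" "lin f" "lin g" "t \<in> vecs"
  shows "tsum (tmap f g t) F = tsum t (\<lambda>x y. F (f x) (g y))"
proof (rule lfun_eqI[OF _ _ _ \<open>t \<in> vecs\<close>])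
  show "lfun (\<lambda>t. tsum (tmap f g t) F)"
    by (intro lfun_comp[OF lfun_tsum] lin_tmap assms)
  show "lfun (\<lambda>t. tsum t (\<lambda>x y. F (f x) (g y)))" by (rule lfun_tsum)
  show "tsum (tmap f g (bvec i)) F = tsum (bvec i) (\<lambda>x y. F (f x) (g y))" for i
    using assms by (cases i) (simp add: tmap_bvec tsum_bvec tsum_tens lin_vecs)
qed

lemma tmap_coord: "tmap f g t (i, j) = tsum t (\<lambda>x y. f x i * g y j)"
  by (simp add: tmap_def linext_def tsum_def split_def tens_def)

lemma tsum_coord: "t \<in> vecs \<Longrightarrow> tsum t (\<lambda>x y. x i * y j) = t (i, j)"
proof (rule lfun_eqI[where v = t and l = "\<lambda>t. tsum t (\<lambda>x y. x i * y j)", OF lfun_tsum lfun_coord])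
  fix p :: "'a \<times> 'b"
  show "tsum (bvec p) (\<lambda>x y. x i * y j) = bvec p (i, j)"
    by (cases p) (auto simp: tsum_bvec bvec_apply)
qed

lemma bilin_coord: "bilin (\<lambda>x y. x i * y j)"
  by (intro bilinI lfun_mult_left lfun_mult_right lfun_coord)

lemma tens_coord: "tens u v (i, j) = u i * v j"
  by (simp add: tens_def)

lemma tsum_swap: "tsum s (\<lambda>x y. tsum t (\<lambda>a b. F x y a b)) = tsum t (\<lambda>a b. tsum s (\<lambda>x y. F x y a b))"
  unfolding tsum_def sum_distrib_left by (subst sum.swap) (simp add: mult.left_commute)

lemma tsum_mult_left: "tsum t (\<lambda>x y. c * F x y) = c * tsum t F"
  by (simp add: tsum_def sum_distrib_left mult.left_commute)

lemma tsum_mult_right: "tsum t (\<lambda>x y. F x y * c) = tsum t F * c"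
  by (simp add: tsum_def sum_distrib_right mult.assoc)

lemma tsum_sum: "tsum t (\<lambda>x y. \<Sum>i\<in>X. F i x y) = (\<Sum>i\<in>X. tsum t (F i))"
  unfolding tsum_def sum_distrib_left by (rule sum.swap)

text \<open>Only values at basis vectors enter \<open>tsum\<close>, so \<open>F\<close> may be
  arbitrary here. Writing one leg in coordinates decouples it from the other leg; afterwards finite
  index sets and vanishing statements can be applied to one leg at a time.\<close>

lemma tsum_expand_left:
  assumes "t \<in> vecs" "finite K" "fst ` supp t \<subseteq> K"
  shows "tsum t F = (\<Sum>i\<in>K. tsum t (\<lambda>x y. x i * F (bvec i) y))"
proof -
  have "tsum t (\<lambda>x y. \<Sum>i\<in>K. x i * F (bvec i) y) = tsum t F"
    unfolding tsum_def
  proof (rule sum.cong[OF refl])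
    fix p assume "p \<in> supp t"
    then have "fst p \<in> K" using assms(3) by auto
    then show "t p * (\<Sum>i\<in>K. bvec (fst p) i * F (bvec i) (bvec (snd p))) = t p * F (bvec (fst p)) (bvec (snd p))"
      using assms(2) by (simp add: bvec_apply if_distrib[of "\<lambda>c. c * _"] cong: if_cong)
  qed
  then show ?thesis by (simp add: tsum_sum)
qed

definition flip :: "('i \<times> 'j \<Rightarrow> 'k) \<Rightarrow> ('j \<times> 'i \<Rightarrow> 'k)" where
  "flip t = (\<lambda>(a, b). t (b, a))"

lemma supp_flip: "supp (flip t) = prod.swap ` supp t"
  by (force simp: flip_def supp_def)

lemma tsum_flip: "tsum (flip t) F = tsum t (\<lambda>x y. F y x)"
  unfolding tsum_def supp_flip by (subst sum.reindex) (auto simp: flip_def split_def)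

lemma flip_vecs [simp]: "t \<in> vecs \<Longrightarrow> flip t \<in> vecs"
  by (simp add: vecs_iff supp_flip)

lemma lin_flip: "lin flip"
  by (auto simp: lin_on_def vecs_iff supp_flip) (auto simp: flip_def vadd_def vsmul_def)

lemma tsum_expand_right:
  assumes "t \<in> vecs" "finite K" "snd ` supp t \<subseteq> K"
  shows "tsum t F = (\<Sum>i\<in>K. tsum t (\<lambda>x y. y i * F x (bvec i)))"
  using tsum_expand_left[of "flip t" K "\<lambda>x y. F y x"] assms
  by (simp add: tsum_flip supp_flip image_image)

text \<open>The two bracketings live over different index types; rebracketing triples is a bijection
  between the supports.\<close>

lemma tsum_assoc:
  fixes s :: "('i \<times> 'j) \<times> 'l \<Rightarrow> 'k::field"
  assumes "\<And>a b c. s ((a, b), c) = t (a, (b, c))"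
  shows "tsum s (\<lambda>u z. tsum u (\<lambda>x y. F x y z)) = tsum t (\<lambda>x u. tsum u (\<lambda>y z. F x y z))"
proof -
  have t: "supp t = (\<lambda>((a, b), c). (a, (b, c))) ` supp s"
  proof safe
    fix a b c assume "(a, (b, c)) \<in> supp t"
    then show "(a, (b, c)) \<in> (\<lambda>((a, b), c). (a, (b, c))) ` supp s"
      by (intro image_eqI[of _ _ "((a, b), c)"]) (auto simp: assms)
  qed (auto simp: assms)
  have inj: "inj_on (\<lambda>((a, b), c). (a, (b, c))) (supp s)" by (auto simp: inj_on_def)
  show ?thesis unfolding tsum_def[of s] tsum_def[of t] t sum.reindex[OF inj]
  proof (rule sum.cong[OF refl])
    fix p assume "p \<in> supp s"
    obtain a b c where p: "p = ((a, b), c)" by (metis surj_pair)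
    show "s p * tsum (bvec (fst p)) (\<lambda>x y. F x y (bvec (snd p))) =
         ((\<lambda>p. t p * tsum (bvec (snd p)) (F (bvec (fst p)))) \<circ> (\<lambda>((a, b), c). (a, b, c))) p"
      by (simp add: p assms tsum_bvec)
  qed
qed

lemma eq_by_lfun:
  assumes "\<And>G. lfun G \<Longrightarrow> G u = G v"
  shows "u = v"
  using assms[OF lfun_coord] by auto

subsection \<open>Hopf algebras\<close>

text \<open>Every rewriting of a Sweedler sum carries a linearity side condition; these introduction
  rules reduce it to the linearity of the operations involved.\<close>

named_theorems multilin

lemmas [multilin] = bilinI trilinI lin_id lfun_mult_left lfun_mult_right lfun_tsum_arg lfun_tsum_form

lemma bilin_comp1: "bilin F \<Longrightarrow> lin f \<Longrightarrow> y \<in> vecs \<Longrightarrow> lfun (\<lambda>x. F (f x) y)"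
  using lfun_comp[of "\<lambda>x. F x y" f] by (simp add: bilin_def)

lemma bilin_comp2: "bilin F \<Longrightarrow> lin f \<Longrightarrow> y \<in> vecs \<Longrightarrow> lfun (\<lambda>x. F y (f x))"
  using lfun_comp[of "F y" f] by (simp add: bilin_def)

lemmas bilin_comp = bilin_comp1 bilin_comp2

text \<open>The operations are separate parameters and the axioms are in tested form, so that the
  calculus can be instantiated again with product and coproduct both reversed; mirrored statements
  are obtained in this way.\<close>

locale hopf_calculus =
  fixes mul :: "('i \<Rightarrow> 'k::field) \<Rightarrow> ('i \<Rightarrow> 'k) \<Rightarrow> 'i \<Rightarrow> 'k" (infixl \<open>\<odot>\<close> 70)
    and one :: "'i \<Rightarrow> 'k" (\<open>\<one>\<close>)
    and cop :: "('i \<Rightarrow> 'k) \<Rightarrow> 'i \<times> 'i \<Rightarrow> 'k" (\<open>\<Delta>\<close>)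
    and eps :: "('i \<Rightarrow> 'k) \<Rightarrow> 'k" (\<open>\<epsilon>\<close>)
    and S :: "('i \<Rightarrow> 'k) \<Rightarrow> 'i \<Rightarrow> 'k"
  assumes lin_mulR: "u \<in> vecs \<Longrightarrow> lin (\<lambda>v. u \<odot> v)"
    and lin_mulL: "v \<in> vecs \<Longrightarrow> lin (\<lambda>u. u \<odot> v)"
    and one_vecs [simp]: "\<one> \<in> vecs"
    and mul_assoc: "u \<in> vecs \<Longrightarrow> v \<in> vecs \<Longrightarrow> w \<in> vecs \<Longrightarrow> u \<odot> v \<odot> w = u \<odot> (v \<odot> w)"
    and mul_one [simp]: "v \<in> vecs \<Longrightarrow> \<one> \<odot> v = v" "v \<in> vecs \<Longrightarrow> v \<odot> \<one> = v"
    and lin_cop: "lin \<Delta>"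
    and lfun_eps: "lfun \<epsilon>"
    and coassoc: "\<And>F. trilin F \<Longrightarrow> v \<in> vecs \<Longrightarrow>
      tsum (\<Delta> v) (\<lambda>x y. tsum (\<Delta> x) (\<lambda>a b. F a b y)) = tsum (\<Delta> v) (\<lambda>x y. tsum (\<Delta> y) (\<lambda>a b. F x a b))"
    and counit1: "lfun G \<Longrightarrow> v \<in> vecs \<Longrightarrow> tsum (\<Delta> v) (\<lambda>x y. \<epsilon> x * G y) = G v"
    and counit2: "lfun G \<Longrightarrow> v \<in> vecs \<Longrightarrow> tsum (\<Delta> v) (\<lambda>x y. \<epsilon> y * G x) = G v"
    and cop_mul: "bilin F \<Longrightarrow> u \<in> vecs \<Longrightarrow> v \<in> vecs \<Longrightarrow>
      tsum (\<Delta> (u \<odot> v)) F = tsum (\<Delta> u) (\<lambda>a b. tsum (\<Delta> v) (\<lambda>c d. F (a \<odot> c) (b \<odot> d)))"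
    and cop_one: "bilin F \<Longrightarrow> tsum (\<Delta> \<one>) F = F \<one> \<one>"
    and eps_mul: "u \<in> vecs \<Longrightarrow> v \<in> vecs \<Longrightarrow> \<epsilon> (u \<odot> v) = \<epsilon> u * \<epsilon> v"
    and eps_one: "\<epsilon> \<one> = 1"
    and lin_S: "lin S"
    and antipode1: "lfun G \<Longrightarrow> v \<in> vecs \<Longrightarrow> tsum (\<Delta> v) (\<lambda>x y. G (S x \<odot> y)) = \<epsilon> v * G \<one>"
    and antipode2: "lfun G \<Longrightarrow> v \<in> vecs \<Longrightarrow> tsum (\<Delta> v) (\<lambda>x y. G (x \<odot> S y)) = \<epsilon> v * G \<one>"
begin

lemma mul_vecs [simp]: "u \<in> vecs \<Longrightarrow> v \<in> vecs \<Longrightarrow> u \<odot> v \<in> vecs"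
  using lin_vecs[OF lin_mulL] by blast

lemma S_vecs [simp]: "v \<in> vecs \<Longrightarrow> S v \<in> vecs"
  by (rule lin_vecs[OF lin_S])

lemma cop_vecs [simp]: "v \<in> vecs \<Longrightarrow> \<Delta> v \<in> vecs"
  by (rule lin_vecs[OF lin_cop])

lemmas [multilin] = lin_comp[OF lin_mulL] lin_comp[OF lin_mulR] lin_comp[OF lin_cop] lin_comp[OF lin_S]
  lfun_comp[OF lfun_eps]

section \<open>The antipode reverses products and coproducts\<close>

lemma antipode1': 
  assumes G: "lfun G" and "p \<in> vecs" "q \<in> vecs" "v \<in> vecs" 
  shows "tsum (\<Delta> v) (\<lambda>x y. G (p \<odot> (S x \<odot> (y \<odot> q)))) = \<epsilon> v * G (p \<odot> q)"
proof -
  have "tsum (\<Delta> v) (\<lambda>x y. G (p \<odot> (S x \<odot> (y \<odot> q)))) = tsum (\<Delta> v) (\<lambda>x y. G (p \<odot> ((S x \<odot> y) \<odot> q)))"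
    by (rule tsum_cong) (simp add: mul_assoc assms)
  also have "\<dots> = \<epsilon> v * G (p \<odot> (\<one> \<odot> q))"
    using assms by (intro antipode1) (intro multilin lfun_comp[OF G] | simp)+
  finally show ?thesis using assms by simp
qed

lemma antipode2': 
  assumes G: "lfun G" and "p \<in> vecs" "q \<in> vecs" "v \<in> vecs" 
  shows "tsum (\<Delta> v) (\<lambda>x y. G (p \<odot> (x \<odot> (S y \<odot> q)))) = \<epsilon> v * G (p \<odot> q)"
proof -
  have "tsum (\<Delta> v) (\<lambda>x y. G (p \<odot> (x \<odot> (S y \<odot> q)))) = tsum (\<Delta> v) (\<lambda>x y. G (p \<odot> ((x \<odot> S y) \<odot> q)))"
    by (rule tsum_cong) (simp add: mul_assoc assms)
  also have "\<dots> = \<epsilon> v * G (p \<odot> (\<one> \<odot> q))"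
    using assms by (intro antipode2) (intro multilin lfun_comp[OF G] | simp)+
  finally show ?thesis using assms by simp
qed

text \<open>Both sides are convolution inverses of the multiplication:
  \<open>S(a1 b1) a2 b2 S(b3) S(a3)\<close> collapses to \<open>S(ab)\<close> when the tail is
  cancelled, and to \<open>S(b) S(a)\<close> when the head is cancelled.\<close>

lemma S_mul:
  assumes "a \<in> vecs" "b \<in> vecs"
  shows "S (a \<odot> b) = S b \<odot> S a"
proof (rule eq_by_lfun)
  fix G :: "('i \<Rightarrow> 'k) \<Rightarrow> 'k" assume G: "lfun G"
  note ml = multilin lfun_comp[OF G]
  let ?F = "\<lambda>a1 a2 a3 b1 b2 b3. G (S (a1 \<odot> b1) \<odot> (a2 \<odot> (b2 \<odot> (S b3 \<odot> S a3))))"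
  have "tsum (\<Delta> a) (\<lambda>a1 a'. tsum (\<Delta> a') (\<lambda>a2 a3. tsum (\<Delta> b) (\<lambda>b1 b'. tsum (\<Delta> b') (\<lambda>b2 b3. ?F a1 a2 a3 b1 b2 b3))))
      = tsum (\<Delta> a) (\<lambda>a1 a'. tsum (\<Delta> a') (\<lambda>a2 a3. tsum (\<Delta> b) (\<lambda>b1 b'. \<epsilon> b' * G (S (a1 \<odot> b1) \<odot> (a2 \<odot> S a3)))))"
  proof (intro tsum_cong)
    fix a1 a' a2 a3 b1 b' :: "'i \<Rightarrow> 'k" 
    assume v: "a1 \<in> vecs" "a' \<in> vecs" "a2 \<in> vecs" "a3 \<in> vecs" "b1 \<in> vecs" "b' \<in> vecs"
    show "tsum (\<Delta> b') (\<lambda>b2 b3. ?F a1 a2 a3 b1 b2 b3) = \<epsilon> b' * G (S (a1 \<odot> b1) \<odot> (a2 \<odot> S a3))"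
      using v antipode2'[OF G, of "S (a1 \<odot> b1) \<odot> a2" "S a3" b'] by (simp add: mul_assoc cong: tsum_cong)
  qed
  also have "\<dots> = tsum (\<Delta> a) (\<lambda>a1 a'. tsum (\<Delta> a') (\<lambda>a2 a3. G (S (a1 \<odot> b) \<odot> (a2 \<odot> S a3))))"
    by (intro tsum_cong counit2) (intro ml assms | simp add: assms)+
  also have "\<dots> = tsum (\<Delta> a) (\<lambda>a1 a'. \<epsilon> a' * G (S (a1 \<odot> b) \<odot> \<one>))"
    by (intro tsum_cong antipode2) (intro ml assms | simp add: assms)+
  also have "\<dots> = G (S (a \<odot> b) \<odot> \<one>)"
    by (intro counit2) (intro ml assms | simp add: assms)+
  finally have 1: "tsum (\<Delta> a) (\<lambda>a1 a'. tsum (\<Delta> a') (\<lambda>a2 a3. tsum (\<Delta> b) (\<lambda>b1 b'. tsum (\<Delta> b') (\<lambda>b2 b3. ?F a1 a2 a3 b1 b2 b3))))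
      = G (S (a \<odot> b))"
    using assms by simp
  have "tsum (\<Delta> a) (\<lambda>a1 a'. tsum (\<Delta> a') (\<lambda>a2 a3. tsum (\<Delta> b) (\<lambda>b1 b'. tsum (\<Delta> b') (\<lambda>b2 b3. ?F a1 a2 a3 b1 b2 b3))))
     = tsum (\<Delta> a) (\<lambda>a1 a'. tsum (\<Delta> a') (\<lambda>a2 a3. tsum (\<Delta> b) (\<lambda>b' b3. tsum (\<Delta> b') (\<lambda>b1 b2. ?F a1 a2 a3 b1 b2 b3))))"
    by (intro tsum_cong coassoc[symmetric]) (intro ml assms | simp add: assms)+
  also have "\<dots> = tsum (\<Delta> a) (\<lambda>a' a3. tsum (\<Delta> a') (\<lambda>a1 a2. tsum (\<Delta> b) (\<lambda>b' b3. tsum (\<Delta> b') (\<lambda>b1 b2. ?F a1 a2 a3 b1 b2 b3))))"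
    by (intro coassoc[symmetric]) (intro ml assms | simp add: assms)+
  also have "\<dots> = tsum (\<Delta> a) (\<lambda>a' a3. tsum (\<Delta> b) (\<lambda>b' b3. tsum (\<Delta> a') (\<lambda>a1 a2. tsum (\<Delta> b') (\<lambda>b1 b2. ?F a1 a2 a3 b1 b2 b3))))"
    by (intro tsum_cong tsum_swap)
  also have "\<dots> = tsum (\<Delta> a) (\<lambda>a' a3. tsum (\<Delta> b) (\<lambda>b' b3. \<epsilon> b' * (\<epsilon> a' * G (S b3 \<odot> S a3))))"
  proof (intro tsum_cong)
    fix a' a3 b' b3 :: "'i \<Rightarrow> 'k" assume v: "a' \<in> vecs" "a3 \<in> vecs" "b' \<in> vecs" "b3 \<in> vecs"
    have "tsum (\<Delta> a') (\<lambda>a1 a2. tsum (\<Delta> b') (\<lambda>b1 b2. ?F a1 a2 a3 b1 b2 b3))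
        = tsum (\<Delta> a') (\<lambda>a1 a2. tsum (\<Delta> b') (\<lambda>b1 b2. G (\<one> \<odot> (S (a1 \<odot> b1) \<odot> (a2 \<odot> b2 \<odot> (S b3 \<odot> S a3))))))"
      using v by (intro tsum_cong) (simp add: mul_assoc)
    also have "\<dots> = tsum (\<Delta> (a' \<odot> b')) (\<lambda>x y. G (\<one> \<odot> (S x \<odot> (y \<odot> (S b3 \<odot> S a3)))))"
      using v by (intro cop_mul[symmetric]) (intro ml | simp)+
    also have "\<dots> = \<epsilon> (a' \<odot> b') * G (S b3 \<odot> S a3)"
      using antipode1'[OF G, of \<one> "S b3 \<odot> S a3" "a' \<odot> b'"] v by simp
    finally show "tsum (\<Delta> a') (\<lambda>a1 a2. tsum (\<Delta> b') (\<lambda>b1 b2. ?F a1 a2 a3 b1 b2 b3)) = \<epsilon> b' * (\<epsilon> a' * G (S b3 \<odot> S a3))"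
      using v by (simp add: eps_mul)
  qed
  also have "\<dots> = tsum (\<Delta> a) (\<lambda>a' a3. \<epsilon> a' * G (S b \<odot> S a3))"
    by (intro tsum_cong counit1) (intro ml assms | simp add: assms)+
  also have "\<dots> = G (S b \<odot> S a)"
    by (intro counit1) (intro ml assms | simp add: assms)+
  finally show "G (S (a \<odot> b)) = G (S b \<odot> S a)" using 1 by simp
qed

text \<open>Both sides are convolution inverses of \<Delta>, now with values in the tensor square:
  \<open>\<Delta>(S(d1)) \<Delta>(d2) (S(d4) \<otimes> S(d3))\<close> is evaluated from either
  end.\<close>

lemma cop_S:
  assumes F: "bilin F" and d: "d \<in> vecs"
  shows "tsum (\<Delta> (S d)) F = tsum (\<Delta> d) (\<lambda>x y. F (S y) (S x))"
proof -
  note ml = multilin bilin_comp[OF F]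
  let ?F = "\<lambda>d1 d2 d3 d4. tsum (\<Delta> (S d1)) (\<lambda>p q. tsum (\<Delta> d2) (\<lambda>r s. F (p \<odot> (r \<odot> S d4)) (q \<odot> (s \<odot> S d3))))"
  have l: "lfun (\<lambda>y. F p (q \<odot> y))" "lfun (\<lambda>y. F (p \<odot> y) q)" if "p \<in> vecs" "q \<in> vecs" for p q
    using that by (intro ml | simp)+
  \<comment> \<open>In \<open>e1 S(e4) \<otimes> e2 S(e3)\<close> the middle pair cancels first;
    this makes the outer pair adjacent, and it cancels next.\<close>
  have inner: "tsum (\<Delta> e) (\<lambda>d' d4. tsum (\<Delta> d') (\<lambda>d2 d3. ?F d1 d2 d3 d4)) = \<epsilon> e * tsum (\<Delta> (S d1)) F"
    if e: "e \<in> vecs" "d1 \<in> vecs" for e d1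
  proof -
    have "tsum (\<Delta> e) (\<lambda>d' d4. tsum (\<Delta> d') (\<lambda>d2 d3. ?F d1 d2 d3 d4)) =
       tsum (\<Delta> (S d1)) (\<lambda>p q. tsum (\<Delta> e) (\<lambda>d' d4. tsum (\<Delta> d') (\<lambda>d2 d3. tsum (\<Delta> d2) (\<lambda>r s. F (p \<odot> (r \<odot> S d4)) (q \<odot> (s \<odot> S d3))))))"
      by (subst (2) tsum_swap, subst tsum_swap) (rule refl)
    also have "\<dots> = tsum (\<Delta> (S d1)) (\<lambda>p q. tsum (\<Delta> e) (\<lambda>d' d4. tsum (\<Delta> d') (\<lambda>r d2. tsum (\<Delta> d2) (\<lambda>s d3. F (p \<odot> (r \<odot> S d4)) (q \<odot> (s \<odot> S d3))))))"
      by (intro tsum_cong coassoc) (intro ml | simp)+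
    also have "\<dots> = tsum (\<Delta> (S d1)) (\<lambda>p q. tsum (\<Delta> e) (\<lambda>d' d4. tsum (\<Delta> d') (\<lambda>r d2. \<epsilon> d2 * F (p \<odot> (r \<odot> S d4)) (q \<odot> \<one>))))"
      by (intro tsum_cong antipode2) (intro ml | simp)+
    also have "\<dots> = tsum (\<Delta> (S d1)) (\<lambda>p q. tsum (\<Delta> e) (\<lambda>d' d4. F (p \<odot> (d' \<odot> S d4)) (q \<odot> \<one>)))"
      by (intro tsum_cong counit2) (intro ml | simp)+
    also have "\<dots> = tsum (\<Delta> (S d1)) (\<lambda>p q. \<epsilon> e * F (p \<odot> \<one>) (q \<odot> \<one>))"
      using e by (intro tsum_cong antipode2) (intro ml | simp)+
    also have "\<dots> = \<epsilon> e * tsum (\<Delta> (S d1)) F"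
      unfolding tsum_mult_left[symmetric] by (intro tsum_cong) simp
    finally show ?thesis .
  qed
  have "tsum (\<Delta> d) (\<lambda>d1 e. tsum (\<Delta> e) (\<lambda>d' d4. tsum (\<Delta> d') (\<lambda>d2 d3. ?F d1 d2 d3 d4)))
      = tsum (\<Delta> d) (\<lambda>d1 e. \<epsilon> e * tsum (\<Delta> (S d1)) F)"
    by (intro tsum_cong inner)
  also have "\<dots> = tsum (\<Delta> (S d)) F"
    using d by (intro counit2) (intro ml | simp)+
  finally have 1: "tsum (\<Delta> d) (\<lambda>d1 e. tsum (\<Delta> e) (\<lambda>d' d4. tsum (\<Delta> d') (\<lambda>d2 d3. ?F d1 d2 d3 d4))) = tsum (\<Delta> (S d)) F" .
  have "tsum (\<Delta> d) (\<lambda>d1 e. tsum (\<Delta> e) (\<lambda>d' d4. tsum (\<Delta> d') (\<lambda>d2 d3. ?F d1 d2 d3 d4)))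
      = tsum (\<Delta> d) (\<lambda>d1 e. tsum (\<Delta> e) (\<lambda>d2 d'. tsum (\<Delta> d') (\<lambda>d3 d4. ?F d1 d2 d3 d4)))"
    by (intro tsum_cong coassoc) (intro ml | simp)+
  also have "\<dots> = tsum (\<Delta> d) (\<lambda>e d'. tsum (\<Delta> e) (\<lambda>d1 d2. tsum (\<Delta> d') (\<lambda>d3 d4. ?F d1 d2 d3 d4)))"
    using d by (intro coassoc[symmetric]) (intro ml | simp)+
  also have "\<dots> = tsum (\<Delta> d) (\<lambda>e d'. \<epsilon> e * tsum (\<Delta> d') (\<lambda>d3 d4. F (S d4) (S d3)))"
  proof (intro tsum_cong)
    fix e d' :: "'i \<Rightarrow> 'k" assume v: "e \<in> vecs" "d' \<in> vecs"
    have "tsum (\<Delta> e) (\<lambda>d1 d2. tsum (\<Delta> d') (\<lambda>d3 d4. ?F d1 d2 d3 d4)) = tsum (\<Delta> d') (\<lambda>d3 d4. tsum (\<Delta> e) (\<lambda>d1 d2. ?F d1 d2 d3 d4))"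
      by (rule tsum_swap)
    also have "\<dots> = tsum (\<Delta> d') (\<lambda>d3 d4. tsum (\<Delta> e) (\<lambda>d1 d2. tsum (\<Delta> (S d1 \<odot> d2)) (\<lambda>x y. F (x \<odot> S d4) (y \<odot> S d3))))"
    proof (intro tsum_cong)
      fix d1 d2 d3 d4 :: "'i \<Rightarrow> 'k" assume w: "d1 \<in> vecs" "d2 \<in> vecs" "d3 \<in> vecs" "d4 \<in> vecs"
      have "?F d1 d2 d3 d4 = tsum (\<Delta> (S d1)) (\<lambda>p q. tsum (\<Delta> d2) (\<lambda>r s. F (p \<odot> r \<odot> S d4) (q \<odot> s \<odot> S d3)))"
        using w by (intro tsum_cong) (simp add: mul_assoc)
      also have "\<dots> = tsum (\<Delta> (S d1 \<odot> d2)) (\<lambda>x y. F (x \<odot> S d4) (y \<odot> S d3))"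
        using w by (intro cop_mul[symmetric]) (intro ml | simp)+
      finally show "?F d1 d2 d3 d4 = \<dots>" .
    qed
    also have "\<dots> = tsum (\<Delta> d') (\<lambda>d3 d4. \<epsilon> e * tsum (\<Delta> \<one>) (\<lambda>x y. F (x \<odot> S d4) (y \<odot> S d3)))"
      using v by (intro tsum_cong antipode1[where G = "\<lambda>z. tsum (\<Delta> z) _"]) (intro ml | simp)+
    also have "\<dots> = tsum (\<Delta> d') (\<lambda>d3 d4. \<epsilon> e * F (\<one> \<odot> S d4) (\<one> \<odot> S d3))"
    proof (intro tsum_cong)
      fix x y :: "'i \<Rightarrow> 'k" assume "x \<in> vecs" "y \<in> vecs"
      then have "bilin (\<lambda>p q. F (p \<odot> S y) (q \<odot> S x))" by (intro ml | simp)+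
      then show "\<epsilon> e * tsum (\<Delta> \<one>) (\<lambda>p q. F (p \<odot> S y) (q \<odot> S x)) = \<epsilon> e * F (\<one> \<odot> S y) (\<one> \<odot> S x)"
        by (simp add: cop_one)
    qed
    also have "\<dots> = \<epsilon> e * tsum (\<Delta> d') (\<lambda>d3 d4. F (S d4) (S d3))"
      unfolding tsum_mult_left[symmetric] by (intro tsum_cong) simp
    finally show "tsum (\<Delta> e) (\<lambda>d1 d2. tsum (\<Delta> d') (\<lambda>d3 d4. ?F d1 d2 d3 d4)) = \<epsilon> e * tsum (\<Delta> d') (\<lambda>d3 d4. F (S d4) (S d3))" .
  qed
  also have "\<dots> = tsum (\<Delta> d) (\<lambda>x y. F (S y) (S x))"
    using d by (intro counit1) (intro ml | simp)+
  finally show ?thesis using 1 by simp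
qed

end

subsection \<open>Integrals and rational functionals\<close>

definition vtsum :: "('i \<times> 'j \<Rightarrow> 'k) \<Rightarrow> (('i \<Rightarrow> 'k) \<Rightarrow> ('j \<Rightarrow> 'k) \<Rightarrow> ('l \<Rightarrow> 'k)) \<Rightarrow> 'l \<Rightarrow> 'k::field" where
  "vtsum t F = linext (\<lambda>p. F (bvec (fst p)) (bvec (snd p))) t"

lemma lfun_vtsum:
  assumes "lfun G" "t \<in> vecs" "\<And>x y. x \<in> vecs \<Longrightarrow> y \<in> vecs \<Longrightarrow> F x y \<in> vecs"
  shows "G (vtsum t F) = tsum t (\<lambda>x y. G (F x y))"
  unfolding vtsum_def tsum_def using assms by (intro linext_lfun) auto

lemma lin_vtsum:
  assumes "\<And>x y. x \<in> vecs \<Longrightarrow> y \<in> vecs \<Longrightarrow> F x y \<in> vecs"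
  shows "lin (\<lambda>t. vtsum t F)"
  unfolding vtsum_def using assms by (intro lin_linext) auto

lemma vec_eq_0_by_lfun:
  assumes "\<And>G. lfun G \<Longrightarrow> G u = 0"
  shows "u = vzero"
  using assms[OF lfun_coord] by (auto simp: vzero_def)

context hopf_calculus
begin

definition is_integral :: "(('i \<Rightarrow> 'k) \<Rightarrow> 'k) \<Rightarrow> bool" where
  "is_integral l \<longleftrightarrow> lfun l \<and>
     (\<forall>h\<in>vecs. \<forall>G. lfun G \<longrightarrow> tsum (\<Delta> h) (\<lambda>x y. G x * l y) = l h * G \<one>)"

lemma is_integral_lfun: "is_integral l \<Longrightarrow> lfun l"
  by (simp add: is_integral_def)

lemma is_integral_eq: "is_integral l \<Longrightarrow> lfun G \<Longrightarrow> h \<in> vecs \<Longrightarrow> tsum (\<Delta> h) (\<lambda>x y. G x * l y) = l h * G \<one>"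
  by (simp add: is_integral_def)

text \<open>The family \<open>rcoef f\<close> is the right coaction on functionals:
  \<open>d\<^sub>1 f(d\<^sub>2) = \<Sum>j. rcoef f j d \<cdot> e\<^sub>j\<close>.\<close>

definition rcoef :: "(('i \<Rightarrow> 'k) \<Rightarrow> 'k) \<Rightarrow> 'i \<Rightarrow> ('i \<Rightarrow> 'k) \<Rightarrow> 'k" where
  "rcoef f j d = tsum (\<Delta> d) (\<lambda>x y. x j * f y)"

text \<open>Rationality in the usual sense: the vectors \<open>d1 f(d2)\<close>, for all
  \<open>d\<close>, lie in one finite-dimensional space. The index set \<open>J\<close> is kept
  explicit because the projection below is a sum over it.\<close>

definition rational_on :: "'i set \<Rightarrow> (('i \<Rightarrow> 'k) \<Rightarrow> 'k) \<Rightarrow> bool" where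
  "rational_on J f \<longleftrightarrow> finite J \<and> lfun f \<and> (\<forall>j. j \<notin> J \<longrightarrow> (\<forall>d\<in>vecs. rcoef f j d = 0))"

lemma lfun_rcoef: "lfun (rcoef f j)"
  unfolding rcoef_def[abs_def] by (intro lfun_tsum_arg lin_cop)

lemmas [multilin] = lfun_comp[OF lfun_rcoef]

lemma rational_sum:
  assumes f: "rational_on J f" and d: "d \<in> vecs"
  shows "tsum (\<Delta> d) (\<lambda>x y. G x * f y) = (\<Sum>j\<in>J. G (bvec j) * rcoef f j d)"
proof -
  let ?K = "J \<union> fst ` supp (\<Delta> d)"
  have K: "finite ?K" using f cop_vecs[OF d] by (simp add: rational_on_def vecs_iff)
  have "tsum (\<Delta> d) (\<lambda>x y. G x * f y) = (\<Sum>j\<in>?K. tsum (\<Delta> d) (\<lambda>x y. x j * (G (bvec j) * f y)))"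
    using K d by (intro tsum_expand_left) auto
  also have "\<dots> = (\<Sum>j\<in>?K. G (bvec j) * rcoef f j d)"
    by (simp add: rcoef_def tsum_mult_left[symmetric] mult.left_commute)
  also have "\<dots> = (\<Sum>j\<in>J. G (bvec j) * rcoef f j d)"
    using f d K by (intro sum.mono_neutral_right) (auto simp: rational_on_def)
  finally show ?thesis .
qed

text \<open>Coassociativity of the coaction on functionals: coacting on the coefficient functionals
  of \<open>f\<close> is the same as comultiplying the coefficients \<open>e_l\<close>.\<close>

lemma rcoef_sum:
  assumes f: "rational_on J f" and G: "lfun G" and d: "d \<in> vecs"
  shows "tsum (\<Delta> d) (\<lambda>x y. G x * rcoef f j y)
    = (\<Sum>l\<in>J. tsum (\<Delta> (bvec l)) (\<lambda>p q. G p * q j) * rcoef f l d)"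
proof -
  have lf: "lfun f" using f by (simp add: rational_on_def)
  note ml = multilin lfun_comp[OF G] lfun_comp[OF lf] lfun_coord
  have "tsum (\<Delta> d) (\<lambda>x y. G x * rcoef f j y) = tsum (\<Delta> d) (\<lambda>x y. tsum (\<Delta> y) (\<lambda>a b. G x * (a j * f b)))"
    by (simp add: rcoef_def tsum_mult_left)
  also have "\<dots> = tsum (\<Delta> d) (\<lambda>x y. tsum (\<Delta> x) (\<lambda>a b. G a * (b j * f y)))"
    using d by (intro coassoc[symmetric]) (intro ml G lf | simp)+
  also have "\<dots> = tsum (\<Delta> d) (\<lambda>x y. tsum (\<Delta> x) (\<lambda>a b. G a * b j) * f y)"
    by (simp add: tsum_mult_right[symmetric] mult.assoc)
  also have "\<dots> = (\<Sum>l\<in>J. tsum (\<Delta> (bvec l)) (\<lambda>p q. G p * q j) * rcoef f l d)"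
    by (rule rational_sum[OF f d])
  finally show ?thesis .
qed

text \<open>By \<open>rcoef_sum\<close> the coaction of a coefficient functional involves only first
  legs of the finitely many \<open>\<Delta>(e_l)\<close>, so rational functionals are stable under
  their own coaction.\<close>

lemma rational_rcoef:
  assumes f: "rational_on J f"
  shows "rational_on (\<Union>l\<in>J. fst ` supp (\<Delta> (bvec l))) (rcoef f j)"
  unfolding rational_on_def
proof (intro conjI allI impI ballI)
  show "finite (\<Union>l\<in>J. fst ` supp (\<Delta> (bvec l)))"
    using f cop_vecs[OF bvec_vecs] by (auto simp: rational_on_def vecs_iff)
next
  fix i d assume i: "i \<notin> (\<Union>l\<in>J. fst ` supp (\<Delta> (bvec l)))" and d: "d \<in> (vecs :: ('i \<Rightarrow> 'k) set)"
  have "tsum (\<Delta> (bvec l)) (\<lambda>p q. p i * q j) = 0" if "l \<in> J" for l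
    using i that by (force simp: tsum_coord)
  then show "rcoef (rcoef f j) i d = 0"
    using rcoef_sum[OF f lfun_coord d, of i j] by (simp add: rcoef_def[of "rcoef f j"])
qed (rule lfun_rcoef)

text \<open>Hopf module compatibility of the coaction with the action
  \<open>(g \<cdot> z)(d) = g(d S(z))\<close>: the coproduct of \<open>d S(z1)\<close> has legs
  \<open>d1 S(z2)\<close> and \<open>d2 S(z1)\<close>, and multiplying by the remaining leg cancels
  \<open>S(z2) z3\<close>.\<close>

lemma translate_S:
  assumes G: "lfun G" and g: "lfun g" and d: "d \<in> vecs" and z: "z \<in> vecs"
  shows "tsum (\<Delta> d) (\<lambda>x y. G x * g (y \<odot> S z))
    = tsum (\<Delta> z) (\<lambda>z1 z2. tsum (\<Delta> (d \<odot> S z1)) (\<lambda>u1 u2. G (u1 \<odot> z2) * g u2))"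
proof -
  note ml = multilin G g lfun_comp[OF G] lfun_comp[OF g]
  have "tsum (\<Delta> z) (\<lambda>z1 z2. tsum (\<Delta> (d \<odot> S z1)) (\<lambda>u1 u2. G (u1 \<odot> z2) * g u2))
     = tsum (\<Delta> z) (\<lambda>z1 z2. tsum (\<Delta> d) (\<lambda>x y. tsum (\<Delta> z1) (\<lambda>p q. G (x \<odot> S q \<odot> z2) * g (y \<odot> S p))))"
  proof (rule tsum_cong)
    fix z1 z2 :: "'i \<Rightarrow> 'k" assume v: "z1 \<in> vecs" "z2 \<in> vecs"
    have "tsum (\<Delta> (d \<odot> S z1)) (\<lambda>u1 u2. G (u1 \<odot> z2) * g u2)
       = tsum (\<Delta> d) (\<lambda>x y. tsum (\<Delta> (S z1)) (\<lambda>p q. G (x \<odot> p \<odot> z2) * g (y \<odot> q)))"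
      using v d by (intro cop_mul) (intro ml | simp)+
    also have "\<dots> = tsum (\<Delta> d) (\<lambda>x y. tsum (\<Delta> z1) (\<lambda>p q. G (x \<odot> S q \<odot> z2) * g (y \<odot> S p)))"
      using v by (intro tsum_cong cop_S) (intro ml | simp)+
    finally show "tsum (\<Delta> (d \<odot> S z1)) (\<lambda>u1 u2. G (u1 \<odot> z2) * g u2) = \<dots>" .
  qed
  also have "\<dots> = tsum (\<Delta> d) (\<lambda>x y. tsum (\<Delta> z) (\<lambda>z1 z2. tsum (\<Delta> z1) (\<lambda>p q. G (x \<odot> S q \<odot> z2) * g (y \<odot> S p))))"
    by (rule tsum_swap)
  also have "\<dots> = tsum (\<Delta> d) (\<lambda>x y. tsum (\<Delta> z) (\<lambda>p z'. tsum (\<Delta> z') (\<lambda>q z2. G (x \<odot> S q \<odot> z2) * g (y \<odot> S p))))"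
    using z by (intro tsum_cong coassoc) (intro ml | simp)+
  also have "\<dots> = tsum (\<Delta> d) (\<lambda>x y. tsum (\<Delta> z) (\<lambda>p z'. tsum (\<Delta> z') (\<lambda>q z2. G (x \<odot> (S q \<odot> z2)) * g (y \<odot> S p))))"
    by (simp add: mul_assoc cong: tsum_cong)
  also have "\<dots> = tsum (\<Delta> d) (\<lambda>x y. tsum (\<Delta> z) (\<lambda>p z'. \<epsilon> z' * (G (x \<odot> \<one>) * g (y \<odot> S p))))"
    by (intro tsum_cong antipode1) (intro ml | simp)+
  also have "\<dots> = tsum (\<Delta> d) (\<lambda>x y. G (x \<odot> \<one>) * g (y \<odot> S z))"
    using z by (intro tsum_cong counit2) (intro ml | simp)+
  also have "\<dots> = tsum (\<Delta> d) (\<lambda>x y. G x * g (y \<odot> S z))"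
    by (intro tsum_cong) simp
  finally show ?thesis ..
qed

text \<open>Invariance applied to the product \<open>b2 h\<close>, followed by multiplication with
  \<open>S(b1)\<close>, cancels the free leg of \<open>b\<close>. The effect is to move the free leg
  from \<open>h\<close> to \<open>b\<close>, which may be held fixed.\<close>

lemma translate_left:
  assumes l: "is_integral l" and G: "lfun G" and h: "h \<in> vecs" and b: "b \<in> vecs"
  shows "tsum (\<Delta> h) (\<lambda>x y. G x * l (b \<odot> y)) = tsum (\<Delta> b) (\<lambda>b1 b2. G (S b1) * l (b2 \<odot> h))"
proof -
  note lf = is_integral_lfun[OF l]
  note ml = multilin G lf lfun_comp[OF G] lfun_comp[OF lf]
  have "tsum (\<Delta> b) (\<lambda>b1 b2. G (S b1) * l (b2 \<odot> h))
      = tsum (\<Delta> b) (\<lambda>b1 b'. tsum (\<Delta> b') (\<lambda>b2 b3. tsum (\<Delta> h) (\<lambda>x y. G (S b1 \<odot> (b2 \<odot> x)) * l (b3 \<odot> y))))"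
  proof (rule tsum_cong)
    fix b1 b' :: "'i \<Rightarrow> 'k" assume v: "b1 \<in> vecs" "b' \<in> vecs"
    have "G (S b1) * l (b' \<odot> h) = l (b' \<odot> h) * G (S b1 \<odot> \<one>)" using v by (simp add: mult.commute)
    also have "\<dots> = tsum (\<Delta> (b' \<odot> h)) (\<lambda>x y. G (S b1 \<odot> x) * l y)"
      using v h by (intro is_integral_eq[OF l, symmetric]) (intro ml | simp)+
    also have "\<dots> = tsum (\<Delta> b') (\<lambda>b2 b3. tsum (\<Delta> h) (\<lambda>x y. G (S b1 \<odot> (b2 \<odot> x)) * l (b3 \<odot> y)))"
      using v h by (intro cop_mul) (intro ml | simp)+
    finally show "G (S b1) * l (b' \<odot> h) = \<dots>" .
  qed
  also have "\<dots> = tsum (\<Delta> b) (\<lambda>b' b3. tsum (\<Delta> b') (\<lambda>b1 b2. tsum (\<Delta> h) (\<lambda>x y. G (S b1 \<odot> (b2 \<odot> x)) * l (b3 \<odot> y))))"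
    using b by (intro coassoc[symmetric]) (intro ml | simp)+
  also have "\<dots> = tsum (\<Delta> b) (\<lambda>b' b3. tsum (\<Delta> h) (\<lambda>x y. tsum (\<Delta> b') (\<lambda>b1 b2. G (S b1 \<odot> b2 \<odot> x) * l (b3 \<odot> y))))"
    by (subst tsum_swap[of "\<Delta> h"]) (simp add: mul_assoc cong: tsum_cong)
  also have "\<dots> = tsum (\<Delta> b) (\<lambda>b' b3. tsum (\<Delta> h) (\<lambda>x y. \<epsilon> b' * (G (\<one> \<odot> x) * l (b3 \<odot> y))))"
    by (intro tsum_cong antipode1) (intro ml | simp)+
  also have "\<dots> = tsum (\<Delta> h) (\<lambda>x y. tsum (\<Delta> b) (\<lambda>b' b3. \<epsilon> b' * (G (\<one> \<odot> x) * l (b3 \<odot> y))))"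
    by (rule tsum_swap)
  also have "\<dots> = tsum (\<Delta> h) (\<lambda>x y. G (\<one> \<odot> x) * l (b \<odot> y))"
    using b by (intro tsum_cong counit1) (intro ml | simp)+
  also have "\<dots> = tsum (\<Delta> h) (\<lambda>x y. G x * l (b \<odot> y))"
    by (intro tsum_cong) simp
  finally show ?thesis ..
qed

text \<open>The projection of the Hopf module of rational functionals onto its coinvariants, i.e. onto
  the integrals; the module structure is \<open>(f \<cdot> y)(d) = f(d S(y))\<close>.\<close>

definition coinv_proj :: "'i set \<Rightarrow> (('i \<Rightarrow> 'k) \<Rightarrow> 'k) \<Rightarrow> ('i \<Rightarrow> 'k) \<Rightarrow> 'k" where
  "coinv_proj J f d = (\<Sum>j\<in>J. rcoef f j (d \<odot> S (S (bvec j))))"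

text \<open>In Hopf module notation the projection is \<open>f0 \<cdot> S(f1)\<close>. Its coaction
  is \<open>f0 \<cdot> S(f3) \<otimes> f1 S(f2)\<close>, and the second factor collapses to
  \<open>1\<close>.\<close>

lemma coinv_proj_integral:
  assumes f: "rational_on J f"
  shows "is_integral (coinv_proj J f)"
  unfolding is_integral_def
proof (intro conjI ballI allI impI)
  show "lfun (coinv_proj J f)"
    unfolding coinv_proj_def[abs_def] by (intro lfun_setsum) (intro multilin | simp)+
next
  fix d :: "'i \<Rightarrow> 'k" and G :: "('i \<Rightarrow> 'k) \<Rightarrow> 'k"
  assume d: "d \<in> vecs" and G: "lfun G"
  note ml = multilin G lfun_comp[OF G] lfun_coord
  \<comment> \<open>Adding the second legs of the \<open>\<Delta>(e_l)\<close> lets the sum over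
    \<open>j\<close> be recombined into a Sweedler sum; the extra terms vanish because the
    coefficient functionals outside \<open>J\<close> are zero.\<close>
  let ?K = "J \<union> (\<Union>l\<in>J. snd ` supp (\<Delta> (bvec l)))"
  have K: "finite ?K"
    using f cop_vecs[OF bvec_vecs] by (auto simp: rational_on_def vecs_iff)
  have PK: "coinv_proj J f y = (\<Sum>j\<in>?K. rcoef f j (y \<odot> S (S (bvec j))))" if "y \<in> vecs" for y
    unfolding coinv_proj_def using f that K
    by (intro sum.mono_neutral_left) (auto simp: rational_on_def)
  let ?H = "\<lambda>l r s. tsum (\<Delta> s) (\<lambda>p q. G (r \<odot> S p) * rcoef f l (d \<odot> S (S q)))"
  have "tsum (\<Delta> d) (\<lambda>x y. G x * coinv_proj J f y)
      = tsum (\<Delta> d) (\<lambda>x y. \<Sum>j\<in>?K. G x * rcoef f j (y \<odot> S (S (bvec j))))"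
    by (intro tsum_cong) (simp add: PK sum_distrib_left)
  also have "\<dots> = (\<Sum>j\<in>?K. tsum (\<Delta> d) (\<lambda>x y. G x * rcoef f j (y \<odot> S (S (bvec j)))))"
    by (rule tsum_sum)
  also have "\<dots> = (\<Sum>j\<in>?K. \<Sum>l\<in>J. tsum (\<Delta> (bvec l)) (\<lambda>r s. s j * ?H l r (bvec j)))"
  proof (rule sum.cong[OF refl])
    fix j
    have "tsum (\<Delta> d) (\<lambda>x y. G x * rcoef f j (y \<odot> S (S (bvec j))))
      = tsum (\<Delta> (S (bvec j))) (\<lambda>z1 z2. tsum (\<Delta> (d \<odot> S z1)) (\<lambda>u1 u2. G (u1 \<odot> z2) * rcoef f j u2))"
      using d by (intro translate_S G lfun_rcoef) simp_all
    also have "\<dots> = tsum (\<Delta> (bvec j)) (\<lambda>p q. tsum (\<Delta> (d \<odot> S (S q))) (\<lambda>u1 u2. G (u1 \<odot> S p) * rcoef f j u2))"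
      using d by (intro cop_S) (intro ml | simp)+
    also have "\<dots> = tsum (\<Delta> (bvec j)) (\<lambda>p q. \<Sum>l\<in>J. tsum (\<Delta> (bvec l)) (\<lambda>r s. G (r \<odot> S p) * s j) * rcoef f l (d \<odot> S (S q)))"
      using d by (intro tsum_cong rcoef_sum f) (intro ml | simp)+
    also have "\<dots> = (\<Sum>l\<in>J. tsum (\<Delta> (bvec j)) (\<lambda>p q. tsum (\<Delta> (bvec l)) (\<lambda>r s. s j * (G (r \<odot> S p) * rcoef f l (d \<odot> S (S q))))))"
      by (simp add: tsum_sum tsum_mult_right[symmetric]) (simp only: mult_ac)
    also have "\<dots> = (\<Sum>l\<in>J. tsum (\<Delta> (bvec l)) (\<lambda>r s. s j * ?H l r (bvec j)))"
      by (subst tsum_swap) (simp add: tsum_mult_left)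
    finally show "tsum (\<Delta> d) (\<lambda>x y. G x * rcoef f j (y \<odot> S (S (bvec j)))) = \<dots>" .
  qed
  also have "\<dots> = (\<Sum>l\<in>J. \<Sum>j\<in>?K. tsum (\<Delta> (bvec l)) (\<lambda>r s. s j * ?H l r (bvec j)))"
    by (rule sum.swap)
  also have "\<dots> = (\<Sum>l\<in>J. tsum (\<Delta> (bvec l)) (?H l))"
    using K by (intro sum.cong refl tsum_expand_right[symmetric]) auto
  also have "\<dots> = (\<Sum>l\<in>J. rcoef f l (d \<odot> S (S (bvec l))) * G \<one>)"
  proof (rule sum.cong[OF refl])
    fix l
    have "tsum (\<Delta> (bvec l)) (?H l)
       = tsum (\<Delta> (bvec l)) (\<lambda>s q. tsum (\<Delta> s) (\<lambda>r p. G (r \<odot> S p) * rcoef f l (d \<odot> S (S q))))"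
      using d by (intro coassoc[symmetric]) (intro ml | simp)+
    also have "\<dots> = tsum (\<Delta> (bvec l)) (\<lambda>s q. \<epsilon> s * (G \<one> * rcoef f l (d \<odot> S (S q))))"
      by (intro tsum_cong antipode2) (intro ml | simp)+
    also have "\<dots> = G \<one> * rcoef f l (d \<odot> S (S (bvec l)))"
      using d by (intro counit1) (intro ml | simp)+
    finally show "tsum (\<Delta> (bvec l)) (?H l) = rcoef f l (d \<odot> S (S (bvec l))) * G \<one>"
      by (simp add: mult.commute)
  qed
  finally show "tsum (\<Delta> d) (\<lambda>x y. G x * coinv_proj J f y) = coinv_proj J f d * G \<one>"
    by (simp add: coinv_proj_def sum_distrib_right)
qed

lemma S_one: "S \<one> = \<one>"
proof (rule eq_by_lfun)
  fix G :: "('i \<Rightarrow> 'k) \<Rightarrow> 'k" assume G: "lfun G"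
  have "G (S \<one>) = tsum (\<Delta> \<one>) (\<lambda>x y. G (S x \<odot> y))"
    by (subst cop_one) (intro multilin lfun_comp[OF G] | simp)+
  then show "G (S \<one>) = G \<one>" using antipode1[OF G one_vecs] by (simp add: eps_one)
qed

text \<open>This is \<open>f = f0 \<cdot> (S(f1) f2)\<close> with the first product read as the
  projection of \<open>f0\<close>. The sets \<open>J'\<close> and \<open>K\<close> contain the first
  and second legs of all \<open>\<Delta>(e_l)\<close>, so the two coordinate sums recombine into
  \<open>S(S(p) q)\<close>, to which the antipode axiom applies.\<close>

lemma coinv_proj_recover:
  assumes f: "rational_on J f" and d: "d \<in> vecs"
  defines "J' \<equiv> \<Union>l\<in>J. fst ` supp (\<Delta> (bvec l))" and "K \<equiv> \<Union>l\<in>J. snd ` supp (\<Delta> (bvec l))"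
  shows "f d = (\<Sum>j\<in>K. coinv_proj J' (rcoef f j) (d \<odot> S (bvec j)))"
proof -
  have lf: "lfun f" using f by (simp add: rational_on_def)
  note ml = multilin lf lfun_comp[OF lf] lfun_coord
  have J: "finite J" using f by (simp add: rational_on_def)
  have fin: "finite J'" "finite K"
    unfolding J'_def K_def using J cop_vecs[OF bvec_vecs] by (auto simp: vecs_iff)
  let ?w = "\<lambda>i j. d \<odot> S (bvec j) \<odot> S (S (bvec i))"
  have "(\<Sum>j\<in>K. coinv_proj J' (rcoef f j) (d \<odot> S (bvec j)))
     = (\<Sum>j\<in>K. \<Sum>i\<in>J'. \<Sum>l\<in>J. tsum (\<Delta> (bvec l)) (\<lambda>p q. q j * (p i * rcoef f l (?w i j))))"
    unfolding coinv_proj_def rcoef_def[of "rcoef f _"]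
  proof (intro sum.cong refl)
    fix j i
    show "tsum (\<Delta> (?w i j)) (\<lambda>x y. x i * rcoef f j y)
       = (\<Sum>l\<in>J. tsum (\<Delta> (bvec l)) (\<lambda>p q. q j * (p i * rcoef f l (?w i j))))"
      using d by (subst rcoef_sum[OF f lfun_coord]) (simp_all add: tsum_mult_right[symmetric] mult_ac)
  qed
  also have "\<dots> = (\<Sum>l\<in>J. \<Sum>i\<in>J'. \<Sum>j\<in>K. tsum (\<Delta> (bvec l)) (\<lambda>p q. q j * (p i * rcoef f l (?w i j))))"
    by (subst sum.swap, subst sum.swap[of _ K], subst sum.swap[of _ J J']) (rule refl)
  also have "\<dots> = (\<Sum>l\<in>J. \<Sum>i\<in>J'. tsum (\<Delta> (bvec l)) (\<lambda>p q. p i * rcoef f l (d \<odot> S q \<odot> S (S (bvec i)))))"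
    using fin by (intro sum.cong refl tsum_expand_right[symmetric]) (auto simp: K_def)
  also have "\<dots> = (\<Sum>l\<in>J. tsum (\<Delta> (bvec l)) (\<lambda>p q. rcoef f l (d \<odot> S q \<odot> S (S p))))"
    using fin by (intro sum.cong refl tsum_expand_left[symmetric]) (auto simp: J'_def)
  also have "\<dots> = (\<Sum>l\<in>J. tsum (\<Delta> (bvec l)) (\<lambda>p q. rcoef f l (d \<odot> S (S p \<odot> q))))"
    using d by (intro sum.cong refl tsum_cong) (simp add: S_mul mul_assoc)
  also have "\<dots> = (\<Sum>l\<in>J. \<epsilon> (bvec l) * rcoef f l (d \<odot> S \<one>))"
    using d by (intro sum.cong refl antipode1) (intro ml | simp)+
  also have "\<dots> = tsum (\<Delta> (d \<odot> S \<one>)) (\<lambda>x y. \<epsilon> x * f y)"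
    using d by (intro rational_sum[OF f, symmetric]) simp
  also have "\<dots> = f (d \<odot> S \<one>)"
    using d by (intro counit1 lf) simp
  also have "\<dots> = f d"
    using d by (simp add: S_one)
  finally show ?thesis ..
qed


text \<open>Evaluating the reconstruction formula at \<open>1\<close> leaves only values of
  projections at vectors \<open>S(e_j)\<close>. Hence one of these integrals is nonzero on the image
  of the antipode, which keeps its composite with \<open>S\<close> nonzero.\<close>

lemma rational_imp_integral:
  assumes f: "rational_on J f" and "f \<one> \<noteq> 0"
  shows "\<exists>l z. is_integral l \<and> z \<in> vecs \<and> l (S z) \<noteq> 0"
proof -
  define P where "P j = coinv_proj (\<Union>l\<in>J. fst ` supp (\<Delta> (bvec l))) (rcoef f j)" for j
  have "f \<one> = (\<Sum>j\<in>(\<Union>l\<in>J. snd ` supp (\<Delta> (bvec l))). P j (\<one> \<odot> S (bvec j)))"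
    unfolding P_def by (rule coinv_proj_recover[OF f one_vecs])
  then obtain j where "P j (\<one> \<odot> S (bvec j)) \<noteq> 0"
    using \<open>f \<one> \<noteq> 0\<close> by (auto elim: sum.not_neutral_contains_not_neutral)
  moreover have "is_integral (P j)"
    unfolding P_def by (rule coinv_proj_integral[OF rational_rcoef[OF f]])
  ultimately show ?thesis by (intro exI[of _ "P j"] exI[of _ "bvec j"]) simp
qed

text \<open>The functional \<open>d \<mapsto> \<integral>(v \<phi>(d))\<close> is rational: by left invariance its coaction takes values in the
  span of the \<open>\<theta>(S(v\<^sub>1))\<close>.\<close>

lemma integral_transfer:
  fixes mulD :: "('j \<Rightarrow> 'k) \<Rightarrow> ('j \<Rightarrow> 'k) \<Rightarrow> 'j \<Rightarrow> 'k"
  assumes D: "hopf_calculus mulD oneD copD epsD SD"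
    and phi: "lin \<phi>" and theta: "lin \<theta>"
    and colin: "\<And>F d. bilin F \<Longrightarrow> d \<in> vecs \<Longrightarrow> tsum (copD d) (\<lambda>x y. F x (\<phi> y)) = tsum (\<Delta> (\<phi> d)) (\<lambda>x y. F (\<theta> x) y)"
    and phi1: "\<phi> oneD = \<one>"
    and l: "is_integral l" and v: "v \<in> vecs" "l v \<noteq> 0"
  shows "\<exists>l' z. hopf_calculus.is_integral oneD copD l' \<and> z \<in> vecs \<and> l' (SD z) \<noteq> 0"
proof -
  interpret D: hopf_calculus mulD oneD copD epsD SD by (rule D)
  note lf = is_integral_lfun[OF l]
  note ml = multilin lf lfun_comp[OF lf] lfun_coord lin_comp[OF phi] lfun_comp[OF lfun_coord theta]
  define f where "f = (\<lambda>d. l (v \<odot> \<phi> d))"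
  define J where "J = (\<Union>p\<in>supp (\<Delta> v). supp (\<theta> (S (bvec (fst p)))))"
  have [simp]: "\<phi> d \<in> vecs" if "d \<in> vecs" for d using lin_vecs[OF phi that] .
  have f: "lfun f" unfolding f_def using v by (intro ml | simp)+
  have "D.rational_on J f"
    unfolding D.rational_on_def
  proof (intro conjI f allI impI ballI)
    show "finite J"
      using cop_vecs[OF v(1)] lin_vecs[OF theta S_vecs[OF bvec_vecs]] by (simp add: J_def vecs_iff)
  next
    fix j d assume j: "j \<notin> J" and d: "d \<in> (vecs :: ('j \<Rightarrow> 'k) set)"
    \<comment> \<open>Colinearity first moves the free leg from \<open>d\<close> to
      \<open>\<phi> d\<close>; \<open>translate_left\<close> then trades it for a leg of the fixed
      vector \<open>v\<close>, so that the bound \<open>J\<close> is uniform in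
      \<open>d\<close>.\<close>
    have "D.rcoef f j d = tsum (\<Delta> (\<phi> d)) (\<lambda>x y. \<theta> x j * l (v \<odot> y))"
      unfolding D.rcoef_def f_def using d v by (intro colin[where F = "\<lambda>x y. x j * l (v \<odot> y)"]) (intro ml | simp)+
    also have "\<dots> = tsum (\<Delta> v) (\<lambda>b1 b2. \<theta> (S b1) j * l (b2 \<odot> \<phi> d))"
      using d v by (intro translate_left[OF l, where G = "\<lambda>x. \<theta> x j"] lfun_comp[OF lfun_coord theta]) simp_all
    also have "\<dots> = 0"
      unfolding tsum_def using j by (intro sum.neutral) (auto simp: J_def)
    finally show "D.rcoef f j d = 0" .
  qed
  moreover have "f oneD \<noteq> 0" using v by (simp add: f_def phi1)
  ultimately show ?thesis by (rule D.rational_imp_integral)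
qed

text \<open>The Hopf module map \<open>h \<mapsto> \<integral>(\<cdot> S(h))\<close> is injective because the coinvariant projection inverts it.\<close>

lemma S_kernel:
  assumes l: "is_integral l" and d: "d \<in> vecs" "l d \<noteq> 0" and h: "h \<in> vecs" "S h = vzero"
  shows "h = vzero"
proof (rule vec_eq_0_by_lfun)
  fix G :: "('i \<Rightarrow> 'k) \<Rightarrow> 'k" assume G: "lfun G"
  note lf = is_integral_lfun[OF l]
  note ml = multilin lf G lfun_comp[OF lf] lfun_comp[OF G] lfun_coord
  \<comment> \<open>Invariance of \<open>l\<close> at \<open>x S(h1)\<close>, multiplied by
    \<open>h2\<close>, is one side of \<open>translate_S\<close>; the other side contains
    \<open>S h\<close>, which is zero.\<close>
  have 0: "tsum (\<Delta> h) (\<lambda>z1 z2. l (x \<odot> S z1) * G' z2) = 0" if x: "x \<in> vecs" and G': "lfun G'" for x G'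
  proof -
    have "tsum (\<Delta> h) (\<lambda>z1 z2. l (x \<odot> S z1) * G' z2)
       = tsum (\<Delta> h) (\<lambda>z1 z2. tsum (\<Delta> (x \<odot> S z1)) (\<lambda>u1 u2. G' (u1 \<odot> z2) * l u2))"
    proof (rule tsum_cong)
      fix z1 z2 :: "'i \<Rightarrow> 'k" assume v: "z1 \<in> vecs" "z2 \<in> vecs"
      have "tsum (\<Delta> (x \<odot> S z1)) (\<lambda>u1 u2. G' (u1 \<odot> z2) * l u2) = l (x \<odot> S z1) * G' (\<one> \<odot> z2)"
        using v x by (intro is_integral_eq[OF l]) (intro multilin lfun_comp[OF G'] | simp)+
      then show "l (x \<odot> S z1) * G' z2 = tsum (\<Delta> (x \<odot> S z1)) (\<lambda>u1 u2. G' (u1 \<odot> z2) * l u2)"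
        using v by simp
    qed
    also have "\<dots> = tsum (\<Delta> x) (\<lambda>u1 u2. G' u1 * l (u2 \<odot> S h))"
      by (rule translate_S[OF G' lf x h(1), symmetric])
    also have "\<dots> = 0"
    proof -
      have "l (u \<odot> S h) = 0" if "u \<in> vecs" for u
        using lfun_vzero[OF lfun_comp[OF lf lin_mulR[OF that]]] h by simp
      then show ?thesis by (simp add: tsum_def)
    qed
    finally show ?thesis .
  qed
  let ?F = "\<lambda>z1 z2 z3. l (d \<odot> S (S z2) \<odot> S z1) * G z3"
  \<comment> \<open>The element \<open>h\<close> is reinserted as
    \<open>S(h1 S(h2)) \<otimes> h3\<close>; reversing the product produces a factor
    \<open>S(h1)\<close> at the far right, where fact \<open>0\<close> can act.\<close>
  have "G h * l (d \<odot> S \<one>) = tsum (\<Delta> h) (\<lambda>z' z3. \<epsilon> z' * (l (d \<odot> S \<one>) * G z3))"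
    using h d by (intro trans[OF _ counit1[symmetric]]) (intro ml | simp)+
  also have "\<dots> = tsum (\<Delta> h) (\<lambda>z' z3. tsum (\<Delta> z') (\<lambda>z1 z2. l (d \<odot> S (z1 \<odot> S z2)) * G z3))"
    using d by (intro tsum_cong antipode2[symmetric]) (intro ml | simp)+
  also have "\<dots> = tsum (\<Delta> h) (\<lambda>z' z3. tsum (\<Delta> z') (\<lambda>z1 z2. ?F z1 z2 z3))"
    using d by (intro tsum_cong) (simp add: S_mul mul_assoc)
  also have "\<dots> = tsum (\<Delta> h) (\<lambda>z1 z'. tsum (\<Delta> z') (\<lambda>z2 z3. ?F z1 z2 z3))"
    using h d by (intro coassoc) (intro ml | simp)+
  \<comment> \<open>Fact \<open>0\<close> requires the left factor \<open>x\<close> to be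
    independent of the legs of \<open>h\<close>. Expanding the second leg in coordinates makes
    \<open>x = d S(S(z2))\<close> range over legs of a basis vector instead.\<close>
  also have "\<dots> = (\<Sum>i\<in>snd ` supp (\<Delta> h). tsum (\<Delta> h) (\<lambda>z1 z'. z' i * tsum (\<Delta> (bvec i)) (\<lambda>z2 z3. ?F z1 z2 z3)))"
    using cop_vecs[OF h(1)] by (intro tsum_expand_right) (simp_all add: vecs_iff)
  also have "\<dots> = (\<Sum>i\<in>snd ` supp (\<Delta> h). tsum (\<Delta> (bvec i)) (\<lambda>z2 z3. tsum (\<Delta> h) (\<lambda>z1 z'. l (d \<odot> S (S z2) \<odot> S z1) * z' i) * G z3))"
  proof (rule sum.cong[OF refl])
    fix i
    have "tsum (\<Delta> h) (\<lambda>z1 z'. z' i * tsum (\<Delta> (bvec i)) (\<lambda>z2 z3. ?F z1 z2 z3))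
       = tsum (\<Delta> h) (\<lambda>z1 z'. tsum (\<Delta> (bvec i)) (\<lambda>z2 z3. l (d \<odot> S (S z2) \<odot> S z1) * z' i * G z3))"
      by (simp add: tsum_mult_left[symmetric] mult_ac)
    also have "\<dots> = tsum (\<Delta> (bvec i)) (\<lambda>z2 z3. tsum (\<Delta> h) (\<lambda>z1 z'. l (d \<odot> S (S z2) \<odot> S z1) * z' i) * G z3)"
      by (subst tsum_swap) (simp add: tsum_mult_right)
    finally show "tsum (\<Delta> h) (\<lambda>z1 z'. z' i * tsum (\<Delta> (bvec i)) (\<lambda>z2 z3. ?F z1 z2 z3)) = \<dots>" .
  qed
  also have "\<dots> = (\<Sum>i\<in>snd ` supp (\<Delta> h). tsum (\<Delta> (bvec i)) (\<lambda>z2 z3. 0 * G z3))"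
    using d by (intro sum.cong refl tsum_cong arg_cong2[where f = "(*)"] 0 lfun_coord) simp_all
  also have "\<dots> = 0" by (simp add: tsum_def)
  finally show "G h = 0" using d by (simp add: S_one)
qed

text \<open>For an integral \<open>L\<close>, the antipode sends
  \<open>L(S(h1)) h2 - L(S(h)) 1\<close> to the defect of invariance of \<open>L\<close> at
  \<open>S(h)\<close>, which is zero. Since \<open>S\<close> has trivial kernel,
  \<open>L \<circ> S\<close> satisfies the mirrored condition.\<close>

lemma integral_imp_left_integral:
  assumes l: "is_integral l" and d: "d \<in> vecs" "l d \<noteq> 0"
  shows "\<exists>l'. lfun l' \<and> (\<exists>v\<in>vecs. l' v \<noteq> 0) \<and>
    (\<forall>h\<in>vecs. \<forall>G. lfun G \<longrightarrow> tsum (\<Delta> h) (\<lambda>x y. l' x * G y) = l' h * G \<one>)"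
proof -
  \<comment> \<open>Transfer along the identity exchanges \<open>l\<close> for an integral that is
    known to be nonzero on the image of \<open>S\<close>.\<close>
  obtain L z where L: "is_integral L" and z: "z \<in> vecs" "L (S z) \<noteq> 0"
    using integral_transfer[OF hopf_calculus_axioms lin_id(1) lin_id(1) refl refl l d] by blast
  have lf: "lfun (\<lambda>x. L (S x))" by (rule lfun_comp[OF is_integral_lfun[OF L] lin_S])
  have "tsum (\<Delta> h) (\<lambda>x y. L (S x) * G y) = L (S h) * G \<one>" if h: "h \<in> vecs" and G: "lfun G" for h G
  proof -
    define u where "u = vadd (vtsum (\<Delta> h) (\<lambda>x y. vsmul (L (S x)) y)) (vsmul (- L (S h)) \<one>)"
    have v: "vtsum (\<Delta> h) (\<lambda>x y. vsmul (L (S x)) y) \<in> vecs"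
      using h by (intro lin_vecs[OF lin_vtsum]) simp_all
    have Gu: "G u = tsum (\<Delta> h) (\<lambda>x y. L (S x) * G y) - L (S h) * G \<one>" if G: "lfun G" for G
    proof -
      have "G (vtsum (\<Delta> h) (\<lambda>x y. vsmul (L (S x)) y)) = tsum (\<Delta> h) (\<lambda>x y. L (S x) * G y)"
        using G h by (simp add: lfun_vtsum lfun_vsmul cong: tsum_cong)
      then show ?thesis
        unfolding u_def using v G by (simp add: lfun_vadd lfun_vsmul)
    qed
    have "S u = vzero"
    proof (rule vec_eq_0_by_lfun)
      fix G :: "('i \<Rightarrow> 'k) \<Rightarrow> 'k" assume G: "lfun G"
      have "G (S u) = tsum (\<Delta> h) (\<lambda>x y. L (S x) * G (S y)) - L (S h) * G (S \<one>)"
        by (rule Gu[OF lfun_comp[OF G lin_S]])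
      also have "tsum (\<Delta> h) (\<lambda>x y. L (S x) * G (S y)) = tsum (\<Delta> (S h)) (\<lambda>x y. G x * L y)"
        using h by (subst cop_S) (intro multilin G is_integral_lfun[OF L] | simp add: mult.commute)+
      also have "\<dots> = L (S h) * G \<one>" using is_integral_eq[OF L G] h by simp
      finally show "G (S u) = 0" by (simp add: S_one)
    qed
    moreover have "u \<in> vecs" unfolding u_def using v by simp
    ultimately have "u = vzero" using S_kernel[OF l d] by blast
    then show ?thesis using Gu[OF G] lfun_vzero[OF G] by simp
  qed
  then show ?thesis using lf z by blast
qed

text \<open>Reversing both structures preserves the antipode axioms for the same \<open>S\<close>,
  whereas reversing just one would call for its inverse. Integrals of the reversed algebra are the
  functionals with \<open>l(h1) h2 = l(h) 1\<close>.\<close>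

lemma opcop: "hopf_calculus (\<lambda>u v. v \<odot> u) \<one> (\<lambda>v. flip (\<Delta> v)) \<epsilon> S"
proof (rule hopf_calculus.intro, unfold tsum_flip)
  show "lin (\<lambda>v. flip (\<Delta> v))" by (rule lin_comp[OF lin_flip lin_cop])
next
  fix F :: "('i \<Rightarrow> 'k) \<Rightarrow> ('i \<Rightarrow> 'k) \<Rightarrow> ('i \<Rightarrow> 'k) \<Rightarrow> 'k" and v :: "'i \<Rightarrow> 'k"
  assume F: "trilin F" and v: "v \<in> vecs"
  have "trilin (\<lambda>a b c. F c b a)" using F by (simp add: trilin_def)
  from coassoc[OF this v]
  show "tsum (\<Delta> v) (\<lambda>x y. tsum (\<Delta> y) (\<lambda>a b. F b a x)) = tsum (\<Delta> v) (\<lambda>x y. tsum (\<Delta> x) (\<lambda>a b. F y b a))"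
    by (rule sym)
next
  fix F :: "('i \<Rightarrow> 'k) \<Rightarrow> ('i \<Rightarrow> 'k) \<Rightarrow> 'k" and u v :: "'i \<Rightarrow> 'k"
  assume F: "bilin F" and v: "u \<in> vecs" "v \<in> vecs"
  have "bilin (\<lambda>a b. F b a)" using F by (simp add: bilin_def)
  from cop_mul[OF this v(2) v(1)]
  show "tsum (\<Delta> (v \<odot> u)) (\<lambda>x y. F y x) = tsum (\<Delta> u) (\<lambda>x y. tsum (\<Delta> v) (\<lambda>a b. F (b \<odot> y) (a \<odot> x)))"
    by (subst tsum_swap)
next
  fix F :: "('i \<Rightarrow> 'k) \<Rightarrow> ('i \<Rightarrow> 'k) \<Rightarrow> 'k"
  assume F: "bilin F"
  have "bilin (\<lambda>a b. F b a)" using F by (simp add: bilin_def)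
  then show "tsum (\<Delta> \<one>) (\<lambda>x y. F y x) = F \<one> \<one>" by (rule cop_one)
next
  fix u v w :: "'i \<Rightarrow> 'k" assume v: "u \<in> vecs" "v \<in> vecs" "w \<in> vecs"
  show "w \<odot> (v \<odot> u) = w \<odot> v \<odot> u" using v by (simp add: mul_assoc)
next
  fix u v :: "'i \<Rightarrow> 'k" assume v: "u \<in> vecs" "v \<in> vecs"
  show "\<epsilon> (v \<odot> u) = \<epsilon> u * \<epsilon> v" using v by (simp add: eps_mul)
next
  fix v :: "'i \<Rightarrow> 'k" and G :: "('i \<Rightarrow> 'k) \<Rightarrow> 'k" assume v: "v \<in> vecs" and G: "lfun G"
  show "tsum (\<Delta> v) (\<lambda>x y. \<epsilon> y * G x) = G v" by (rule counit2[OF G v])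
  show "tsum (\<Delta> v) (\<lambda>x y. \<epsilon> x * G y) = G v" by (rule counit1[OF G v])
  show "tsum (\<Delta> v) (\<lambda>x y. G (x \<odot> S y)) = \<epsilon> v * G \<one>" by (rule antipode2[OF G v])
  show "tsum (\<Delta> v) (\<lambda>x y. G (S x \<odot> y)) = \<epsilon> v * G \<one>" by (rule antipode1[OF G v])
next
  fix v :: "'i \<Rightarrow> 'k" assume v: "v \<in> vecs"
  show "lin (\<lambda>u. u \<odot> v)" by (rule lin_mulL[OF v])
  show "lin (\<lambda>u. v \<odot> u)" by (rule lin_mulR[OF v])
  show "v \<odot> \<one> = v" "\<one> \<odot> v = v" by (rule mul_one[OF v])+
next
  show "\<one> \<in> vecs" "lfun \<epsilon>" "\<epsilon> \<one> = 1" "lin S"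
    by (rule one_vecs lfun_eps eps_one lin_S)+
qed

end

lemma (in hopf_calculus) integral_opcop_iff:
  "hopf_calculus.is_integral \<one> (\<lambda>v. flip (\<Delta> v)) l \<longleftrightarrow>
   lfun l \<and> (\<forall>h\<in>vecs. \<forall>G. lfun G \<longrightarrow> tsum (\<Delta> h) (\<lambda>x y. l x * G y) = l h * G \<one>)"
  unfolding hopf_calculus.is_integral_def[OF opcop] tsum_flip by (simp only: mult.commute)

section \<open>From Hopf algebra records to tested axioms\<close>

lemma hopf_calculus_of_hopf_alg:
  assumes H: "hopf_alg H"
  shows "hopf_calculus (hmul H) (hone H) (hcomul H) (hcounit H) (hanti H)"
proof -
  let ?D = "hcomul H"
  have mulR: "\<forall>u\<in>vecs. lin (hmul H u)" and mulL: "\<forall>v\<in>vecs. lin (\<lambda>u. hmul H u v)"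
    and one: "hone H \<in> vecs" "\<forall>v\<in>vecs. hmul H (hone H) v = v \<and> hmul H v (hone H) = v"
    and assoc: "\<forall>u\<in>vecs. \<forall>v\<in>vecs. \<forall>w\<in>vecs. hmul H (hmul H u v) w = hmul H u (hmul H v w)"
    and D: "lin ?D" and e: "lfun (hcounit H)" and S: "lin (hanti H)"
    and coas: "\<forall>v\<in>vecs. \<forall>a b c. tmap ?D id (?D v) ((a, b), c) = tmap id ?D (?D v) (a, (b, c))"
    and cou: "\<forall>v\<in>vecs. epsL H (?D v) = v \<and> epsR H (?D v) = v"
    and Dmul: "\<forall>u\<in>vecs. \<forall>v\<in>vecs. ?D (hmul H u v) = tmul H (?D u) (?D v)"
    and Done: "?D (hone H) = tens (hone H) (hone H)"
    and emul: "\<forall>u\<in>vecs. \<forall>v\<in>vecs. hcounit H (hmul H u v) = hcounit H u * hcounit H v"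
    and eone: "hcounit H (hone H) = 1"
    and anti: "\<forall>v\<in>vecs. mulT H (tmap (hanti H) id (?D v)) = vsmul (hcounit H v) (hone H) \<and>
                mulT H (tmap id (hanti H) (?D v)) = vsmul (hcounit H v) (hone H)"
    using H[unfolded hopf_alg_def] by - (elim conjE, assumption)+
  have mv: "hmul H u v \<in> vecs" if "u \<in> vecs" "v \<in> vecs" for u v
    using mulR that lin_vecs[of "hmul H u" v] by blast
  have mulT: "G (mulT H t) = tsum t (\<lambda>x y. G (hmul H x y))" if "lfun G" "t \<in> vecs" for G :: "('a \<Rightarrow> 'b) \<Rightarrow> 'b" and t
    using lfun_vtsum[OF that, of "hmul H"] mv by (simp add: vtsum_def mulT_def split_def)
  have bmul: "bilin (\<lambda>x y. G (hmul H x y))" if "lfun G" for G :: "('a \<Rightarrow> 'b) \<Rightarrow> 'b"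
    using mulR mulL that by (intro bilinI lfun_comp[OF that]) auto
  show ?thesis
  proof
    fix F :: "('a \<Rightarrow> 'b) \<Rightarrow> ('a \<Rightarrow> 'b) \<Rightarrow> ('a \<Rightarrow> 'b) \<Rightarrow> 'b" and v :: "'a \<Rightarrow> 'b"
    assume F: "trilin F" and v: "v \<in> vecs"
    have Dv: "?D v \<in> vecs" by (rule lin_vecs[OF D v])
    have "tsum (?D v) (\<lambda>x y. tsum (?D x) (\<lambda>a b. F a b y)) = tsum (tmap ?D id (?D v)) (\<lambda>u z. tsum u (\<lambda>x y. F x y z))"
      using F Dv by (subst tsum_tmap[OF _ D]) (auto intro!: bilinI lfun_tsum_form lfun_tsum simp: trilin_def)
    also have "\<dots> = tsum (tmap id ?D (?D v)) (\<lambda>x u. tsum u (\<lambda>y z. F x y z))"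
      using coas v by (intro tsum_assoc) blast
    also have "\<dots> = tsum (?D v) (\<lambda>x y. tsum (?D y) (\<lambda>a b. F x a b))"
      using F Dv by (subst tsum_tmap[OF _ _ D]) (auto intro!: bilinI lfun_tsum_form lfun_tsum simp: trilin_def)
    finally show "tsum (?D v) (\<lambda>x y. tsum (?D x) (\<lambda>a b. F a b y)) = \<dots>" .
  next
    fix G :: "('a \<Rightarrow> 'b) \<Rightarrow> 'b" and v :: "'a \<Rightarrow> 'b"
    assume G: "lfun G" and v: "v \<in> vecs"
    have Dv: "?D v \<in> vecs" by (rule lin_vecs[OF D v])
    have "G v = G (epsL H (?D v))" using cou v by simp
    also have "\<dots> = tsum (?D v) (\<lambda>x y. G (vsmul (hcounit H x) y))"
      using lfun_vtsum[OF G Dv, of "\<lambda>x y. vsmul (hcounit H x) y"] by (simp add: vtsum_def epsL_def split_def)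
    finally show "tsum (?D v) (\<lambda>x y. hcounit H x * G y) = G v"
      using G by (simp add: lfun_vsmul cong: tsum_cong)
    have "G v = G (epsR H (?D v))" using cou v by simp
    also have "\<dots> = tsum (?D v) (\<lambda>x y. G (vsmul (hcounit H y) x))"
      using lfun_vtsum[OF G Dv, of "\<lambda>x y. vsmul (hcounit H y) x"] by (simp add: vtsum_def epsR_def split_def)
    finally show "tsum (?D v) (\<lambda>x y. hcounit H y * G x) = G v"
      using G by (simp add: lfun_vsmul cong: tsum_cong)
    have "vsmul (hcounit H v) (hone H) = mulT H (tmap (hanti H) id (?D v))" 
         "vsmul (hcounit H v) (hone H) = mulT H (tmap id (hanti H) (?D v))" using anti v by simp_all
    moreover have "G (vsmul (hcounit H v) (hone H)) = hcounit H v * G (hone H)"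
      using G one by (simp add: lfun_vsmul)
    ultimately show "tsum (?D v) (\<lambda>x y. G (hmul H (hanti H x) y)) = hcounit H v * G (hone H)"
      and "tsum (?D v) (\<lambda>x y. G (hmul H x (hanti H y))) = hcounit H v * G (hone H)"
      using mulT[OF G lin_vecs[OF lin_tmap[OF S lin_id(2)] Dv]] mulT[OF G lin_vecs[OF lin_tmap[OF lin_id(2) S] Dv]]
        tsum_tmap[OF bmul[OF G] S lin_id(2) Dv] tsum_tmap[OF bmul[OF G] lin_id(2) S Dv]
      by simp_all
  next
    fix F :: "('a \<Rightarrow> 'b) \<Rightarrow> ('a \<Rightarrow> 'b) \<Rightarrow> 'b" and u v :: "'a \<Rightarrow> 'b"
    assume F: "bilin F" and v: "u \<in> vecs" "v \<in> vecs"
    have "?D (hmul H u v) = tmul H (?D u) (?D v)" using Dmul v by simp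
    also have "\<dots> = vtsum (?D u) (\<lambda>a b. vtsum (?D v) (\<lambda>c d. tens (hmul H a c) (hmul H b d)))"
      by (simp add: tmul_def vtsum_def split_def)
    finally have "tsum (?D (hmul H u v)) F
        = tsum (vtsum (?D u) (\<lambda>a b. vtsum (?D v) (\<lambda>c d. tens (hmul H a c) (hmul H b d)))) F"
      by (rule arg_cong)
    also have "\<dots> = tsum (?D u) (\<lambda>a b. tsum (vtsum (?D v) (\<lambda>c d. tens (hmul H a c) (hmul H b d))) F)"
      by (rule lfun_vtsum[OF lfun_tsum lin_vecs[OF D v(1)]])
         (intro lin_vecs[OF lin_vtsum] lin_vecs[OF D v(2)] tens_vecs mv)
    also have "\<dots> = tsum (?D u) (\<lambda>a b. tsum (?D v) (\<lambda>c d. F (hmul H a c) (hmul H b d)))"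
    proof (rule tsum_cong)
      fix a b :: "'a \<Rightarrow> 'b" assume ab: "a \<in> vecs" "b \<in> vecs"
      have "tsum (vtsum (?D v) (\<lambda>c d. tens (hmul H a c) (hmul H b d))) F
          = tsum (?D v) (\<lambda>c d. tsum (tens (hmul H a c) (hmul H b d)) F)"
        using ab by (intro lfun_vtsum[OF lfun_tsum] lin_vecs[OF D v(2)] tens_vecs mv)
      also have "\<dots> = tsum (?D v) (\<lambda>c d. F (hmul H a c) (hmul H b d))"
        using ab by (intro tsum_cong tsum_tens[OF F] mv)
      finally show "tsum (vtsum (?D v) (\<lambda>c d. tens (hmul H a c) (hmul H b d))) F = \<dots>" .
    qed
    finally show "tsum (?D (hmul H u v)) F = \<dots>" .
  next
    fix F :: "('a \<Rightarrow> 'b) \<Rightarrow> ('a \<Rightarrow> 'b) \<Rightarrow> 'b" assume "bilin F"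
    then show "tsum (?D (hone H)) F = F (hone H) (hone H)" by (simp add: Done one tsum_tens)
  next
    fix u v w :: "'a \<Rightarrow> 'b" assume "u \<in> vecs" "v \<in> vecs" "w \<in> vecs"
    then show "hmul H (hmul H u v) w = hmul H u (hmul H v w)" by (rule assoc[rule_format])
  next
    fix u v :: "'a \<Rightarrow> 'b" assume "u \<in> vecs" "v \<in> vecs"
    then show "hcounit H (hmul H u v) = hcounit H u * hcounit H v" by (rule emul[rule_format])
  next
    fix v :: "'a \<Rightarrow> 'b" assume v: "v \<in> vecs"
    show "lin (hmul H v)" by (rule mulR[rule_format, OF v])
    show "lin (\<lambda>u. hmul H u v)" by (rule mulL[rule_format, OF v])
    show "hmul H (hone H) v = v" "hmul H v (hone H) = v" using one(2)[rule_format, OF v] by simp_all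
  next
    show "hone H \<in> vecs" "lfun (hcounit H)" "hcounit H (hone H) = 1" "lin ?D" "lin (hanti H)"
      by (rule one e eone D S)+
  qed
qed

lemma cofrob_iff_integral:
  assumes H: "hopf_alg H"
  shows "cofrob H \<longleftrightarrow> (\<exists>l. hopf_calculus.is_integral (hone H) (hcomul H) l \<and> (\<exists>v\<in>vecs. l v \<noteq> 0))"
proof -
  interpret hopf_calculus "hmul H" "hone H" "hcomul H" "hcounit H" "hanti H"
    by (rule hopf_calculus_of_hopf_alg[OF H])
  have G: "G (linext (\<lambda>(a, b). vsmul (l (bvec b)) (bvec a)) (hcomul H h)) = tsum (hcomul H h) (\<lambda>x y. G x * l y)"
    if "lfun G" "h \<in> vecs" for G l h
    using lfun_vtsum[OF that(1) cop_vecs[OF that(2)], of "\<lambda>x y. vsmul (l y) x"] that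
    by (simp add: vtsum_def split_def lfun_vsmul mult.commute cong: tsum_cong)
  have "(\<forall>h\<in>vecs. linext (\<lambda>(a, b). vsmul (l (bvec b)) (bvec a)) (hcomul H h) = vsmul (l h) (hone H))
     \<longleftrightarrow> (\<forall>h\<in>vecs. \<forall>G. lfun G \<longrightarrow> tsum (hcomul H h) (\<lambda>x y. G x * l y) = l h * G (hone H))" for l
  proof (intro ball_cong refl iffI allI impI)
    fix h and G :: "('a \<Rightarrow> 'b) \<Rightarrow> 'b" assume "h \<in> vecs" "lfun G"
      "linext (\<lambda>(a, b). vsmul (l (bvec b)) (bvec a)) (hcomul H h) = vsmul (l h) (hone H)"
    then show "tsum (hcomul H h) (\<lambda>x y. G x * l y) = l h * G (hone H)"
      using G[of G h l] by (simp add: lfun_vsmul)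
  next
    fix h :: "'a \<Rightarrow> 'b" assume "h \<in> vecs" and "\<forall>G. lfun G \<longrightarrow> tsum (hcomul H h) (\<lambda>x y. G x * l y) = l h * G (hone H)"
    then show "linext (\<lambda>(a, b). vsmul (l (bvec b)) (bvec a)) (hcomul H h) = vsmul (l h) (hone H)"
      by (intro eq_by_lfun) (simp add: G lfun_vsmul)
  qed
  then show ?thesis unfolding cofrob_def is_integral_def by (simp only: conj_ac)
qed

subsection \<open>Coflatness and extension of colinear maps\<close>

text \<open>Contraction of the second tensor factor with a coordinate functional. A subspace is a
  right subcomodule exactly when it is closed under all slices of the coaction, and colinearity can
  be checked slice by slice.\<close>

definition slice :: "'j \<Rightarrow> ('i \<times> 'j \<Rightarrow> 'k) \<Rightarrow> 'i \<Rightarrow> 'k" where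
  "slice j t = (\<lambda>x. t (x, j))"

lemma vecs_on_vecs: "v \<in> vecs_on I \<Longrightarrow> v \<in> vecs"
  by (simp add: vecs_on_def)

lemma lin_onI:
  assumes "\<And>v. v \<in> vecs_on I \<Longrightarrow> f v \<in> vecs_on J" "\<And>j. lfun (\<lambda>v. f v j)"
  shows "lin_on I J f"
proof -
  have "f (vadd u v) = vadd (f u) (f v)" if "u \<in> vecs_on I" "v \<in> vecs_on I" for u v
    using lfun_vadd[OF assms(2) vecs_on_vecs[OF that(1)] vecs_on_vecs[OF that(2)]]
    by (simp add: vadd_def fun_eq_iff)
  moreover have "f (vsmul c v) = vsmul c (f v)" if "v \<in> vecs_on I" for c v
    using lfun_vsmul[OF assms(2) vecs_on_vecs[OF that]] by (simp add: vsmul_def fun_eq_iff)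
  ultimately show ?thesis using assms(1) by (simp add: lin_on_def)
qed

lemma lin_slice: "lin (slice j)"
proof (rule lin_onI)
  fix t :: "'a \<times> 'b \<Rightarrow> 'c" assume "t \<in> vecs"
  moreover have "supp (slice j t) \<subseteq> fst ` supp t" by (force simp: slice_def)
  ultimately show "slice j t \<in> vecs" by (auto simp: vecs_iff intro: finite_subset)
qed (simp add: slice_def lfun_coord)

lemma slice_vecs [simp]: "t \<in> vecs \<Longrightarrow> slice j t \<in> vecs"
  for t :: "'i \<times> 'j \<Rightarrow> 'k::field"
  by (rule lin_vecs[OF lin_slice])

lemma lfun_slice:
  fixes l :: "('i \<Rightarrow> 'k::field) \<Rightarrow> 'k" and t :: "'i \<times> 'j \<Rightarrow> 'k"
  assumes l: "lfun l" and t: "t \<in> vecs"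
  shows "l (slice j t) = tsum t (\<lambda>x y. y j * l x)"
proof (rule lfun_eqI[OF lfun_comp[OF l lin_slice] lfun_tsum _ t])
  fix p :: "'i \<times> 'j"
  obtain a b where p: "p = (a, b)" by fastforce
  have "slice j (bvec (a, b) :: _ \<Rightarrow> 'k) = vsmul (bvec b j) (bvec a)"
    by (auto simp: slice_def bvec_apply vsmul_def)
  then show "l (slice j (bvec p)) = tsum (bvec p) (\<lambda>x y. y j * l x)"
    using l by (simp add: p tsum_bvec lfun_vsmul)
qed

lemma tsum_slices:
  assumes F: "bilin F" and t: "t \<in> vecs_on (UNIV \<times> J)" and J: "finite J"
  shows "tsum t F = (\<Sum>j\<in>J. F (slice j t) (bvec j))"
proof -
  have tv: "t \<in> vecs" and s: "supp t \<subseteq> UNIV \<times> J" using t by (auto simp: vecs_on_def)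
  have "tsum t F = (\<Sum>j\<in>J. tsum t (\<lambda>x y. y j * F x (bvec j)))"
    using s by (intro tsum_expand_right tv J) auto
  also have "\<dots> = (\<Sum>j\<in>J. F (slice j t) (bvec j))"
    using F by (intro sum.cong refl lfun_slice[OF _ tv, symmetric]) (simp add: bilin_def)
  finally show ?thesis .
qed

lemma tsum_vzero [simp]: "tsum vzero F = 0"
  by (simp add: tsum_def vzero_def supp_def)

lemma epsL_coord: "epsL H t x = tsum t (\<lambda>u y. hcounit H u * y x)"
  by (simp add: epsL_def linext_def tsum_def split_def vsmul_def)

text \<open>A matrix coalgebra \<open>c\<close> makes the row space on \<open>J\<close> a left comodule; it is dual to the right comodule
  with basis \<open>v\<^sub>j\<close> and coaction \<open>v\<^sub>j \<mapsto> \<Sum>i. v\<^sub>i \<otimes> c\<^sub>i\<^sub>j\<close>.\<close>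

definition dual_coact :: "(nat \<Rightarrow> nat \<Rightarrow> 'c \<Rightarrow> 'k) \<Rightarrow> nat set \<Rightarrow> (nat \<Rightarrow> 'k) \<Rightarrow> 'c \<times> nat \<Rightarrow> 'k::field" where
  "dual_coact c J n = (\<lambda>(z, j). if j \<in> J then \<Sum>i\<in>J. n i * c i j z else 0)"

definition restr :: "nat set \<Rightarrow> (nat \<Rightarrow> 'k) \<Rightarrow> nat \<Rightarrow> 'k::zero" where
  "restr J n = (\<lambda>j. if j \<in> J then n j else 0)"

lemma slice_dual_coact: "j \<in> J \<Longrightarrow> slice j (dual_coact c J n) = (\<lambda>z. \<Sum>i\<in>J. n i * c i j z)"
  by (simp add: slice_def dual_coact_def)

lemma dual_coact_bvec:
  "finite J \<Longrightarrow> i \<in> J \<Longrightarrow> dual_coact c J (bvec i) (z, j) = (if j \<in> J then c i j z else 0)"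
  by (simp add: dual_coact_def bvec_apply if_distrib[of "\<lambda>x. x * _"] cong: if_cong)

lemma dual_coact_vecs:
  fixes c :: "nat \<Rightarrow> nat \<Rightarrow> 'c \<Rightarrow> 'k::field"
  assumes J: "finite J" and c: "\<And>i j. i \<in> J \<Longrightarrow> j \<in> J \<Longrightarrow> c i j \<in> vecs"
  shows "dual_coact c J n \<in> vecs_on (UNIV \<times> J)"
proof -
  have "supp (dual_coact c J n) \<subseteq> (\<Union>i\<in>J. \<Union>j\<in>J. supp (c i j)) \<times> J"
    by (auto simp: dual_coact_def split: if_splits elim!: sum.not_neutral_contains_not_neutral) blast
  moreover have "finite ((\<Union>i\<in>J. \<Union>j\<in>J. supp (c i j)) \<times> J)"
    using J c by (auto simp: vecs_iff)
  ultimately show ?thesis by (auto simp: vecs_on_def intro: finite_subset)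
qed

lemma lfun_dual_coact: "lfun (\<lambda>n. dual_coact c J n p)"
  by (cases p) (auto simp: dual_coact_def lfun_def vadd_def vsmul_def distrib_right sum.distrib
      sum_distrib_left mult.assoc)

lemma lfun_restr: "lfun (\<lambda>n. restr J n j)"
  by (auto simp: restr_def lfun_def vadd_def vsmul_def)

lemma tsum_dual_coact:
  assumes F: "bilin F" and J: "finite J" and c: "\<And>i j. i \<in> J \<Longrightarrow> j \<in> J \<Longrightarrow> c i j \<in> vecs"
  shows "tsum (dual_coact c J n) F = (\<Sum>j\<in>J. \<Sum>i\<in>J. n i * F (c i j) (bvec j))"
proof -
  have "tsum (dual_coact c J n) F = (\<Sum>j\<in>J. F (slice j (dual_coact c J n)) (bvec j))"
    by (rule tsum_slices[OF F dual_coact_vecs[OF J c] J])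
  also have "\<dots> = (\<Sum>j\<in>J. \<Sum>i\<in>J. n i * F (c i j) (bvec j))"
  proof (rule sum.cong[OF refl])
    fix j assume j: "j \<in> J"
    have "lfun (\<lambda>x. F x (bvec j))" using F by (simp add: bilin_def)
    then show "F (slice j (dual_coact c J n)) (bvec j) = (\<Sum>i\<in>J. n i * F (c i j) (bvec j))"
      unfolding slice_dual_coact[OF j] by (rule lfun_sum) (use J c j in auto)
  qed
  finally show ?thesis .
qed

lemma bilin_prod: "lfun f \<Longrightarrow> lfun g \<Longrightarrow> bilin (\<lambda>x y. f x * g y)"
  by (intro bilinI lfun_mult_left lfun_mult_right)

lemma sum_bvec_right: "finite J \<Longrightarrow> (\<Sum>j\<in>J. a j * bvec j x) = (if x \<in> J then a x else (0::'k::field))"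
  by (simp add: bvec_apply if_distrib[of "\<lambda>y. _ * y"] cong: if_cong)

text \<open>The row coaction is \<open>e_i \<mapsto> \<Sum>j. c_ij \<otimes> e_j\<close>; the two
  matrix identities for \<open>c\<close> are its coassociativity and counit laws in
  coordinates.\<close>

lemma lcomod_dual_coact:
  fixes C :: "('c, 'k::field) hopf"
  assumes C: "hopf_alg C" and J: "finite J"
    and c: "\<And>i j. i \<in> J \<Longrightarrow> j \<in> J \<Longrightarrow> c i j \<in> vecs"
    and cop: "\<And>i j p q. i \<in> J \<Longrightarrow> j \<in> J \<Longrightarrow> hcomul C (c i j) (p, q) = (\<Sum>k\<in>J. c i k p * c k j q)"
    and eps: "\<And>i j. i \<in> J \<Longrightarrow> j \<in> J \<Longrightarrow> hcounit C (c i j) = (if i = j then 1 else 0)"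
  shows "lcomod C J (dual_coact c J)"
proof -
  interpret hopf_calculus "hmul C" "hone C" "hcomul C" "hcounit C" "hanti C"
    by (rule hopf_calculus_of_hopf_alg[OF C])
  have 1: "lin_on J (UNIV \<times> J) (dual_coact c J)"
    by (intro lin_onI dual_coact_vecs J c lfun_dual_coact)
  have 2: "tmap (hcomul C) id (dual_coact c J n) ((c1, c2), x)
      = tmap id (dual_coact c J) (dual_coact c J n) (c1, (c2, x))" for n c1 c2 x
  proof -
    have "tmap (hcomul C) id (dual_coact c J n) ((c1, c2), x)
        = tsum (dual_coact c J n) (\<lambda>u y. hcomul C u (c1, c2) * y x)"
      by (simp add: tmap_coord)
    also have "\<dots> = (\<Sum>j\<in>J. \<Sum>i\<in>J. n i * (hcomul C (c i j) (c1, c2) * bvec j x))"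
      by (intro tsum_dual_coact J c bilin_prod lfun_coord lfun_comp[OF lfun_coord lin_cop])
    also have "\<dots> = (\<Sum>j\<in>J. (\<Sum>i\<in>J. n i * hcomul C (c i j) (c1, c2)) * bvec j x)"
      by (simp add: sum_distrib_right mult.assoc)
    also have "\<dots> = (if x \<in> J then \<Sum>i\<in>J. n i * (\<Sum>k\<in>J. c i k c1 * c k x c2) else 0)"
      using J by (simp add: sum_bvec_right cop)
    also have "\<dots> = (\<Sum>k\<in>J. \<Sum>i\<in>J. n i * (c i k c1 * dual_coact c J (bvec k) (c2, x)))"
      using J by (simp add: dual_coact_bvec sum_distrib_left) (rule impI, rule sum.swap)
    also have "\<dots> = tsum (dual_coact c J n) (\<lambda>u y. u c1 * dual_coact c J y (c2, x))"
      by (rule tsum_dual_coact[symmetric]) (intro J c bilin_prod lfun_coord lfun_dual_coact | assumption)+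
    finally show ?thesis by (simp add: tmap_coord)
  qed
  have 3: "epsL C (dual_coact c J n) = n" if n: "n \<in> vecs_on J" for n
  proof
    fix x
    have "epsL C (dual_coact c J n) x = (\<Sum>j\<in>J. \<Sum>i\<in>J. n i * (hcounit C (c i j) * bvec j x))"
      unfolding epsL_coord by (intro tsum_dual_coact J c bilin_prod lfun_coord lfun_eps)
    also have "\<dots> = (\<Sum>j\<in>J. (\<Sum>i\<in>J. n i * hcounit C (c i j)) * bvec j x)"
      by (simp add: sum_distrib_right mult.assoc)
    also have "\<dots> = (if x \<in> J then n x else 0)"
      using J by (simp add: sum_bvec_right eps if_distrib[of "\<lambda>y. _ * y"] cong: if_cong)
    also have "\<dots> = n x" using n by (auto simp: vecs_on_def supp_def)
    finally show "epsL C (dual_coact c J n) x = n x" .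
  qed
  show ?thesis unfolding lcomod_def using 1 2 3 by blast
qed

text \<open>Condition \<open>tri\<close> says that the \<open>v_j\<close> with
  \<open>j \<in> J0\<close> span a subcomodule. Cutting rows down to \<open>J0\<close> is the
  transpose of the inclusion, and the zero block makes this cut colinear.\<close>

lemma lcomod_map_restr:
  fixes c :: "nat \<Rightarrow> nat \<Rightarrow> 'c \<Rightarrow> 'k::field"
  assumes J: "finite J" "J0 \<subseteq> J" and c: "\<And>i j. i \<in> J \<Longrightarrow> j \<in> J \<Longrightarrow> c i j \<in> vecs"
    and tri: "\<And>i j. i \<in> J - J0 \<Longrightarrow> j \<in> J0 \<Longrightarrow> c i j = vzero"
  shows "lcomod_map J (dual_coact c J) J0 (dual_coact c J0) (restr J0)"
  unfolding lcomod_map_def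
proof (intro conjI ballI ext)
  show "lin_on J J0 (restr J0)"
    using J by (intro lin_onI lfun_restr) (auto simp: restr_def vecs_on_def supp_def intro: finite_subset split: if_splits)
  fix n :: "nat \<Rightarrow> 'k" and p :: "'c \<times> nat"
  obtain z x where p: "p = (z, x)" by fastforce
  have "tmap id (restr J0) (dual_coact c J n) (z, x) = (\<Sum>j\<in>J. \<Sum>i\<in>J. n i * (c i j z * restr J0 (bvec j) x))"
    unfolding tmap_coord id_apply by (intro tsum_dual_coact J c bilin_prod lfun_coord lfun_restr)
  also have "\<dots> = (\<Sum>j\<in>J. \<Sum>i\<in>J. if x \<in> J0 then n i * c i j z * bvec j x else 0)"
    by (intro sum.cong refl) (simp add: restr_def)
  also have "\<dots> = (if x \<in> J0 then \<Sum>i\<in>J. n i * c i x z else 0)"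
    using J by (auto simp: sum_distrib_right[symmetric] sum_bvec_right)
  also have "\<dots> = (if x \<in> J0 then \<Sum>i\<in>J0. n i * c i x z else 0)"
    using J tri by (auto intro!: sum.mono_neutral_right simp: vzero_def)
  finally show "dual_coact c J0 (restr J0 n) p = tmap id (restr J0) (dual_coact c J n) p"
    by (simp add: p dual_coact_def restr_def)
qed

text \<open>The cotensor product with the dual comodule is the space of colinear maps, so coflatness applied to the
  restriction map extends colinear maps along \<open>span {v\<^sub>j | j \<in> J0} \<subseteq> span {v\<^sub>j | j \<in> J}\<close>.\<close>

lemma coflat_extend:
  fixes B :: "('b, 'k::field) hopf" and C :: "('c, 'k) hopf"
    and c :: "nat \<Rightarrow> nat \<Rightarrow> 'c \<Rightarrow> 'k" and b :: "nat \<Rightarrow> 'b \<Rightarrow> 'k"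
  assumes B: "hopf_alg B" and C: "hopf_alg C" and pi: "lin \<pi>" and coflat: "faithfully_coflat B C \<pi>"
    and J: "finite J" "J0 \<subseteq> J"
    and c: "\<And>i j. i \<in> J \<Longrightarrow> j \<in> J \<Longrightarrow> c i j \<in> vecs"
    and cop: "\<And>i j p q. i \<in> J \<Longrightarrow> j \<in> J \<Longrightarrow> hcomul C (c i j) (p, q) = (\<Sum>k\<in>J. c i k p * c k j q)"
    and eps: "\<And>i j. i \<in> J \<Longrightarrow> j \<in> J \<Longrightarrow> hcounit C (c i j) = (if i = j then 1 else 0)"
    and tri: "\<And>i j. i \<in> J - J0 \<Longrightarrow> j \<in> J0 \<Longrightarrow> c i j = vzero"
    and b: "\<And>j. j \<in> J0 \<Longrightarrow> b j \<in> vecs"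
    and colin: "\<And>j x z. j \<in> J0 \<Longrightarrow> rcoact B \<pi> (b j) (x, z) = (\<Sum>i\<in>J0. b i x * c i j z)"
  shows "\<exists>b'. (\<forall>j\<in>J0. b' j = b j) \<and>
    (\<forall>j\<in>J. b' j \<in> vecs \<and> (\<forall>x z. rcoact B \<pi> (b' j) (x, z) = (\<Sum>i\<in>J. b' i x * c i j z)))"
proof -
  interpret B: hopf_calculus "hmul B" "hone B" "hcomul B" "hcounit B" "hanti B"
    by (rule hopf_calculus_of_hopf_alg[OF B])
  have rho: "lin (rcoact B \<pi>)"
    unfolding rcoact_def[abs_def] by (rule lin_comp[OF lin_tmap[OF lin_id(2) pi] B.lin_cop])
  have J0: "finite J0" using J finite_subset by blast
  have c0: "c i j \<in> vecs" if "i \<in> J0" "j \<in> J0" for i j using c J that by blast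
  \<comment> \<open>The slices of a tensor are the images of the dual basis vectors: membership in
    the cotensor product says that \<open>v_j \<mapsto> slice j t\<close> is colinear.\<close>
  have cotensor_iff: "t \<in> cotensor B \<pi> K (dual_coact c K) \<longleftrightarrow>
      t \<in> vecs_on (UNIV \<times> K) \<and> (\<forall>j\<in>K. \<forall>x z. rcoact B \<pi> (slice j t) (x, z) = (\<Sum>i\<in>K. slice i t x * c i j z))"
    if K: "finite K" for t K
  proof -
    have 1: "tmap (rcoact B \<pi>) id t ((x, z), j) = (if j \<in> K then rcoact B \<pi> (slice j t) (x, z) else 0)"
      if t: "t \<in> vecs_on (UNIV \<times> K)" for x z j
    proof -
      have "tmap (rcoact B \<pi>) id t ((x, z), j) = (\<Sum>i\<in>K. rcoact B \<pi> (slice i t) (x, z) * bvec i j)"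
        unfolding tmap_coord id_apply
        by (intro tsum_slices[OF _ t K] bilin_prod lfun_coord lfun_comp[OF lfun_coord rho])
      then show ?thesis using K by (simp add: sum_bvec_right)
    qed
    have 2: "tmap id (dual_coact c K) t (x, (z, j)) = (if j \<in> K then \<Sum>i\<in>K. slice i t x * c i j z else 0)"
      if t: "t \<in> vecs_on (UNIV \<times> K)" for x z j
    proof -
      have "tmap id (dual_coact c K) t (x, (z, j)) = (\<Sum>i\<in>K. slice i t x * dual_coact c K (bvec i) (z, j))"
        unfolding tmap_coord id_apply
        by (intro tsum_slices[OF _ t K] bilin_prod lfun_coord lfun_dual_coact)
      then show ?thesis using K by (simp add: dual_coact_bvec)
    qed
    have "(if P then u else 0) = (if P then v else 0) \<longleftrightarrow> (P \<longrightarrow> u = v)" for P and u v :: 'k by simp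
    with 1 2 show ?thesis by (cases "t \<in> vecs_on (UNIV \<times> K)") (auto simp: cotensor_def)
  qed
  have lc: "lcomod C J (dual_coact c J)"
    by (rule lcomod_dual_coact[OF C J(1)]) (use c cop eps in auto)
  have lc0: "lcomod C J0 (dual_coact c J0)"
  proof (rule lcomod_dual_coact[OF C J0])
    fix i j p q assume ij: "i \<in> J0" "j \<in> J0"
    have "hcomul C (c i j) (p, q) = (\<Sum>k\<in>J. c i k p * c k j q)" using ij J by (intro cop) auto
    also have "\<dots> = (\<Sum>k\<in>J0. c i k p * c k j q)"
      using J tri[OF _ ij(2)] by (intro sum.mono_neutral_right) (auto simp: vzero_def)
    finally show "hcomul C (c i j) (p, q) = (\<Sum>k\<in>J0. c i k p * c k j q)" .
  next
    fix i j assume ij: "i \<in> J0" "j \<in> J0"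
    show "c i j \<in> vecs" by (rule c0[OF ij])
    show "hcounit C (c i j) = (if i = j then 1 else 0)" using ij J by (intro eps) auto
  qed
  \<comment> \<open>Coflatness is phrased as exactness at a middle term, so surjectivity of the
    restriction is encoded by a sequence ending in the zero comodule, which is carried by the empty
    index set.\<close>
  have e: "vecs_on {} = {vzero :: nat \<Rightarrow> 'k}"
    by (auto simp: vecs_on_def supp_def vzero_def)
  have zz: "vzero \<in> vecs_on I" for I :: "'x set" by (simp add: vecs_on_def supp_def vzero_def)
  have lin0: "lin_on I I' (\<lambda>_. vzero)" for I :: "nat set" and I' :: "'x set"
    by (rule lin_onI) (simp_all add: zz, simp add: lfun_def vzero_def)
  have tv: "tmap f g (vzero :: 'x \<times> nat \<Rightarrow> 'k) = vzero" for f :: "('x \<Rightarrow> 'k) \<Rightarrow> 'y \<Rightarrow> 'k" and g :: "(nat \<Rightarrow> 'k) \<Rightarrow> 'z \<Rightarrow> 'k"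
    by (auto simp: fun_eq_iff tmap_coord) (simp add: vzero_def)
  have tv': "tmap id (\<lambda>_. vzero) t = vzero" for t :: "'x \<times> nat \<Rightarrow> 'k"
    by (auto simp: fun_eq_iff tmap_coord) (simp add: vzero_def tsum_def)
  have lc3: "lcomod C {} (\<lambda>_. vzero)"
    unfolding lcomod_def e by (auto simp: lin0 tv) (auto simp: vzero_def epsL_coord fun_eq_iff tsum_def supp_def)
  have m1: "lcomod_map J (dual_coact c J) J0 (dual_coact c J0) (restr J0)"
    by (rule lcomod_map_restr[OF J c tri])
  have m2: "lcomod_map J0 (dual_coact c J0) {} (\<lambda>_. vzero) (\<lambda>_. vzero)"
    unfolding lcomod_map_def by (simp add: lin0 tv')
  have im: "restr J0 ` (vecs_on J :: (nat \<Rightarrow> 'k) set) = {n \<in> vecs_on J0. (\<lambda>_. vzero :: nat \<Rightarrow> 'k) n = vzero}"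
  proof -
    have "restr J0 n \<in> vecs_on J0" if "n \<in> vecs_on J" for n :: "nat \<Rightarrow> 'k"
      using m1 that by (simp add: lcomod_map_def lin_on_def)
    moreover have "restr J0 n = n" "n \<in> vecs_on J" if "n \<in> vecs_on J0" for n :: "nat \<Rightarrow> 'k"
      using that J by (auto simp: restr_def vecs_on_def supp_def fun_eq_iff)
    ultimately have "restr J0 ` (vecs_on J :: (nat \<Rightarrow> 'k) set) = (vecs_on J0 :: (nat \<Rightarrow> 'k) set)"
      by (metis (no_types, lifting) image_subsetI rev_image_eqI subsetI subset_antisym)
    then show ?thesis by simp
  qed
  have ex: "tmap id (restr J0) ` cotensor B \<pi> J (dual_coact c J) =
      {t \<in> cotensor B \<pi> J0 (dual_coact c J0). tmap id (\<lambda>_. vzero :: nat \<Rightarrow> 'k) t = vzero}"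
    using coflat[unfolded faithfully_coflat_def, rule_format, THEN iffD1, OF _ im] lc lc0 lc3 m1 m2 by blast
  \<comment> \<open>The given family \<open>b\<close> is packed into a single tensor; a preimage of
    it in the larger cotensor product is the extended family.\<close>
  define t0 where "t0 = (\<lambda>(x, j). if j \<in> J0 then b j x else 0)"
  have sl0: "slice j t0 = b j" if "j \<in> J0" for j using that by (simp add: slice_def t0_def)
  have "t0 \<in> vecs_on (UNIV \<times> J0)"
  proof -
    have "supp t0 \<subseteq> (\<Union>j\<in>J0. supp (b j)) \<times> J0" by (auto simp: t0_def split: if_splits)
    moreover have "finite ((\<Union>j\<in>J0. supp (b j)) \<times> J0)" using J0 b by (auto simp: vecs_iff)
    ultimately show ?thesis by (auto simp: vecs_on_def intro: finite_subset)
  qed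
  then have "t0 \<in> cotensor B \<pi> J0 (dual_coact c J0)"
    using colin by (simp add: cotensor_iff[OF J0] sl0)
  then have "t0 \<in> tmap id (restr J0) ` cotensor B \<pi> J (dual_coact c J)"
    unfolding ex by (simp add: tv')
  then obtain t where t: "t \<in> cotensor B \<pi> J (dual_coact c J)" and tt0: "tmap id (restr J0) t = t0"
    by (auto simp del: id_apply)
  have tJ: "t \<in> vecs_on (UNIV \<times> J)" using t by (simp add: cotensor_def)
  have "slice j t = b j" if j: "j \<in> J0" for j
  proof
    fix x
    have "t0 (x, j) = (\<Sum>i\<in>J. slice i t x * restr J0 (bvec i) j)"
      unfolding tt0[symmetric] tmap_coord id_apply
      by (intro tsum_slices[OF _ tJ J(1)] bilin_prod lfun_coord lfun_restr)
    also have "\<dots> = (\<Sum>i\<in>J. slice i t x * bvec i j)" using j by (simp add: restr_def)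
    finally show "slice j t x = b j x" using j J by (auto simp: sum_bvec_right t0_def)
  qed
  then show ?thesis
    using t vecs_on_vecs[OF tJ] by (intro exI[of _ "\<lambda>j. slice j t"]) (simp add: cotensor_iff[OF J(1)])
qed

section \<open>Finite-dimensional subcomodules and adapted bases\<close>

lemma plus_eq_vadd: "u + v = vadd u v"
  by (simp add: vadd_def plus_fun_def)

lemma zero_eq_vzero: "0 = vzero"
  by (simp add: vzero_def zero_fun_def)

lemma sum_fun_apply: "(\<Sum>x\<in>X. f x) i = (\<Sum>x\<in>X. f x i)" for f :: "'x \<Rightarrow> 'i \<Rightarrow> 'k::comm_monoid_add"
  by (induction X rule: infinite_finite_induct) simp_all

text \<open>The ambient space consists of all functions, with \<open>vecs\<close> as a subspace;
  this makes spans, bases and extension of independent sets available.\<close>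

interpretation vec: vector_space "vsmul :: 'k::field \<Rightarrow> ('i \<Rightarrow> 'k) \<Rightarrow> 'i \<Rightarrow> 'k"
  by unfold_locales (auto simp: vsmul_def fun_eq_iff distrib_left distrib_right)

lemma sum_vsmul: "(\<Sum>x\<in>X. vsmul (a x) (f x)) = (\<lambda>i. \<Sum>x\<in>X. a x * f x i)"
  by (simp add: fun_eq_iff sum_fun_apply vsmul_def)

lemma subspace_iff: "vec.subspace V \<longleftrightarrow> vzero \<in> V \<and> (\<forall>u\<in>V. \<forall>v\<in>V. vadd u v \<in> V) \<and> (\<forall>c. \<forall>v\<in>V. vsmul c v \<in> V)"
  by (auto simp: vec.subspace_def plus_eq_vadd zero_eq_vzero)

lemma subspace_vecs: "vec.subspace vecs"
  by (simp add: subspace_iff)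

lemma subspace_lin_vimage:
  assumes f: "lin f" and W: "vec.subspace W"
  shows "vec.subspace {v \<in> vecs. f v \<in> W}"
proof -
  have "f vzero = vzero"
  proof
    show "f vzero j = vzero j" for j
      using lfun_vzero[OF lfun_comp[OF lfun_coord[of j] f]] by (simp add: vzero_def)
  qed
  then show ?thesis using f W by (simp add: subspace_iff lin_on_def)
qed

context hopf_calculus
begin

text \<open>The slices of \<open>\<Delta> v\<close> span it: the counit recovers \<open>v\<close>
  from them, and coassociativity writes a slice of a slice as a combination of them.\<close>

lemma finite_subcomodule:
  assumes v: "v \<in> vecs"
  shows "\<exists>X. finite X \<and> X \<subseteq> vecs \<and> v \<in> vec.span X \<and> (\<forall>w\<in>vec.span X. \<forall>k. slice k (\<Delta> w) \<in> vec.span X)"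
proof -
  let ?K = "snd ` supp (\<Delta> v)"
  let ?X = "(\<lambda>k. slice k (\<Delta> v)) ` ?K"
  have K: "finite ?K" using cop_vecs[OF v] by (simp add: vecs_iff)
  have comb: "(\<lambda>x. \<Sum>k\<in>?K. a k * slice k (\<Delta> v) x) \<in> vec.span ?X" for a
    unfolding sum_vsmul[symmetric] by (intro vec.span_sum vec.span_scale vec.span_base) auto
  have slice_sum: "tsum (\<Delta> v) (\<lambda>x y. a y * x i) = (\<Sum>k\<in>?K. a (bvec k) * slice k (\<Delta> v) i)" for a i
  proof -
    have "tsum (\<Delta> v) (\<lambda>x y. a y * x i) = (\<Sum>k\<in>?K. tsum (\<Delta> v) (\<lambda>x y. y k * (a (bvec k) * x i)))"
      using cop_vecs[OF v] K by (intro tsum_expand_right) auto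
    also have "\<dots> = (\<Sum>k\<in>?K. a (bvec k) * slice k (\<Delta> v) i)"
      using lfun_slice[OF lfun_coord cop_vecs[OF v]]
      by (simp add: tsum_mult_left[symmetric] mult.left_commute)
    finally show ?thesis .
  qed
  have "v = (\<lambda>x. \<Sum>k\<in>?K. \<epsilon> (bvec k) * slice k (\<Delta> v) x)"
    using slice_sum[of \<epsilon>] counit2[OF lfun_coord v] by auto
  then have "v \<in> vec.span ?X" using comb[of "\<lambda>k. \<epsilon> (bvec k)"] by simp
  moreover have "slice k' (\<Delta> w) \<in> vec.span ?X" if w: "w \<in> vec.span ?X" for w k'
  proof -
    have "vec.span ?X \<subseteq> {w \<in> vecs. slice k' (\<Delta> w) \<in> vec.span ?X}"
    proof (rule vec.span_minimal)
      show "vec.subspace {w \<in> vecs. slice k' (\<Delta> w) \<in> vec.span ?X}"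
        by (rule subspace_lin_vimage[OF lin_comp[OF lin_slice lin_cop] vec.subspace_span])
      show "?X \<subseteq> {w \<in> vecs. slice k' (\<Delta> w) \<in> vec.span ?X}"
      proof clarsimp
        fix m k assume "\<Delta> v (m, k) \<noteq> 0"
        have "slice k' (\<Delta> (slice k (\<Delta> v))) i = (\<Sum>l\<in>?K. \<Delta> (bvec l) (k', k) * slice l (\<Delta> v) i)" for i
        proof -
          have "slice k' (\<Delta> (slice k (\<Delta> v))) i = tsum (\<Delta> v) (\<lambda>x y. y k * slice k' (\<Delta> x) i)"
            using v by (intro lfun_slice[where l = "\<lambda>u. slice k' (\<Delta> u) i"]
                lfun_comp[OF lfun_coord lin_comp[OF lin_slice lin_cop]]) simp
          also have "\<dots> = tsum (\<Delta> v) (\<lambda>x y. tsum (\<Delta> x) (\<lambda>a b. b k' * a i * y k))"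
            by (simp add: lfun_slice[OF lfun_coord] tsum_mult_left[symmetric] mult_ac cong: tsum_cong)
          also have "\<dots> = tsum (\<Delta> v) (\<lambda>x y. tsum (\<Delta> y) (\<lambda>a b. a k' * x i * b k))"
            using v by (intro coassoc) (intro multilin lfun_coord | simp)+
          also have "\<dots> = tsum (\<Delta> v) (\<lambda>x y. \<Delta> y (k', k) * x i)"
            by (simp add: tsum_coord[symmetric] tsum_mult_left[symmetric] mult_ac cong: tsum_cong)
          also have "\<dots> = (\<Sum>l\<in>?K. \<Delta> (bvec l) (k', k) * slice l (\<Delta> v) i)"
            by (rule slice_sum)
          finally show ?thesis .
        qed
        then have "slice k' (\<Delta> (slice k (\<Delta> v))) = (\<lambda>i. \<Sum>l\<in>?K. \<Delta> (bvec l) (k', k) * slice l (\<Delta> v) i)"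
          by (rule ext)
        then show "slice k (\<Delta> v) \<in> vecs \<and> slice k' (\<Delta> (slice k (\<Delta> v))) \<in> vec.span ?X"
          using comb v by simp
      qed
    qed
    then show ?thesis using w by blast
  qed
  moreover have "?X \<subseteq> vecs" using v by auto
  ultimately show ?thesis using K by (intro exI[of _ ?X]) auto
qed

text \<open>A basis of \<open>V \<inter> W\<close> is extended to a basis of a finite-dimensional
  subcomodule \<open>W\<close> containing \<open>c0\<close>. The coaction matrix becomes block
  triangular, and \<open>V\<close> meets the span only in the \<open>J0\<close> part, so extending a
  map from \<open>V\<close> creates no conflict on the overlap.\<close>

lemma adapted_basis:
  assumes V: "vec.subspace V" "V \<subseteq> vecs" and sl: "\<And>v k. v \<in> V \<Longrightarrow> slice k (\<Delta> v) \<in> V"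
    and c0: "c0 \<in> vecs"
  obtains J J0 :: "nat set" and v :: "nat \<Rightarrow> 'i \<Rightarrow> 'k" and c :: "nat \<Rightarrow> nat \<Rightarrow> 'i \<Rightarrow> 'k" and t0 :: "nat \<Rightarrow> 'k"
  where "finite J" "J0 \<subseteq> J" "\<And>j. j \<in> J \<Longrightarrow> v j \<in> vecs" "\<And>j. j \<in> J0 \<Longrightarrow> v j \<in> V"
    "c0 = (\<lambda>x. \<Sum>j\<in>J. t0 j * v j x)"
    "\<And>j x k. j \<in> J \<Longrightarrow> \<Delta> (v j) (x, k) = (\<Sum>i\<in>J. v i x * c i j k)"
    "\<And>i j. i \<in> J \<Longrightarrow> j \<in> J \<Longrightarrow> c i j \<in> vecs"
    "\<And>i j p q. i \<in> J \<Longrightarrow> j \<in> J \<Longrightarrow> \<Delta> (c i j) (p, q) = (\<Sum>k\<in>J. c i k p * c k j q)"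
    "\<And>i j. i \<in> J \<Longrightarrow> j \<in> J \<Longrightarrow> \<epsilon> (c i j) = (if i = j then 1 else 0)"
    "\<And>i j. i \<in> J - J0 \<Longrightarrow> j \<in> J0 \<Longrightarrow> c i j = vzero"
    "\<And>t j. (\<lambda>x. \<Sum>j\<in>J. t j * v j x) \<in> V \<Longrightarrow> j \<in> J - J0 \<Longrightarrow> t j = 0"
proof -
  obtain X where X: "finite X" "X \<subseteq> vecs" "c0 \<in> vec.span X"
    and slX: "\<And>w k. w \<in> vec.span X \<Longrightarrow> slice k (\<Delta> w) \<in> vec.span X"
    using finite_subcomodule[OF c0] by blast
  define W where "W = vec.span X"
  define U where "U = V \<inter> W"
  have W: "vec.subspace W" "W \<subseteq> vecs"
    unfolding W_def using vec.span_minimal[OF X(2) subspace_vecs] by auto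
  have U: "vec.subspace U" unfolding U_def by (rule vec.subspace_inter[OF V(1) W(1)])
  obtain B0 where B0: "B0 \<subseteq> U" "vec.independent B0" "U \<subseteq> vec.span B0"
    using vec.maximal_independent_subset[of U] by blast
  have "B0 \<subseteq> W" using B0(1) by (auto simp: U_def)
  then obtain B1 where B1: "B0 \<subseteq> B1" "B1 \<subseteq> W" "vec.independent B1" "W \<subseteq> vec.span B1"
    using vec.maximal_independent_subset_extend[OF _ B0(2)] by blast
  have fB1: "finite B1"
    using vec.independent_span_bound[OF X(1) B1(3)] B1(2) by (simp add: W_def)
  have sB1: "vec.span B1 = W" using B1 W(1) by (metis vec.span_subspace)
  have sB0: "vec.span B0 = U" using B0 U by (metis vec.span_subspace)
  \<comment> \<open>The basis is numbered by naturals because the carriers of \<open>lcomod\<close>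
    are sets of naturals.\<close>
  obtain g :: "_ \<Rightarrow> nat" where g: "inj_on g B1" using finite_imp_inj_to_nat_seg[OF fB1] by blast
  define J where "J = g ` B1"
  define J0 where "J0 = g ` B0"
  define v where "v = inv_into B1 g"
  have J: "finite J" "J0 \<subseteq> J" using fB1 B1(1) by (auto simp: J_def J0_def)
  have bij: "bij_betw v J B1" unfolding v_def J_def by (intro bij_betw_inv_into inj_on_imp_bij_betw g)
  have vB1: "v j \<in> B1" if "j \<in> J" for j using bij_betw_apply[OF bij that] .
  have vB0: "v j \<in> B0 \<longleftrightarrow> j \<in> J0" if "j \<in> J" for j
    using that g B1(1) by (auto simp: v_def J_def J0_def)
  have reindex: "(\<Sum>x\<in>B1. f x) = (\<Sum>j\<in>J. f (v j))" for f :: "('i \<Rightarrow> 'k) \<Rightarrow> 'k"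
    by (rule sum.reindex_bij_betw[OF bij, symmetric])
  let ?r = "vec.representation B1"
  have expand: "w = (\<lambda>x. \<Sum>j\<in>J. ?r w (v j) * v j x)" if w: "w \<in> W" for w
  proof -
    have "(\<Sum>b\<in>B1. vsmul (?r w b) b) = w"
      using w by (intro vec.sum_representation_eq B1(3) fB1) (simp_all add: sB1)
    then show ?thesis by (simp add: sum_vsmul reindex)
  qed
  have indep: "a j = a' j" if eq: "(\<lambda>x. \<Sum>j\<in>J. a j * v j x) = (\<lambda>x. \<Sum>j\<in>J. a' j * v j x)" and j: "j \<in> J" for a a' j
  proof -
    have inv: "g (v i) = i" if "i \<in> J" for i using that by (simp add: v_def J_def f_inv_into_f)
    have "(\<Sum>b\<in>B1. vsmul (a (g b) - a' (g b)) b) = 0"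
      using eq by (simp add: sum_vsmul reindex inv left_diff_distrib sum_subtractf fun_eq_iff)
    then have "a (g b) - a' (g b) = 0" if "b \<in> B1" for b
      using B1(3) fB1 that vec.independentD[OF B1(3) fB1 subset_refl, of "\<lambda>b. a (g b) - a' (g b)"] by simp
    from this[OF vB1[OF j]] show ?thesis by (simp add: inv[OF j])
  qed
  have vW: "v j \<in> W" if "j \<in> J" for j using vB1[OF that] B1(2) by blast
  have vv: "v j \<in> vecs" if "j \<in> J" for j using vW[OF that] W(2) by blast
  \<comment> \<open>Coordinates of the slices of \<open>\<Delta>(v_j)\<close> in the basis, that is
    \<open>\<Delta>(v_j) = \<Sum>i. v_i \<otimes> c_ij\<close>.\<close>
  define c where "c = (\<lambda>i j k. ?r (slice k (\<Delta> (v j))) (v i))"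
  have cop: "\<Delta> (v j) (x, k) = (\<Sum>i\<in>J. v i x * c i j k)" if j: "j \<in> J" for j x k
  proof -
    have "slice k (\<Delta> (v j)) \<in> W" using slX vW[OF j] by (simp add: W_def)
    from fun_cong[OF expand[OF this], of x] show ?thesis by (simp add: slice_def c_def mult.commute)
  qed
  have cv: "c i j \<in> vecs" if "i \<in> J" "j \<in> J" for i j
  proof -
    have "c i j k = 0" if "k \<notin> snd ` supp (\<Delta> (v j))" for k
    proof -
      have "slice k (\<Delta> (v j)) = 0" using that by (force simp: slice_def)
      then show ?thesis by (simp add: c_def vec.representation_zero)
    qed
    then have "supp (c i j) \<subseteq> snd ` supp (\<Delta> (v j))" by (meson subsetI supp_iff)
    then show ?thesis using cop_vecs[OF vv[OF \<open>j \<in> J\<close>]] by (auto simp: vecs_iff intro: finite_subset)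
  qed
  have expand_cop: "tsum (\<Delta> (v j)) F = (\<Sum>i\<in>J. F (v i) (c i j))" if F: "bilin F" and j: "j \<in> J" for F j
  proof -
    have "\<Delta> (v j) = (\<lambda>p. \<Sum>i\<in>J. 1 * tens (v i) (c i j) p)"
      using cop[OF j] by (auto simp: tens_def)
    then have "tsum (\<Delta> (v j)) F = tsum (\<lambda>p. \<Sum>i\<in>J. 1 * tens (v i) (c i j) p) F" by simp
    also have "\<dots> = (\<Sum>i\<in>J. 1 * tsum (tens (v i) (c i j)) F)"
      using J vv cv j by (intro lfun_sum lfun_tsum) auto
    also have "\<dots> = (\<Sum>i\<in>J. F (v i) (c i j))"
      using vv cv j by (intro sum.cong refl) (simp add: tsum_tens[OF F])
    finally show ?thesis .
  qed
  have ccop: "\<Delta> (c i j) (p, q) = (\<Sum>k\<in>J. c i k p * c k j q)" if i: "i \<in> J" and j: "j \<in> J" for i j p q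
  proof -
    \<comment> \<open>Both ways of iterating the coaction on \<open>v_j\<close> are expanded in the
      basis; coefficients are compared afterwards by independence.\<close>
    have "(\<Sum>l\<in>J. \<Delta> (c l j) (p, q) * v l x) = (\<Sum>l\<in>J. (\<Sum>k\<in>J. c l k p * c k j q) * v l x)" for x
    proof -
      have "(\<Sum>l\<in>J. \<Delta> (c l j) (p, q) * v l x) = tsum (\<Delta> (v j)) (\<lambda>u w. \<Delta> w (p, q) * u x)"
        by (rule expand_cop[symmetric, OF _ j])
           (intro bilinI lfun_mult_left lfun_mult_right lfun_coord lfun_comp[OF lfun_coord lin_cop])
      also have "\<dots> = tsum (\<Delta> (v j)) (\<lambda>u w. tsum (\<Delta> w) (\<lambda>a b. a p * b q * u x))"
        by (simp add: tsum_mult_right tsum_coord cong: tsum_cong)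
      also have "\<dots> = tsum (\<Delta> (v j)) (\<lambda>u w. tsum (\<Delta> u) (\<lambda>a b. b p * w q * a x))"
        using vv[OF j] by (intro coassoc[symmetric]) (intro multilin lfun_coord | simp)+
      also have "\<dots> = tsum (\<Delta> (v j)) (\<lambda>u w. \<Delta> u (x, p) * w q)"
        by (simp add: tsum_coord[symmetric] tsum_mult_left[symmetric] mult_ac cong: tsum_cong)
      also have "\<dots> = (\<Sum>k\<in>J. \<Delta> (v k) (x, p) * c k j q)"
        by (rule expand_cop[OF _ j])
           (intro bilinI lfun_mult_left lfun_mult_right lfun_coord lfun_comp[OF lfun_coord lin_cop])
      also have "\<dots> = (\<Sum>k\<in>J. \<Sum>l\<in>J. c l k p * c k j q * v l x)"
        by (intro sum.cong refl) (simp add: cop sum_distrib_left sum_distrib_right mult_ac)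
      also have "\<dots> = (\<Sum>l\<in>J. (\<Sum>k\<in>J. c l k p * c k j q) * v l x)"
        unfolding sum_distrib_right by (rule sum.swap)
      finally show ?thesis .
    qed
    then show ?thesis by (intro indep[OF ext i, of "\<lambda>l. \<Delta> (c l j) (p, q)"])
  qed
  have ceps: "\<epsilon> (c i j) = (if i = j then 1 else 0)" if i: "i \<in> J" and j: "j \<in> J" for i j
  proof -
    have "(\<Sum>l\<in>J. \<epsilon> (c l j) * v l x) = (\<Sum>l\<in>J. (if l = j then 1 else 0) * v l x)" for x
    proof -
      have "(\<Sum>l\<in>J. \<epsilon> (c l j) * v l x) = tsum (\<Delta> (v j)) (\<lambda>u w. \<epsilon> w * u x)"
        by (rule expand_cop[symmetric, OF _ j]) (intro bilinI lfun_mult_left lfun_mult_right lfun_coord lfun_eps)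
      also have "\<dots> = v j x" by (rule counit2[OF lfun_coord vv[OF j]])
      finally show ?thesis using J j by (simp add: if_distrib[of "\<lambda>y. y * _"] cong: if_cong)
    qed
    then show ?thesis by (intro indep[OF ext i, of "\<lambda>l. \<epsilon> (c l j)"])
  qed
  \<comment> \<open>The representation of an element of \<open>U\<close> in \<open>B1\<close> is
    already its representation in \<open>B0\<close>. This yields both the zero block of
    \<open>c\<close> and the last property.\<close>
  have coef0: "?r w (v i) = 0" if w: "w \<in> U" and i: "i \<in> J - J0" for w i
  proof -
    have "?r w = vec.representation B0 w"
      using w by (intro vec.representation_extend B1) (simp add: sB0)
    then show ?thesis using vec.representation_ne_zero[of B0 w "v i"] vB0[of i] i by auto
  qed
  have vU: "v j \<in> U" if "j \<in> J0" for j using vB0[of j] that J B0(1) by blast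
  show ?thesis
  proof (rule that[OF J vv _ _ cop cv ccop ceps])
    show "v j \<in> V" if "j \<in> J0" for j using vU[OF that] by (simp add: U_def)
    show "c0 = (\<lambda>x. \<Sum>j\<in>J. ?r c0 (v j) * v j x)" using X(3) by (intro expand) (simp add: W_def)
    show "c i j = vzero" if "i \<in> J - J0" "j \<in> J0" for i j
    proof
      fix k
      have "slice k (\<Delta> (v j)) \<in> U" using vU[OF that(2)] sl slX by (simp add: U_def W_def)
      from coef0[OF this that(1)] show "c i j k = vzero k" by (simp add: c_def vzero_def)
    qed
    show "t j = 0" if t: "(\<lambda>x. \<Sum>j\<in>J. t j * v j x) \<in> V" and j: "j \<in> J - J0" for t j
    proof -
      let ?w = "\<lambda>x. \<Sum>j\<in>J. t j * v j x"
      have wW: "?w \<in> W" unfolding sum_vsmul[symmetric] using W(1) vW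
        by (intro vec.subspace_sum vec.subspace_scale) auto
      have "t j = ?r ?w (v j)" using expand[OF wW] j by (intro indep[of t]) auto
      also have "\<dots> = 0" using wW t j by (intro coef0) (simp_all add: U_def)
      finally show ?thesis .
    qed
  qed
qed

end

subsection \<open>Total integrals\<close>

text \<open>Graphs of colinear maps defined on a subcomodule of \<open>C\<close> and sending \<open>1\<close> to \<open>1\<close>.\<close>

definition colinear_graph :: "('b, 'k::field) hopf \<Rightarrow> ('c, 'k) hopf \<Rightarrow> (('b \<Rightarrow> 'k) \<Rightarrow> ('c \<Rightarrow> 'k))
    \<Rightarrow> (('c \<Rightarrow> 'k) \<times> ('b \<Rightarrow> 'k)) set \<Rightarrow> bool" where
  "colinear_graph B C \<pi> G \<longleftrightarrow> G \<subseteq> vecs \<times> vecs \<and> (hone C, hone B) \<in> G \<and>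
     (\<forall>(v, b)\<in>G. \<forall>(v', b')\<in>G. (vadd v v', vadd b b') \<in> G) \<and>
     (\<forall>(v, b)\<in>G. \<forall>a. (vsmul a v, vsmul a b) \<in> G) \<and>
     (\<forall>b. (vzero, b) \<in> G \<longrightarrow> b = vzero) \<and>
     (\<forall>(v, b)\<in>G. \<forall>k. (slice k (hcomul C v), slice k (rcoact B \<pi> b)) \<in> G)"

lemma colinear_graph_add:
  "colinear_graph B C \<pi> G \<Longrightarrow> (v, b) \<in> G \<Longrightarrow> (v', b') \<in> G \<Longrightarrow> (vadd v v', vadd b b') \<in> G"
  unfolding colinear_graph_def by blast

lemma colinear_graph_smul:
  "colinear_graph B C \<pi> G \<Longrightarrow> (v, b) \<in> G \<Longrightarrow> (vsmul a v, vsmul a b) \<in> G"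
  unfolding colinear_graph_def by blast

lemma colinear_graph_unique:
  assumes G: "colinear_graph B C \<pi> G" and v: "(v, b) \<in> G" "(v, b') \<in> G"
  shows "b = b'"
proof -
  have "(vadd v (vsmul (- 1) v), vadd b (vsmul (- 1) b')) \<in> G"
    by (rule colinear_graph_add[OF G v(1) colinear_graph_smul[OF G v(2)]])
  moreover have "vadd v (vsmul (- 1) v) = vzero" by (simp add: vadd_def vsmul_def vzero_def)
  ultimately have "vadd b (vsmul (- 1) b') = vzero" using G by (simp add: colinear_graph_def)
  then show ?thesis by (simp add: vadd_def vsmul_def vzero_def fun_eq_iff)
qed

text \<open>Each closure condition involves at most two members of the graph, and two members of the
  union of a chain lie in a common element of the chain.\<close>

lemma colinear_graph_chain:
  assumes "Z \<noteq> {}" "subset.chain {G. colinear_graph B C \<pi> G} Z"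
  shows "colinear_graph B C \<pi> (\<Union>Z)"
proof -
  have Z: "colinear_graph B C \<pi> G" if "G \<in> Z" for G
    using assms(2) that by (auto simp: subset.chain_def)
  have two: "\<exists>G\<in>Z. p \<in> G \<and> q \<in> G" if "p \<in> \<Union>Z" "q \<in> \<Union>Z" for p q
    using assms(2) that unfolding subset.chain_def by blast
  show ?thesis unfolding colinear_graph_def
  proof (intro conjI)
    show "\<Union>Z \<subseteq> vecs \<times> vecs" by (rule Union_least) (use Z in \<open>simp add: colinear_graph_def\<close>)
    obtain G where "G \<in> Z" using assms(1) by blast
    then show "(hone C, hone B) \<in> \<Union>Z" by (rule UnionI) (use Z[OF \<open>G \<in> Z\<close>] in \<open>unfold colinear_graph_def, blast\<close>)
    show "\<forall>(v, b)\<in>\<Union>Z. \<forall>(v', b')\<in>\<Union>Z. (vadd v v', vadd b b') \<in> \<Union>Z"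
    proof clarify
      fix v b G v' b' G' assume "(v, b) \<in> G" "G \<in> Z" "(v', b') \<in> G'" "G' \<in> Z"
      then obtain G'' where "G'' \<in> Z" "(v, b) \<in> G''" "(v', b') \<in> G''" using two by blast
      then show "(vadd v v', vadd b b') \<in> \<Union>Z" using Z[of G''] unfolding colinear_graph_def by blast
    qed
    show "\<forall>(v, b)\<in>\<Union>Z. \<forall>a. (vsmul a v, vsmul a b) \<in> \<Union>Z"
      using Z unfolding colinear_graph_def by blast
    show "\<forall>b. (vzero, b) \<in> \<Union>Z \<longrightarrow> b = vzero"
      using Z unfolding colinear_graph_def by blast
    show "\<forall>(v, b)\<in>\<Union>Z. \<forall>k. (slice k (hcomul C v), slice k (rcoact B \<pi> b)) \<in> \<Union>Z"
      using Z unfolding colinear_graph_def by blast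
  qed
qed

lemma lin_rcoact:
  assumes "hopf_alg B" "lin \<pi>"
  shows "lin (rcoact B \<pi>)"
proof -
  interpret B: hopf_calculus "hmul B" "hone B" "hcomul B" "hcounit B" "hanti B"
    by (rule hopf_calculus_of_hopf_alg[OF assms(1)])
  show ?thesis
    unfolding rcoact_def[abs_def] by (rule lin_comp[OF lin_tmap[OF lin_id(2) assms(2)] B.lin_cop])
qed

text \<open>The starting point for Zorn: both units are grouplike, so the line through them is
  closed under slices. It is single-valued since \<open>\<epsilon>(1) = 1\<close> forces the unit of
  \<open>C\<close> to be nonzero.\<close>

lemma colinear_graph_unit:
  fixes B :: "('b, 'k::field) hopf" and C :: "('c, 'k) hopf"
  assumes B: "hopf_alg B" and C: "hopf_alg C" and pi: "hopf_map B C \<pi>"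
  shows "colinear_graph B C \<pi> (range (\<lambda>a. (vsmul a (hone C), vsmul a (hone B))))"
proof -
  interpret B: hopf_calculus "hmul B" "hone B" "hcomul B" "hcounit B" "hanti B"
    by (rule hopf_calculus_of_hopf_alg[OF B])
  interpret C: hopf_calculus "hmul C" "hone C" "hcomul C" "hcounit C" "hanti C"
    by (rule hopf_calculus_of_hopf_alg[OF C])
  have lpi: "lin \<pi>" and pi1: "\<pi> (hone B) = hone C" using pi by (auto simp: hopf_map_def)
  have dC: "hcomul C (hone C) = tens (hone C) (hone C)" and dB: "hcomul B (hone B) = tens (hone B) (hone B)"
    using B C by (simp_all add: hopf_alg_def)
  have "rcoact B \<pi> (hone B) = tens (hone B) (hone C)"
  proof
    fix p :: "'b \<times> 'c"
    obtain x z where p: "p = (x, z)" by fastforce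
    have "tsum (tens (hone B) (hone B)) (\<lambda>u w. u x * \<pi> w z) = hone B x * \<pi> (hone B) z"
      by (intro tsum_tens bilin_prod lfun_coord lfun_comp[OF lfun_coord lpi]) simp_all
    then show "rcoact B \<pi> (hone B) p = tens (hone B) (hone C) p"
      by (simp add: p rcoact_def tmap_coord dB tens_coord pi1)
  qed
  then have rB: "rcoact B \<pi> (vsmul a (hone B)) = vsmul a (tens (hone B) (hone C))" for a
    using lin_rcoact[OF B lpi] by (simp add: lin_on_def)
  have rC: "hcomul C (vsmul a (hone C)) = vsmul a (tens (hone C) (hone C))" for a
    using C.lin_cop by (simp add: lin_on_def dC)
  have sl: "slice k (vsmul a (tens u w)) = vsmul (a * w k) u" for k a u and w :: "'z \<Rightarrow> 'k"
    by (auto simp: slice_def vsmul_def tens_def)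
  have "hone C \<noteq> vzero" using C.eps_one lfun_vzero[OF C.lfun_eps] by auto
  then obtain z where z: "hone C z \<noteq> 0" by (auto simp: vzero_def)
  have 1: "vsmul 1 u = u" for u :: "'z \<Rightarrow> 'k" by (simp add: vsmul_def)
  have 2: "vadd (vsmul a u) (vsmul b u) = vsmul (a + b) u" for a b and u :: "'z \<Rightarrow> 'k"
    by (simp add: vsmul_def vadd_def distrib_right)
  have 3: "vsmul a (vsmul b u) = vsmul (a * b) u" for a b and u :: "'z \<Rightarrow> 'k"
    by (simp add: vsmul_def mult.assoc)
  show ?thesis unfolding colinear_graph_def
  proof (intro conjI)
    show "(hone C, hone B) \<in> range (\<lambda>a. (vsmul a (hone C), vsmul a (hone B)))"
      by (rule range_eqI[of _ _ 1]) (simp add: 1)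
    show "\<forall>b. (vzero, b) \<in> range (\<lambda>a. (vsmul a (hone C), vsmul a (hone B))) \<longrightarrow> b = vzero"
    proof clarify
      fix a assume "vzero = vsmul a (hone C)"
      then have "a * hone C z = 0" by (metis vsmul_def vzero_def)
      then show "vsmul a (hone B) = vzero" using z by (simp add: vsmul_def vzero_def)
    qed
  qed (auto simp: 2 3 rB rC sl)
qed

text \<open>Only a finite-dimensional subcomodule containing \<open>c0\<close> has to be adjoined to
  the domain. The part of it already covered is spanned by the \<open>J0\<close> basis vectors, so
  \<open>coflat_extend\<close> supplies values on the remaining ones.\<close>

lemma colinear_graph_extend:
  fixes B :: "('b, 'k::field) hopf" and C :: "('c, 'k) hopf"
  assumes B: "hopf_alg B" and C: "hopf_alg C" and pi: "lin \<pi>" and coflat: "faithfully_coflat B C \<pi>"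
    and G: "colinear_graph B C \<pi> G" and c0: "c0 \<in> vecs"
  shows "\<exists>G'. colinear_graph B C \<pi> G' \<and> G \<subseteq> G' \<and> c0 \<in> fst ` G'"
proof -
  interpret B: hopf_calculus "hmul B" "hone B" "hcomul B" "hcounit B" "hanti B"
    by (rule hopf_calculus_of_hopf_alg[OF B])
  interpret C: hopf_calculus "hmul C" "hone C" "hcomul C" "hcounit C" "hanti C"
    by (rule hopf_calculus_of_hopf_alg[OF C])
  have Gv: "v \<in> vecs" "b \<in> vecs" if "(v, b) \<in> G" for v b using G that by (auto simp: colinear_graph_def)
  have G1: "(hone C, hone B) \<in> G" using G by (simp add: colinear_graph_def)
  note Gadd = colinear_graph_add[OF G]
  note Gsmul = colinear_graph_smul[OF G]
  have G0: "b = vzero" if "(vzero, b) \<in> G" for b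
    using G that by (simp add: colinear_graph_def)
  have Gsl: "(slice k (hcomul C v), slice k (rcoact B \<pi> b)) \<in> G" if "(v, b) \<in> G" for v b k
    using G that unfolding colinear_graph_def by blast
  have Gzero: "(vzero, vzero) \<in> G" using Gsmul[OF G1, of 0] by (simp add: zero_eq_vzero)
  have Gsum: "((\<lambda>x. \<Sum>j\<in>X. t j * f j x), (\<lambda>x. \<Sum>j\<in>X. t j * g j x)) \<in> G"
    if "finite X" "\<And>j. j \<in> X \<Longrightarrow> (f j, g j) \<in> G" for X :: "nat set" and t f g
    using that
  proof (induction X rule: finite_induct)
    case empty
    then show ?case using Gzero by (simp add: vzero_def)
  next
    case (insert j X)
    then have "(vadd (vsmul (t j) (f j)) (\<lambda>x. \<Sum>j\<in>X. t j * f j x), vadd (vsmul (t j) (g j)) (\<lambda>x. \<Sum>j\<in>X. t j * g j x)) \<in> G"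
      by (intro Gadd Gsmul) auto
    then show ?case using insert.hyps by (simp add: vadd_def vsmul_def)
  qed
  note Gfun = colinear_graph_unique[OF G]
  define V where "V = fst ` G"
  have V: "vec.subspace V"
    unfolding subspace_iff
  proof (intro conjI ballI allI)
    show "vzero \<in> V" using Gzero unfolding V_def by force
  next
    fix u w assume "u \<in> V" "w \<in> V"
    then obtain x y where "(u, x) \<in> G" "(w, y) \<in> G" unfolding V_def by auto
    from Gadd[OF this] show "vadd u w \<in> V" unfolding V_def by (rule rev_image_eqI) simp
  next
    fix a u assume "u \<in> V"
    then obtain x where "(u, x) \<in> G" unfolding V_def by auto
    from Gsmul[OF this, of a] show "vsmul a u \<in> V" unfolding V_def by (rule rev_image_eqI) simp
  qed
  have Vv: "V \<subseteq> vecs" using Gv unfolding V_def by auto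
  have slV: "slice k (hcomul C v) \<in> V" if "v \<in> V" for v k
    using that Gsl unfolding V_def by force
  obtain J J0 :: "nat set" and v :: "nat \<Rightarrow> 'c \<Rightarrow> 'k"
    and c :: "nat \<Rightarrow> nat \<Rightarrow> 'c \<Rightarrow> 'k" and t0 :: "nat \<Rightarrow> 'k" where
    J: "finite J" "J0 \<subseteq> J" and vv: "\<And>j. j \<in> J \<Longrightarrow> v j \<in> vecs" and vV: "\<And>j. j \<in> J0 \<Longrightarrow> v j \<in> V"
    and c0_eq: "c0 = (\<lambda>x. \<Sum>j\<in>J. t0 j * v j x)"
    and vcop: "\<And>j x k. j \<in> J \<Longrightarrow> hcomul C (v j) (x, k) = (\<Sum>i\<in>J. v i x * c i j k)"
    and cv: "\<And>i j. i \<in> J \<Longrightarrow> j \<in> J \<Longrightarrow> c i j \<in> vecs"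
    and ccop: "\<And>i j p q. i \<in> J \<Longrightarrow> j \<in> J \<Longrightarrow> hcomul C (c i j) (p, q) = (\<Sum>k\<in>J. c i k p * c k j q)"
    and ceps: "\<And>i j. i \<in> J \<Longrightarrow> j \<in> J \<Longrightarrow> hcounit C (c i j) = (if i = j then 1 else 0)"
    and tri: "\<And>i j. i \<in> J - J0 \<Longrightarrow> j \<in> J0 \<Longrightarrow> c i j = vzero"
    and indep: "\<And>t j. (\<lambda>x. \<Sum>j\<in>J. t j * v j x) \<in> V \<Longrightarrow> j \<in> J - J0 \<Longrightarrow> t j = 0"
    by (rule C.adapted_basis[OF V Vv slV c0]) (assumption, rule that, assumption+)
  have J0: "finite J0" using J finite_subset by blast
  have "\<forall>j\<in>J0. \<exists>y. (v j, y) \<in> G" using vV by (fastforce simp: V_def)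
  then obtain b where b: "\<And>j. j \<in> J0 \<Longrightarrow> (v j, b j) \<in> G" using bchoice by metis
  have colin: "rcoact B \<pi> (b j) (x, k) = (\<Sum>i\<in>J0. b i x * c i j k)" if j: "j \<in> J0" for j x k
  proof -
    have "slice k (hcomul C (v j)) = (\<lambda>x. \<Sum>i\<in>J0. c i j k * v i x)"
    proof
      fix x
      have "slice k (hcomul C (v j)) x = (\<Sum>i\<in>J. v i x * c i j k)"
        using j J by (auto simp: slice_def vcop)
      also have "\<dots> = (\<Sum>i\<in>J0. v i x * c i j k)"
        using J tri[OF _ j] by (intro sum.mono_neutral_right) (auto simp: vzero_def)
      finally show "slice k (hcomul C (v j)) x = (\<Sum>i\<in>J0. c i j k * v i x)" by (simp add: mult.commute)
    qed
    then have "slice k (rcoact B \<pi> (b j)) = (\<lambda>x. \<Sum>i\<in>J0. c i j k * b i x)"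
      using Gsl[OF b[OF j], of k] Gsum[OF J0 b, where t = "\<lambda>i. c i j k"] by (intro Gfun) auto
    then show ?thesis by (auto simp: slice_def fun_eq_iff mult.commute)
  qed
  have "\<exists>b'. (\<forall>j\<in>J0. b' j = b j) \<and>
      (\<forall>j\<in>J. b' j \<in> vecs \<and> (\<forall>x z. rcoact B \<pi> (b' j) (x, z) = (\<Sum>i\<in>J. b' i x * c i j z)))"
    by (rule coflat_extend[OF B C pi coflat J]) (erule cv ccop ceps tri Gv(2)[OF b] colin; assumption)+
  then obtain b' where b': "(\<forall>j\<in>J0. b' j = b j) \<and>
      (\<forall>j\<in>J. b' j \<in> vecs \<and> (\<forall>x z. rcoact B \<pi> (b' j) (x, z) = (\<Sum>i\<in>J. b' i x * c i j z)))"
    by (rule exE)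
  then have b'b: "\<And>j. j \<in> J0 \<Longrightarrow> b' j = b j" and b'v: "\<And>j. j \<in> J \<Longrightarrow> b' j \<in> vecs"
    and b'c: "\<And>j x k. j \<in> J \<Longrightarrow> rcoact B \<pi> (b' j) (x, k) = (\<Sum>i\<in>J. b' i x * c i j k)"
    by simp_all
  define sv where "sv = (\<lambda>t x. \<Sum>j\<in>J. t j * v j x)"
  define sb where "sb = (\<lambda>t x. \<Sum>j\<in>J. t j * b' j x)"
  have svv: "sv t \<in> vecs" for t
    using sum_vecs[of J "\<lambda>j. vsmul (t j) (v j)"] vsmul_vecs[OF vv] by (simp add: sv_def vsmul_def)
  have sbv: "sb t \<in> vecs" for t
    using sum_vecs[of J "\<lambda>j. vsmul (t j) (b' j)"] vsmul_vecs[OF b'v] by (simp add: sb_def vsmul_def)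
  define G' where "G' = {(vadd w (sv t), vadd y (sb t)) | w y t. (w, y) \<in> G}"
  \<comment> \<open>Slicing acts on the coefficients \<open>t\<close> through the matrix
    \<open>c\<close>, by the same formula for \<open>sv\<close> and \<open>sb\<close>; this makes
    the adjoined pairs closed under slicing.\<close>
  have slsv: "slice k (hcomul C (sv t)) = sv (\<lambda>i. \<Sum>j\<in>J. t j * c i j k)" for k t
  proof
    fix x
    have "slice k (hcomul C (sv t)) x = (\<Sum>j\<in>J. t j * slice k (hcomul C (v j)) x)"
      unfolding sv_def by (rule lfun_sum[OF lfun_comp[OF lfun_coord lin_comp[OF lin_slice C.lin_cop]] J(1) vv])
    also have "\<dots> = (\<Sum>j\<in>J. \<Sum>i\<in>J. t j * c i j k * v i x)"
      by (intro sum.cong refl) (simp add: slice_def vcop sum_distrib_left mult_ac)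
    also have "\<dots> = sv (\<lambda>i. \<Sum>j\<in>J. t j * c i j k) x"
      unfolding sv_def sum_distrib_right by (rule sum.swap)
    finally show "slice k (hcomul C (sv t)) x = \<dots>" .
  qed
  have slsb: "slice k (rcoact B \<pi> (sb t)) = sb (\<lambda>i. \<Sum>j\<in>J. t j * c i j k)" for k t
  proof
    fix x
    have "slice k (rcoact B \<pi> (sb t)) x = (\<Sum>j\<in>J. t j * slice k (rcoact B \<pi> (b' j)) x)"
      unfolding sb_def
      by (rule lfun_sum[OF lfun_comp[OF lfun_coord lin_comp[OF lin_slice lin_rcoact[OF B pi]]] J(1) b'v])
    also have "\<dots> = (\<Sum>j\<in>J. \<Sum>i\<in>J. t j * c i j k * b' i x)"
      by (intro sum.cong refl) (simp add: slice_def b'c sum_distrib_left mult_ac)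
    also have "\<dots> = sb (\<lambda>i. \<Sum>j\<in>J. t j * c i j k) x"
      unfolding sb_def sum_distrib_right by (rule sum.swap)
    finally show "slice k (rcoact B \<pi> (sb t)) x = \<dots>" .
  qed
  have add: "f (vadd x y) = vadd (f x) (f y)" if "lin f" "x \<in> vecs" "y \<in> vecs" for f :: "('x \<Rightarrow> 'k) \<Rightarrow> 'y \<Rightarrow> 'k" and x y
    using that by (simp add: lin_on_def)
  have GG': "G \<subseteq> G'"
  proof
    fix p assume p: "p \<in> G"
    have "sv (\<lambda>_. 0) = vzero" "sb (\<lambda>_. 0) = vzero" by (simp_all add: sv_def sb_def vzero_def)
    then have "p = (vadd (fst p) (sv (\<lambda>_. 0)), vadd (snd p) (sb (\<lambda>_. 0)))"
      by (simp add: vadd_def vzero_def)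
    then show "p \<in> G'" using p unfolding G'_def by (metis (mono_tags, lifting) mem_Collect_eq prod.collapse)
  qed
  have "colinear_graph B C \<pi> G'"
    unfolding colinear_graph_def
  proof (intro conjI)
    show "G' \<subseteq> vecs \<times> vecs" using Gv svv sbv by (auto simp: G'_def)
    show "(hone C, hone B) \<in> G'" using G1 GG' by blast
    show "\<forall>(v, b)\<in>G'. \<forall>(v', b')\<in>G'. (vadd v v', vadd b b') \<in> G'"
    proof clarify
      fix p q p' q' assume "(p, q) \<in> G'" "(p', q') \<in> G'"
      then obtain w y t w' y' t' where e: "p = vadd w (sv t)" "q = vadd y (sb t)" "(w, y) \<in> G"
        "p' = vadd w' (sv t')" "q' = vadd y' (sb t')" "(w', y') \<in> G" unfolding G'_def by blast
      have "vadd p p' = vadd (vadd w w') (sv (\<lambda>j. t j + t' j))" "vadd q q' = vadd (vadd y y') (sb (\<lambda>j. t j + t' j))"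
        by (simp_all add: e vadd_def sv_def sb_def distrib_right sum.distrib add_ac)
      then show "(vadd p p', vadd q q') \<in> G'" using Gadd[OF e(3,6)] unfolding G'_def by blast
    qed
    show "\<forall>(v, b)\<in>G'. \<forall>a. (vsmul a v, vsmul a b) \<in> G'"
    proof clarify
      fix p q a assume "(p, q) \<in> G'"
      then obtain w y t where e: "p = vadd w (sv t)" "q = vadd y (sb t)" "(w, y) \<in> G" unfolding G'_def by blast
      have "vsmul a p = vadd (vsmul a w) (sv (\<lambda>j. a * t j))" "vsmul a q = vadd (vsmul a y) (sb (\<lambda>j. a * t j))"
        by (simp_all add: e vadd_def vsmul_def sv_def sb_def distrib_left sum_distrib_left mult.assoc)
      then show "(vsmul a p, vsmul a q) \<in> G'" using Gsmul[OF e(3)] unfolding G'_def by blast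
    qed
    show "\<forall>b. (vzero, b) \<in> G' \<longrightarrow> b = vzero"
    proof clarify
      fix q assume "(vzero, q) \<in> G'"
      then obtain w y t where e: "vzero = vadd w (sv t)" "q = vadd y (sb t)" "(w, y) \<in> G" unfolding G'_def by blast
      \<comment> \<open>An adjoined vector that falls into the old domain has coefficients only on
        \<open>J0\<close>, where \<open>b'\<close> agrees with \<open>b\<close>; the pair therefore
        already belongs to \<open>G\<close>.\<close>
      have "sv t = vsmul (- 1) w" using e(1) by (simp add: vadd_def vsmul_def vzero_def fun_eq_iff eq_neg_iff_add_eq_0 add.commute)
      then have "sv t \<in> V" using Gsmul[OF e(3), of "- 1"] unfolding V_def by force
      then have t: "t j = 0" if "j \<in> J - J0" for j using indep[OF _ that] by (simp add: sv_def)
      have "(sv t, sb t) = ((\<lambda>x. \<Sum>j\<in>J0. t j * v j x), (\<lambda>x. \<Sum>j\<in>J0. t j * b j x))"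
        using J t b'b by (auto simp: sv_def sb_def fun_eq_iff intro!: sum.mono_neutral_cong_right)
      then have "(sv t, sb t) \<in> G" using Gsum[OF J0 b] by simp
      then have "(vzero, q) \<in> G" using Gadd[OF e(3)] e by metis
      then show "q = vzero" by (rule G0)
    qed
    show "\<forall>(v, b)\<in>G'. \<forall>k. (slice k (hcomul C v), slice k (rcoact B \<pi> b)) \<in> G'"
    proof clarify
      fix p q k assume "(p, q) \<in> G'"
      then obtain w y t where e: "p = vadd w (sv t)" "q = vadd y (sb t)" "(w, y) \<in> G" unfolding G'_def by blast
      have "slice k (hcomul C p) = vadd (slice k (hcomul C w)) (slice k (hcomul C (sv t)))"
        unfolding e by (rule add[OF lin_comp[OF lin_slice C.lin_cop] Gv(1)[OF e(3)] svv])
      moreover have "slice k (rcoact B \<pi> q) = vadd (slice k (rcoact B \<pi> y)) (slice k (rcoact B \<pi> (sb t)))"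
        unfolding e by (rule add[OF lin_comp[OF lin_slice lin_rcoact[OF B pi]] Gv(2)[OF e(3)] sbv])
      ultimately show "(slice k (hcomul C p), slice k (rcoact B \<pi> q)) \<in> G'"
        using Gsl[OF e(3), of k] unfolding slsv slsb G'_def by blast
    qed
  qed
  moreover have "c0 \<in> fst ` G'"
  proof -
    have "c0 = vadd vzero (sv t0)" by (simp add: c0_eq sv_def vadd_def vzero_def)
    moreover have "(vadd vzero (sv t0), vadd vzero (sb t0)) \<in> G'" unfolding G'_def using Gzero by blast
    ultimately show ?thesis by (metis fst_conv image_eqI)
  qed
  ultimately show ?thesis using GG' by blast
qed

text \<open>A maximal graph must have full domain, since any missing vector could be adjoined; it is
  then the graph of a function.\<close>

lemma total_integral:
  fixes B :: "('b, 'k::field) hopf" and C :: "('c, 'k) hopf"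
  assumes B: "hopf_alg B" and C: "hopf_alg C" and pi: "hopf_map B C \<pi>" and coflat: "faithfully_coflat B C \<pi>"
  shows "\<exists>\<phi>. lin \<phi> \<and> \<phi> (hone C) = hone B \<and> (\<forall>v\<in>vecs. tmap \<phi> id (hcomul C v) = rcoact B \<pi> (\<phi> v))"
proof -
  interpret C: hopf_calculus "hmul C" "hone C" "hcomul C" "hcounit C" "hanti C"
    by (rule hopf_calculus_of_hopf_alg[OF C])
  have lpi: "lin \<pi>" using pi by (simp add: hopf_map_def)
  obtain G where G: "colinear_graph B C \<pi> G" and max: "\<And>G'. colinear_graph B C \<pi> G' \<Longrightarrow> G \<subseteq> G' \<Longrightarrow> G' = G"
    using subset_Zorn_nonempty[of "{G. colinear_graph B C \<pi> G}"] colinear_graph_unit[OF B C pi]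
      colinear_graph_chain by (smt (verit) empty_iff mem_Collect_eq)
  have total: "\<exists>b. (v, b) \<in> G" if "v \<in> vecs" for v
    using colinear_graph_extend[OF B C lpi coflat G that] max by force
  define \<phi> where "\<phi> = (\<lambda>v. SOME b. (v, b) \<in> G)"
  have phi: "(v, \<phi> v) \<in> G" if "v \<in> vecs" for v unfolding \<phi>_def by (rule someI_ex[OF total[OF that]])
  note Gadd = colinear_graph_add[OF G]
  note Gsmul = colinear_graph_smul[OF G]
  note Gfun = colinear_graph_unique[OF G]
  have lin: "lin \<phi>"
    unfolding lin_on_def
  proof (intro conjI ballI allI)
    show "\<phi> v \<in> vecs" if "v \<in> vecs" for v using phi[OF that] G by (auto simp: colinear_graph_def)
    show "\<phi> (vadd u v) = vadd (\<phi> u) (\<phi> v)" if "u \<in> vecs" "v \<in> vecs" for u v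
      using phi[OF vadd_vecs[OF that]] Gadd[OF phi[OF that(1)] phi[OF that(2)]] by (rule Gfun)
    show "\<phi> (vsmul a v) = vsmul a (\<phi> v)" if "v \<in> vecs" for a v
      using phi[OF vsmul_vecs[OF that]] Gsmul[OF phi[OF that]] by (rule Gfun)
  qed
  moreover have "\<phi> (hone C) = hone B"
    using phi[OF C.one_vecs] G unfolding colinear_graph_def by (intro Gfun) blast+
  moreover have "tmap \<phi> id (hcomul C v) = rcoact B \<pi> (\<phi> v)" if v: "v \<in> vecs" for v
  proof
    fix p :: "'b \<times> 'c"
    obtain x k where p: "p = (x, k)" by fastforce
    \<comment> \<open>The graph holds slices of \<open>v\<close> and of its image as a pair;
      single-valuedness turns this into colinearity in each coordinate \<open>k\<close>.\<close>
    have "(slice k (hcomul C v), slice k (rcoact B \<pi> (\<phi> v))) \<in> G"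
      using G phi[OF v] unfolding colinear_graph_def by blast
    then have "slice k (rcoact B \<pi> (\<phi> v)) = \<phi> (slice k (hcomul C v))"
      using phi[OF slice_vecs[OF C.cop_vecs[OF v]]] by (rule Gfun)
    then have "rcoact B \<pi> (\<phi> v) (x, k) = \<phi> (slice k (hcomul C v)) x" by (metis slice_def)
    also have "\<dots> = tsum (hcomul C v) (\<lambda>u y. y k * \<phi> u x)"
      by (rule lfun_slice[OF lfun_comp[OF lfun_coord lin] C.cop_vecs[OF v]])
    finally show "tmap \<phi> id (hcomul C v) p = rcoact B \<pi> (\<phi> v) p"
      by (simp add: p tmap_coord mult.commute)
  qed
  ultimately show ?thesis by blast
qed

subsection \<open>Exact sequences\<close>

lemma independent_bvec: "vec.independent (range (bvec :: 'i \<Rightarrow> 'i \<Rightarrow> 'k::field))"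
  unfolding vec.independent_explicit_finite_subsets
proof (intro allI impI ballI)
  fix X :: "('i \<Rightarrow> 'k) set" and u and v
  assume X: "X \<subseteq> range bvec" "finite X" and 0: "(\<Sum>v\<in>X. vsmul (u v) v) = 0" and v: "v \<in> X"
  obtain i where i: "v = bvec i" using X v by blast
  have "(\<Sum>w\<in>X. u w * w i) = 0" using 0 by (simp add: sum_vsmul fun_eq_iff)
  also have "(\<Sum>w\<in>X. u w * w i) = (\<Sum>w\<in>X. if w = v then u v else 0)"
  proof (rule sum.cong[OF refl])
    fix w assume "w \<in> X"
    then obtain j where "w = bvec j" using X by blast
    moreover have "bvec j = (bvec i :: 'i \<Rightarrow> 'k) \<longleftrightarrow> j = i" by (metis bvec_apply zero_neq_one)
    ultimately show "u w * w i = (if w = v then u v else 0)" by (auto simp: i bvec_apply)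
  qed
  finally show "u v = 0" using X v by simp
qed

text \<open>The behaviour of \<open>f\<close> outside \<open>vecs\<close> is unspecified, so it is
  replaced by a globally linear \<open>g\<close> with the same values on basis vectors, to which the
  existence of linear left inverses applies.\<close>

lemma lin_retraction:
  fixes f :: "('i \<Rightarrow> 'k::field) \<Rightarrow> 'j \<Rightarrow> 'k"
  assumes f: "lin f" and inj: "inj_on f vecs"
  shows "\<exists>r. lin r \<and> (\<forall>v\<in>vecs. r (f v) = v)"
proof -
  interpret vp: vector_space_pair "vsmul :: 'k \<Rightarrow> ('i \<Rightarrow> 'k) \<Rightarrow> 'i \<Rightarrow> 'k" "vsmul :: 'k \<Rightarrow> ('j \<Rightarrow> 'k) \<Rightarrow> 'j \<Rightarrow> 'k" ..
  interpret vq: vector_space_pair "vsmul :: 'k \<Rightarrow> ('j \<Rightarrow> 'k) \<Rightarrow> 'j \<Rightarrow> 'k" "vsmul :: 'k \<Rightarrow> ('i \<Rightarrow> 'k) \<Rightarrow> 'i \<Rightarrow> 'k" ..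
  obtain g where g: "\<And>i. g (bvec i) = f (bvec i)" "Vector_Spaces.linear vsmul vsmul g"
    using vp.linear_independent_extend[OF independent_bvec, of f] by auto
  interpret g: Vector_Spaces.linear vsmul vsmul g by (rule g(2))
  have gf: "g v = f v" if v: "v \<in> vecs" for v
  proof
    fix j
    show "g v j = f v j"
    proof (rule lfun_eqI[OF _ lfun_comp[OF lfun_coord f] _ v])
      show "lfun (\<lambda>v. g v j)"
        using g.add g.scale by (simp add: lfun_def plus_eq_vadd) (simp add: vadd_def vsmul_def)
    qed (simp add: g)
  qed
  then have "inj_on g vecs" using inj by (simp add: inj_on_def)
  then obtain r where r: "r ` UNIV \<subseteq> vecs" "Vector_Spaces.linear vsmul vsmul r" "\<And>v. v \<in> vecs \<Longrightarrow> r (g v) = v"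
    using vp.linear_exists_left_inverse_on[OF g(2) subspace_vecs] by blast
  interpret r: Vector_Spaces.linear vsmul vsmul r by (rule r(2))
  have "lin r" using r(1) r.add r.scale by (auto simp: lin_on_def plus_eq_vadd)
  then show ?thesis using r(3) gf by (intro exI[of _ r]) simp
qed

section \<open>Integrals on subalgebras, quotients and extensions\<close>

lemma hopf_map_tsum_cop:
  assumes A: "hopf_alg A" and f: "hopf_map A B f" and F: "bilin F" and v: "v \<in> vecs"
  shows "tsum (hcomul B (f v)) F = tsum (hcomul A v) (\<lambda>x y. F (f x) (f y))"
proof -
  interpret A: hopf_calculus "hmul A" "hone A" "hcomul A" "hcounit A" "hanti A"
    by (rule hopf_calculus_of_hopf_alg[OF A])
  show ?thesis using f v F A.cop_vecs[OF v] by (simp add: hopf_map_def tsum_tmap)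
qed

text \<open>Instance of \<open>integral_transfer\<close> with \<open>\<phi> = \<iota>\<close> and a
  linear retraction as \<open>\<theta>\<close>: since \<open>\<iota>\<close> respects coproducts,
  the retraction only has to undo it on the free leg.\<close>

lemma cofrob_subalgebra:
  assumes A: "hopf_alg A" and B: "hopf_alg B" and \<iota>: "hopf_map A B \<iota>" and inj: "inj_on \<iota> vecs" and "cofrob B"
  shows "cofrob A"
proof -
  interpret A: hopf_calculus "hmul A" "hone A" "hcomul A" "hcounit A" "hanti A"
    by (rule hopf_calculus_of_hopf_alg[OF A])
  interpret B: hopf_calculus "hmul B" "hone B" "hcomul B" "hcounit B" "hanti B"
    by (rule hopf_calculus_of_hopf_alg[OF B])
  have li: "lin \<iota>" and i1: "\<iota> (hone A) = hone B" using \<iota> by (auto simp: hopf_map_def)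
  obtain r where r: "lin r" "\<And>v. v \<in> vecs \<Longrightarrow> r (\<iota> v) = v" using lin_retraction[OF li inj] by blast
  obtain l v where l: "B.is_integral l" "v \<in> vecs" "l v \<noteq> 0"
    using \<open>cofrob B\<close> cofrob_iff_integral[OF B] by blast
  have colin: "tsum (hcomul A d) (\<lambda>x y. F x (\<iota> y)) = tsum (hcomul B (\<iota> d)) (\<lambda>x y. F (r x) y)"
    if F: "bilin F" and d: "d \<in> vecs" for F d
  proof -
    have "bilin (\<lambda>x y. F (r x) y)"
      using bilin_comp1[OF F r(1)] F lin_vecs[OF r(1)] by (simp add: bilin_def)
    from hopf_map_tsum_cop[OF A \<iota> this d] show ?thesis by (simp add: r(2) cong: tsum_cong)
  qed
  obtain l' z where "A.is_integral l'" "z \<in> vecs" "l' (hanti A z) \<noteq> 0"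
    using B.integral_transfer[OF A.hopf_calculus_axioms li r(1) colin i1 l] by blast
  then show ?thesis using cofrob_iff_integral[OF A] A.S_vecs by blast
qed

text \<open>The transfer takes place between the reversed algebras with
  \<open>\<theta> = \<pi>\<close>: after flipping, right colinearity of \<open>\<phi>\<close> leaves
  the second leg in \<open>B\<close>, as the transfer demands.\<close>

lemma cofrob_quotient:
  fixes B :: "('b, 'k::field) hopf" and C :: "('c, 'k) hopf"
  assumes B: "hopf_alg B" and C: "hopf_alg C" and pi: "hopf_map B C \<pi>" and coflat: "faithfully_coflat B C \<pi>"
    and "cofrob B"
  shows "cofrob C"
proof -
  interpret B: hopf_calculus "hmul B" "hone B" "hcomul B" "hcounit B" "hanti B"
    by (rule hopf_calculus_of_hopf_alg[OF B])
  interpret C: hopf_calculus "hmul C" "hone C" "hcomul C" "hcounit C" "hanti C"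
    by (rule hopf_calculus_of_hopf_alg[OF C])
  have lpi: "lin \<pi>" using pi by (simp add: hopf_map_def)
  obtain \<phi> where phi: "lin \<phi>" "\<phi> (hone C) = hone B"
    and phic: "\<And>v. v \<in> vecs \<Longrightarrow> tmap \<phi> id (hcomul C v) = tmap id \<pi> (hcomul B (\<phi> v))"
    using total_integral[OF B C pi coflat] by (auto simp: rcoact_def)
  obtain l v where "B.is_integral l" "v \<in> vecs" "l v \<noteq> 0"
    using \<open>cofrob B\<close> cofrob_iff_integral[OF B] by blast
  then obtain l v where l: "hopf_calculus.is_integral (hone B) (\<lambda>v. flip (hcomul B v)) l" "v \<in> vecs" "l v \<noteq> 0"
    using B.integral_imp_left_integral[of l v] unfolding B.integral_opcop_iff by blast
  have colin: "tsum (flip (hcomul C d)) (\<lambda>x y. F x (\<phi> y)) = tsum (flip (hcomul B (\<phi> d))) (\<lambda>x y. F (\<pi> x) y)"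
    if F: "bilin F" and d: "d \<in> vecs" for F d
  proof -
    have F': "bilin (\<lambda>x y. F y x)" using F by (simp add: bilin_def)
    have "tsum (hcomul C d) (\<lambda>x y. F y (\<phi> x)) = tsum (tmap \<phi> id (hcomul C d)) (\<lambda>x y. F y x)"
      using d by (simp add: tsum_tmap[OF F' phi(1)])
    also have "\<dots> = tsum (hcomul B (\<phi> d)) (\<lambda>x y. F (\<pi> y) x)"
      using d lin_vecs[OF phi(1) d] by (simp add: phic tsum_tmap[OF F' _ lpi])
    finally show ?thesis by (simp add: tsum_flip)
  qed
  obtain l' z where "hopf_calculus.is_integral (hone C) (\<lambda>v. flip (hcomul C v)) l'" "z \<in> vecs" "l' (hanti C z) \<noteq> 0"
    using hopf_calculus.integral_transfer[OF B.opcop C.opcop phi(1) lpi colin phi(2) l] by blast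
  \<comment> \<open>A second change of side, now inside the reversed \<open>C\<close>, brings the
    functional back to the original convention.\<close>
  then obtain l'' where l'': "lfun l''" "\<exists>v\<in>vecs. l'' v \<noteq> 0"
    "\<forall>h\<in>vecs. \<forall>G. lfun G \<longrightarrow> tsum (flip (hcomul C h)) (\<lambda>x y. l'' x * G y) = l'' h * G (hone C)"
    using hopf_calculus.integral_imp_left_integral[OF C.opcop, of l' "hanti C z"] C.S_vecs by blast
  then have "C.is_integral l''" by (simp add: C.is_integral_def tsum_flip mult.commute)
  then show ?thesis using cofrob_iff_integral[OF C] l''(2) by blast
qed

lemma cofrob_extension:
  fixes A :: "('a, 'k::field) hopf" and B :: "('b, 'k) hopf" and C :: "('c, 'k) hopf"
  assumes A: "hopf_alg A" and B: "hopf_alg B" and C: "hopf_alg C"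
    and \<iota>: "hopf_map A B \<iota>" and pi: "hopf_map B C \<pi>" and exact: "exact_seq A B C \<iota> \<pi>"
    and coflat: "faithfully_coflat B C \<pi>" and "cofrob A" and "cofrob C"
  shows "cofrob B"
proof -
  interpret A: hopf_calculus "hmul A" "hone A" "hcomul A" "hcounit A" "hanti A"
    by (rule hopf_calculus_of_hopf_alg[OF A])
  interpret B: hopf_calculus "hmul B" "hone B" "hcomul B" "hcounit B" "hanti B"
    by (rule hopf_calculus_of_hopf_alg[OF B])
  interpret C: hopf_calculus "hmul C" "hone C" "hcomul C" "hcounit C" "hanti C"
    by (rule hopf_calculus_of_hopf_alg[OF C])
  have li: "lin \<iota>" and i1: "\<iota> (hone A) = hone B" using \<iota> by (auto simp: hopf_map_def)
  have lpi: "lin \<pi>" and pimul: "\<And>u v. u \<in> vecs \<Longrightarrow> v \<in> vecs \<Longrightarrow> \<pi> (hmul B u v) = hmul C (\<pi> u) (\<pi> v)"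
    using pi by (auto simp: hopf_map_def)
  have [simp]: "\<iota> v \<in> vecs" if "v \<in> vecs" for v by (rule lin_vecs[OF li that])
  have [simp]: "\<pi> v \<in> vecs" if "v \<in> vecs" for v by (rule lin_vecs[OF lpi that])
  have inj: "inj_on \<iota> vecs" and coinv: "{b\<in>vecs. tmap id \<pi> (hcomul B b) = tens b (hone C)} = \<iota> ` vecs"
    using exact by (auto simp: exact_seq_def)
  obtain r where r: "lin r" "\<And>v. v \<in> vecs \<Longrightarrow> r (\<iota> v) = v" using lin_retraction[OF li inj] by blast
  obtain \<phi> where phi: "lin \<phi>" "\<phi> (hone C) = hone B"
    and phic: "\<And>v. v \<in> vecs \<Longrightarrow> tmap \<phi> id (hcomul C v) = tmap id \<pi> (hcomul B (\<phi> v))"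
    using total_integral[OF B C pi coflat] by (auto simp: rcoact_def)
  have [simp]: "\<phi> v \<in> vecs" if "v \<in> vecs" for v by (rule lin_vecs[OF phi(1) that])
  obtain lA a where lA: "A.is_integral lA" and a: "a \<in> vecs" "lA a \<noteq> 0"
    using \<open>cofrob A\<close> cofrob_iff_integral[OF A] by blast
  obtain lC c where lC: "C.is_integral lC" and c: "c \<in> vecs" "lC c \<noteq> 0"
    using \<open>cofrob C\<close> cofrob_iff_integral[OF C] by blast
  note lCpi = lfun_comp[OF C.is_integral_lfun[OF lC] lpi]
  note lAr = lfun_comp[OF A.is_integral_lfun[OF lA] r(1)]
  note ml = multilin lfun_coord lCpi lAr
  define E where "E = (\<lambda>b. vtsum (hcomul B b) (\<lambda>x y. vsmul (lC (\<pi> y)) x))"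
  have lE: "lin E" unfolding E_def by (rule lin_comp[OF lin_vtsum B.lin_cop]) simp
  have [simp]: "E b \<in> vecs" if "b \<in> vecs" for b by (rule lin_vecs[OF lE that])
  have E: "G (E b) = tsum (hcomul B b) (\<lambda>x y. lC (\<pi> y) * G x)" if "lfun G" "b \<in> vecs" for G b
    unfolding E_def using that by (simp add: lfun_vtsum lfun_vsmul cong: tsum_cong)
  \<comment> \<open>This is \<open>\<Delta>(E b) = b1 \<otimes> E(b2)\<close>, the left colinearity
    of \<open>E\<close>.\<close>
  have E_cop: "tsum (hcomul B (E b)) F = tsum (hcomul B b) (\<lambda>x y. tsum (hcomul B y) (\<lambda>z w. lC (\<pi> w) * F x z))"
    if F: "bilin F" and b: "b \<in> vecs" for F b
  proof -
    have "tsum (hcomul B (E b)) F = tsum (hcomul B b) (\<lambda>x y. lC (\<pi> y) * tsum (hcomul B x) F)"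
      by (rule E[OF lfun_tsum_arg[OF B.lin_cop] b])
    also have "\<dots> = tsum (hcomul B b) (\<lambda>x y. tsum (hcomul B x) (\<lambda>z w. lC (\<pi> y) * F z w))"
      by (simp add: tsum_mult_left)
    also have "\<dots> = tsum (hcomul B b) (\<lambda>x y. tsum (hcomul B y) (\<lambda>z w. lC (\<pi> w) * F x z))"
      using b by (intro B.coassoc) (intro ml bilin_comp[OF F] | simp)+
    finally show ?thesis .
  qed
  \<comment> \<open>Applying \<pi> to the second leg of \<open>\<Delta>(E b)\<close> gives
    \<open>b1 \<otimes> \<pi>(b2)\<close> weighted by the integral of \<open>\<pi>(b3)\<close>;
    invariance on \<open>C\<close> turns the second factor into \<open>1\<close>.\<close>
  have E_coinv: "E b \<in> \<iota> ` vecs" if b: "b \<in> vecs" for b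
  proof -
    have "tmap id \<pi> (hcomul B (E b)) = tens (E b) (hone C)"
    proof
      fix p :: "'b \<times> 'c"
      obtain i k where p: "p = (i, k)" by fastforce
      have "tmap id \<pi> (hcomul B (E b)) (i, k) = tsum (hcomul B (E b)) (\<lambda>x y. x i * \<pi> y k)"
        by (simp add: tmap_coord)
      also have "\<dots> = tsum (hcomul B b) (\<lambda>x y. tsum (hcomul B y) (\<lambda>z w. lC (\<pi> w) * (x i * \<pi> z k)))"
        by (rule E_cop[OF bilin_prod[OF lfun_coord lfun_comp[OF lfun_coord lpi]] b])
      also have "\<dots> = tsum (hcomul B b) (\<lambda>x y. tsum (hcomul C (\<pi> y)) (\<lambda>z w. z k * lC w) * x i)"
        by (simp add: hopf_map_tsum_cop[OF B pi bilin_prod[OF lfun_coord C.is_integral_lfun[OF lC]]]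
            cong: tsum_cong) (simp add: tsum_mult_left[symmetric] mult_ac)
      also have "\<dots> = tsum (hcomul B b) (\<lambda>x y. lC (\<pi> y) * x i * hone C k)"
        by (simp add: C.is_integral_eq[OF lC lfun_coord] mult_ac cong: tsum_cong)
      also have "\<dots> = tens (E b) (hone C) (i, k)"
        using E[OF lfun_coord b] by (simp add: tsum_mult_right tens_coord)
      finally show "tmap id \<pi> (hcomul B (E b)) p = tens (E b) (hone C) p" by (simp add: p)
    qed
    then show ?thesis using b coinv by auto
  qed
  have "B.is_integral (\<lambda>b. lA (r (E b)))"
    unfolding B.is_integral_def
  proof (intro conjI ballI allI impI)
    show "lfun (\<lambda>b. lA (r (E b)))" by (rule lfun_comp[OF lAr lE])
  next
    fix h :: "'b \<Rightarrow> 'k" and G :: "('b \<Rightarrow> 'k) \<Rightarrow> 'k"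
    assume h: "h \<in> vecs" and G: "lfun G"
    \<comment> \<open>By \<open>E_cop\<close> the free leg of \<open>h\<close> is the first leg of
      \<open>E h\<close>, which comes from \<open>A\<close>, where the invariance of
      \<open>lA\<close> is available.\<close>
    obtain a where a: "a \<in> vecs" "E h = \<iota> a" using E_coinv[OF h] by blast
    have F: "bilin (\<lambda>x z. G x * lA (r z))" by (rule bilin_prod[OF G lAr])
    have "tsum (hcomul B h) (\<lambda>x y. G x * lA (r (E y)))
        = tsum (hcomul B h) (\<lambda>x y. tsum (hcomul B y) (\<lambda>z w. lC (\<pi> w) * (G x * lA (r z))))"
      by (simp add: E[OF lAr] tsum_mult_left[symmetric] mult_ac cong: tsum_cong)
    also have "\<dots> = tsum (hcomul B (\<iota> a)) (\<lambda>x z. G x * lA (r z))"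
      using E_cop[OF F h] by (simp add: a)
    also have "\<dots> = tsum (hcomul A a) (\<lambda>x z. G (\<iota> x) * lA z)"
      by (simp add: hopf_map_tsum_cop[OF A \<iota> F a(1)] r(2) cong: tsum_cong)
    also have "\<dots> = lA a * G (\<iota> (hone A))"
      by (rule A.is_integral_eq[OF lA lfun_comp[OF G li] a(1)])
    finally show "tsum (hcomul B h) (\<lambda>x y. G x * lA (r (E y))) = lA (r (E h)) * G (hone B)"
      by (simp add: a i1 r(2))
  qed
  \<comment> \<open>The test vector exploits two facts: \<open>E\<close> commutes with right
    multiplication by the coinvariant \<open>\<iota> a\<close>, and colinearity of
    \<open>\<phi>\<close> together with invariance of \<open>lC\<close> gives
    \<open>E(\<phi> c) = lC(c) \<phi>(1)\<close>, where \<open>\<phi>(1) = 1\<close>.\<close>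
  moreover have "lA (r (E (hmul B (\<phi> c) (\<iota> a)))) = lC c * lA a"
  proof -
    let ?G = "\<lambda>x. lA (r (hmul B x (\<iota> a)))"
    have G: "lfun ?G" by (rule lfun_comp[OF lAr B.lin_mulL]) (simp add: a)
    have "lA (r (E (hmul B (\<phi> c) (\<iota> a)))) = tsum (hcomul B (hmul B (\<phi> c) (\<iota> a))) (\<lambda>x y. lC (\<pi> y) * lA (r x))"
      using a c by (intro E[OF lAr]) simp
    also have "\<dots> = tsum (hcomul B (\<phi> c)) (\<lambda>x y. tsum (hcomul B (\<iota> a)) (\<lambda>p q. lC (\<pi> (hmul B y q)) * lA (r (hmul B x p))))"
      using a c by (intro B.cop_mul) (intro ml | simp)+
    also have "\<dots> = tsum (hcomul B (\<phi> c)) (\<lambda>x y. lC (\<pi> y) * ?G x)"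
    proof (rule tsum_cong)
      fix x y :: "'b \<Rightarrow> 'k" assume v: "x \<in> vecs" "y \<in> vecs"
      have F: "bilin (\<lambda>p q. lC (hmul C (\<pi> y) q) * lA (r (hmul B x p)))"
        using v by (intro bilinI lfun_mult_left lfun_mult_right
            lfun_comp[OF C.is_integral_lfun[OF lC] C.lin_mulR] lfun_comp[OF lAr B.lin_mulR]) simp_all
      have "tsum (hcomul B (\<iota> a)) (\<lambda>p q. lC (\<pi> (hmul B y q)) * lA (r (hmul B x p)))
          = tsum (tmap id \<pi> (hcomul B (\<iota> a))) (\<lambda>p q. lC (hmul C (\<pi> y) q) * lA (r (hmul B x p)))"
        using v a by (simp add: tsum_tmap[OF F _ lpi] pimul cong: tsum_cong)
      also have "tmap id \<pi> (hcomul B (\<iota> a)) = tens (\<iota> a) (hone C)"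
        using coinv a by blast
      finally show "tsum (hcomul B (\<iota> a)) (\<lambda>p q. lC (\<pi> (hmul B y q)) * lA (r (hmul B x p))) = lC (\<pi> y) * ?G x"
        using v a by (simp add: tsum_tens[OF F])
    qed
    also have "\<dots> = tsum (tmap id \<pi> (hcomul B (\<phi> c))) (\<lambda>x w. ?G x * lC w)"
      using c by (subst tsum_tmap[OF bilin_prod[OF G C.is_integral_lfun[OF lC]] _ lpi]) (simp_all add: mult.commute)
    also have "\<dots> = tsum (hcomul C c) (\<lambda>x w. ?G (\<phi> x) * lC w)"
      using c by (simp add: phic[symmetric] tsum_tmap[OF bilin_prod[OF G C.is_integral_lfun[OF lC]] phi(1)])
    also have "\<dots> = lC c * ?G (\<phi> (hone C))"
      using c by (intro C.is_integral_eq[OF lC lfun_comp[OF G phi(1)]])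
    finally show ?thesis using a by (simp add: phi(2) r(2))
  qed
  then have "lA (r (E (hmul B (\<phi> c) (\<iota> a)))) \<noteq> 0" using a c by simp
  moreover have "hmul B (\<phi> c) (\<iota> a) \<in> vecs" using a c by simp
  ultimately show ?thesis using cofrob_iff_integral[OF B] by blast
qed

theorem theorem2p11:
  fixes A :: "('a, 'k::field) hopf" and B :: "('b, 'k) hopf" and C :: "('c, 'k) hopf"
    and \<iota> :: "('a \<Rightarrow> 'k) \<Rightarrow> ('b \<Rightarrow> 'k)" and \<pi> :: "('b \<Rightarrow> 'k) \<Rightarrow> ('c \<Rightarrow> 'k)"
  assumes "hopf_alg A" and "hopf_alg B" and "hopf_alg C"
    and "hopf_map A B \<iota>" and "hopf_map B C \<pi>"
    and "exact_seq A B C \<iota> \<pi>"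
    and "faithfully_coflat B C \<pi>"
  shows "cofrob B \<longleftrightarrow> cofrob A \<and> cofrob C"
proof -
  have "inj_on \<iota> vecs" using assms(6) by (simp add: exact_seq_def)
  then show ?thesis
    using cofrob_subalgebra[OF assms(1,2,4)] cofrob_quotient[OF assms(2,3,5,7)] cofrob_extension[OF assms] by blast
qed

end
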